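(* There is a deterministic distributed algorithm (in the LOCAL model) of round complexity $O(\log^3 n)$ that, given an $n$-vertex planar graph $G$, (1) finds a $6$-list-coloring of $G$ (and in particular a $6$-coloring); (2) finds a $4$-list-coloring of $G$ (and in particular a $4$-coloring) if $G$ is triangle-free; (3) finds a $3$-list-coloring of $G$ (and in particular a $3$-coloring) if $G$ has girth at least $6$.
   Context: Graphs are finite and simple. The girth of a graph is the length of a shortest cycle in it. A coloring assigns colors to vertices so that adjacent vertices get different colors; a $k$-coloring is a coloring with colors from $1,\ldots,k$. A $k$-list-assignment is a family of lists of colors $(L(v))_{v\in G}$ with $|L(v)|\ge k$ for every vertex $v$; an $L$-list-coloring of $G$ is a coloring $c$ with $c(v)\in L(v)$ for every vertex $v$. An algorithm "finds a $k$-list-coloring of $G$" if for any $k$-list-assignment $L$ it finds an $L$-list-coloring of $G$. LOCAL model: each node of an $n$-vertex graph $G$ has a unique identifier (an integer between $1$ and $n$) and exchanges messages with its neighbors in synchronous rounds. There is no bound on message size and nodes have infinite computational power. Initially each node knows only its own identifier, the number $n$ of vertices, the number $k\in\{6,4,3\}$ of colors of the relevant case, and its own list of colors. At the end each vertex must output its own color. The round complexity is the number of rounds until every vertex has chosen its output; with round complexity $r$, the output of each vertex depends only on the labelled ball of radius $r$ around it. *)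

theory Defs
  imports "HOL-Analysis.Analysis" "HOL-Library.Landau_Symbols" "HOL-Library.Extended_Nat"
begin

section \<open>Finite simple graphs\<close>

definition simple_graph :: "'v set \<Rightarrow> 'v set set \<Rightarrow> bool" where
  "simple_graph V E \<longleftrightarrow> finite V \<and> (\<forall>e\<in>E. e \<subseteq> V \<and> card e = 2)"

text \<open>A cycle is given by the list of its vertices in cyclic order; its length is the length of
  that list.\<close>

definition is_cycle :: "'v set \<Rightarrow> 'v set set \<Rightarrow> 'v list \<Rightarrow> bool" where
  "is_cycle V E xs \<longleftrightarrow>
     set xs \<subseteq> V \<and> distinct xs \<and> 3 \<le> length xs \<and>
     (\<forall>i<length xs. {xs ! i, xs ! (Suc i mod length xs)} \<in> E)"

text \<open>The girth of a forest is \<^term>\<open>\<infinity>::enat\<close>, the infimum of the empty set.\<close>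

definition girth :: "'v set \<Rightarrow> 'v set set \<Rightarrow> enat" where
  "girth V E = (INF xs\<in>{xs. is_cycle V E xs}. enat (length xs))"

definition triangle_free :: "'v set \<Rightarrow> 'v set set \<Rightarrow> bool" where
  "triangle_free V E \<longleftrightarrow>
     \<not> (\<exists>u\<in>V. \<exists>v\<in>V. \<exists>w\<in>V. {u, v} \<in> E \<and> {v, w} \<in> E \<and> {u, w} \<in> E)"

text \<open>A graph is planar if it can be drawn in the plane: vertices are distinct points, each edge
  is an arc joining its two ends and avoiding all other vertices, and two edges meet only in
  common ends.\<close>

definition planar :: "'v set \<Rightarrow> 'v set set \<Rightarrow> bool" where
  "planar V E \<longleftrightarrow>
     (\<exists>(p :: 'v \<Rightarrow> complex) (\<gamma> :: 'v set \<Rightarrow> real \<Rightarrow> complex).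
        inj_on p V \<and>
        (\<forall>e\<in>E. arc (\<gamma> e) \<and> {pathstart (\<gamma> e), pathfinish (\<gamma> e)} = p ` e \<and>
               path_image (\<gamma> e) \<inter> p ` V = p ` e) \<and>
        (\<forall>e\<in>E. \<forall>f\<in>E. e \<noteq> f \<longrightarrow> path_image (\<gamma> e) \<inter> path_image (\<gamma> f) \<subseteq> p ` (e \<inter> f)))"


section \<open>Colorings\<close>

definition coloring :: "'v set \<Rightarrow> 'v set set \<Rightarrow> ('v \<Rightarrow> 'c) \<Rightarrow> bool" where
  "coloring V E c \<longleftrightarrow> (\<forall>u\<in>V. \<forall>v\<in>V. {u, v} \<in> E \<longrightarrow> c u \<noteq> c v)"

definition k_coloring :: "nat \<Rightarrow> 'v set \<Rightarrow> 'v set set \<Rightarrow> ('v \<Rightarrow> nat) \<Rightarrow> bool" where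
  "k_coloring k V E c \<longleftrightarrow> coloring V E c \<and> (\<forall>v\<in>V. c v \<in> {1..k})"

text \<open>Infinite lists are allowed; they need a separate case because \<^const>\<open>card\<close> is 0 on them.\<close>

definition list_assignment :: "nat \<Rightarrow> 'v set \<Rightarrow> ('v \<Rightarrow> 'c set) \<Rightarrow> bool" where
  "list_assignment k V L \<longleftrightarrow> (\<forall>v\<in>V. infinite (L v) \<or> k \<le> card (L v))"

definition list_coloring ::
    "('v \<Rightarrow> 'c set) \<Rightarrow> 'v set \<Rightarrow> 'v set set \<Rightarrow> ('v \<Rightarrow> 'c) \<Rightarrow> bool" where
  "list_coloring L V E c \<longleftrightarrow> coloring V E c \<and> (\<forall>v\<in>V. c v \<in> L v)"


section \<open>The LOCAL model\<close>

text \<open>Local states and messages are finite trees over natural numbers and lists of colors. One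
  cannot quantify existentially over types, so a fixed type is needed; this one can encode
  everything a node can have learned after finitely many rounds (identifiers, lists of colors,
  topology), so it is no restriction on the algorithms.\<close>

datatype 'c data = Num nat | Colors "'c set" | Tree "'c data list"

text \<open>The components are arbitrary functions (unbounded computational power, no bound on message
  size). Their arguments are:
  \<^item> \<open>init n k i C\<close>: the number of vertices, the number of colors of the relevant case, the
    identifier of the node, and its list of colors;
  \<^item> \<open>send s j\<close>: the message to the neighbor with identifier \<open>j\<close>, if there is one, sent in state
    \<open>s\<close>. The sender need not know \<open>j\<close>: the state only fixes what any potential neighbor would
    receive;
  \<^item> \<open>receive s M\<close>: the new state, where \<open>M\<close> consists of the received messages, each paired with
    the identifier of its sender;
  \<^item> \<open>decide s\<close>: the color chosen in state \<open>s\<close>, or \<^const>\<open>None\<close> if the node has not chosen yet.\<close>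

record 'c local_algorithm =
  init :: "nat \<Rightarrow> nat \<Rightarrow> nat \<Rightarrow> 'c set \<Rightarrow> 'c data"
  send :: "'c data \<Rightarrow> nat \<Rightarrow> 'c data"
  receive :: "'c data \<Rightarrow> (nat \<times> 'c data) set \<Rightarrow> 'c data"
  decide :: "'c data \<Rightarrow> 'c option"

definition identifiers :: "'v set \<Rightarrow> ('v \<Rightarrow> nat) \<Rightarrow> bool" where
  "identifiers V ident \<longleftrightarrow> inj_on ident V \<and> ident ` V \<subseteq> {1..card V}"

primrec state_after ::
    "'c local_algorithm \<Rightarrow> nat \<Rightarrow> 'v set \<Rightarrow> 'v set set \<Rightarrow> ('v \<Rightarrow> nat) \<Rightarrow> ('v \<Rightarrow> 'c set) \<Rightarrow>
     nat \<Rightarrow> 'v \<Rightarrow> 'c data" where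
  "state_after A k V E ident L 0 = (\<lambda>v. init A (card V) k (ident v) (L v))"
| "state_after A k V E ident L (Suc t) =
     (\<lambda>v. receive A (state_after A k V E ident L t v)
            {(ident u, send A (state_after A k V E ident L t u) (ident v)) | u. {u, v} \<in> E})"

definition decided_by ::
    "'c local_algorithm \<Rightarrow> nat \<Rightarrow> 'v set \<Rightarrow> 'v set set \<Rightarrow> ('v \<Rightarrow> nat) \<Rightarrow> ('v \<Rightarrow> 'c set) \<Rightarrow>
     nat \<Rightarrow> 'v \<Rightarrow> bool" where
  "decided_by A k V E ident L t v \<longleftrightarrow>
     (\<exists>s\<le>t. decide A (state_after A k V E ident L s v) \<noteq> None)"

text \<open>The first choice of a node is its final output; nodes may go on relaying messages
  afterwards.\<close>

definition output_color ::
    "'c local_algorithm \<Rightarrow> nat \<Rightarrow> 'v set \<Rightarrow> 'v set set \<Rightarrow> ('v \<Rightarrow> nat) \<Rightarrow> ('v \<Rightarrow> 'c set) \<Rightarrow>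
     'v \<Rightarrow> 'c" where
  "output_color A k V E ident L v =
     the (decide A (state_after A k V E ident L
       (LEAST t. decide A (state_after A k V E ident L t v) \<noteq> None) v))"

text \<open>In the next two definitions \<open>T n\<close> bounds the number of rounds on \<open>n\<close>-vertex graphs, and
  \<open>P\<close> is the class of graphs on which the algorithm has to work.\<close>

definition finds_list_coloring ::
    "'c local_algorithm \<Rightarrow> (nat \<Rightarrow> nat) \<Rightarrow> nat \<Rightarrow> ('v set \<Rightarrow> 'v set set \<Rightarrow> bool) \<Rightarrow> bool" where
  "finds_list_coloring A T k P \<longleftrightarrow>
     (\<forall>V E ident L.
        simple_graph V E \<and> P V E \<and> identifiers V ident \<and> list_assignment k V L \<longrightarrow>
        (\<forall>v\<in>V. decided_by A k V E ident L (T (card V)) v) \<and>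
        list_coloring L V E (output_color A k V E ident L))"

text \<open>For a \<open>k\<close>-coloring there are no lists in the input, so every node starts with the list
  of colors \<open>1, \<dots>, k\<close>.\<close>

definition finds_coloring ::
    "nat local_algorithm \<Rightarrow> (nat \<Rightarrow> nat) \<Rightarrow> nat \<Rightarrow> ('v set \<Rightarrow> 'v set set \<Rightarrow> bool) \<Rightarrow> bool" where
  "finds_coloring A T k P \<longleftrightarrow>
     (\<forall>V E ident.
        simple_graph V E \<and> P V E \<and> identifiers V ident \<longrightarrow>
        (\<forall>v\<in>V. decided_by A k V E ident (\<lambda>_. {1..k}) (T (card V)) v) \<and>
        k_coloring k V E (output_color A k V E ident (\<lambda>_. {1..k})))"

end

(*
  Let k be 6, 4 or 3, the number of colors. All subgraphs have average degree below k. A vertex of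
  degree at most k is happy if every partial list coloring can be completed on the ball of radius
  58 log n around it, taken in the graph of the vertices of degree at most k. If a ball contains a
  vertex of degree below k, or an even cycle one of whose vertices has no chord, then it can be
  completed; planarity shows that balls without these have average degree at most k - 1/5. So if few
  vertices were happy, the others would contain a dense subgraph in which balls grow by a factor
  59/58 per step, which is impossible up to radius 58 log n. Hence a fraction 1/487 of the vertices
  is happy, and after 487 log n rounds of removing the happy vertices nothing is left.

  The layers are colored in reverse order. To extend a coloring to a layer A, choose a subset S of A
  with disjoint, non-adjacent balls that dominates A within distance O(log^2 n) (by comparing the
  identifiers bit by bit), uncolor all vertices of degree at most k within that distance of S, color
  them again in the order of decreasing distance to S, ties being broken by a coloring with 7 colors,
  and finally complete the balls around S. Each extension takes O(log^2 n) rounds.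

  The edge bounds for plane graphs come from the Jordan curve theorem: an ear inside a cycle splits
  the inside into two regions, and an inversion exchanges the inside and the outside.
*)
theory Submission
  imports Defs
begin

text \<open>Complete graphs are the obstacle to completion: from four vertices on they contain even
  cycles, yet they need not be colorable from lists of the size of the degrees. Asking for a vertex
  without a chord keeps them out, and balls without such a cycle are still sparse. They have girth
  at least 7 if k = 3 and at least 5 if k = 4; if k = 6, breadth-first levels give average degree at
  most 5. The tightest case is k = 3, where girth 7 yields 14/5 = 3 - 1/5. If happy vertices are
  rare, the unhappy ones of degree at most k span a graph of average degree at least k - 1/10. The
  gap of 1/10 that is left makes a ball B grow by at least |B| / (10k - 2) vertices per step, which
  for k <= 6 is the factor 59/58; doubling takes at most 58 steps, whence the radius 58 log n. Balls
  of happy vertices overlap and cannot all be completed at once. What makes the detour through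
  uncoloring work is that a vertex of degree at most k always finds a color while one of its
  neighbors is uncolored.\<close>

section \<open>Edge bounds for plane graphs of given girth\<close>

fun path_edges :: "'v list \<Rightarrow> 'v set set" where
  "path_edges (x # y # zs) = insert {x, y} (path_edges (y # zs))"
| "path_edges _ = {}"

definition cycle_edges :: "'v list \<Rightarrow> 'v set set" where
  "cycle_edges xs = insert {last xs, hd xs} (path_edges xs)"

definition cycle_in :: "'v set set \<Rightarrow> 'v list \<Rightarrow> bool" where
  "cycle_in E xs \<longleftrightarrow> distinct xs \<and> 3 \<le> length xs \<and> cycle_edges xs \<subseteq> E"

lemma finite_path_edges [simp]: "finite (path_edges xs)"
  by (induction xs rule: path_edges.induct) auto

lemma path_edges_subset: "e \<in> path_edges xs \<Longrightarrow> e \<subseteq> set xs"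
  by (induction xs rule: path_edges.induct) auto

lemma path_edges_Cons: "ys \<noteq> [] \<Longrightarrow> path_edges (x # ys) = insert {x, hd ys} (path_edges ys)"
  by (cases ys) auto

lemma path_edges_append:
  "xs \<noteq> [] \<Longrightarrow> ys \<noteq> [] \<Longrightarrow>
   path_edges (xs @ ys) = insert {last xs, hd ys} (path_edges xs \<union> path_edges ys)"
  by (induction xs rule: path_edges.induct) (auto simp: path_edges_Cons)

lemma path_edges_prefix: "path_edges (us @ [w]) \<subseteq> path_edges (us @ w # rs)"
  using path_edges_append[of "us @ [w]" rs] by (cases "rs = []") auto

lemma path_edges_rev [simp]: "path_edges (rev xs) = path_edges xs"
proof (induction xs)
  case (Cons x xs)
  then show ?case
    by (cases "xs = []") (auto simp: path_edges_append path_edges_Cons last_rev)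
qed simp

lemma path_edges_conv_nth:
  "path_edges xs = {{xs ! i, xs ! Suc i} | i. Suc i < length xs}"
proof (induction xs rule: path_edges.induct)
  case (1 x y zs)
  have "{{(x # y # zs) ! i, (x # y # zs) ! Suc i} | i. Suc i < length (x # y # zs)} =
      insert {x, y} {{(y # zs) ! i, (y # zs) ! Suc i} | i. Suc i < length (y # zs)}"
    (is "?A = insert _ ?B")
  proof (intro equalityI subsetI)
    fix e assume "e \<in> ?A"
    then obtain i where "e = {(x # y # zs) ! i, (x # y # zs) ! Suc i}" "Suc i < length (x # y # zs)"
      by blast
    then show "e \<in> insert {x, y} ?B"
      by (cases i) auto
  next
    fix e assume "e \<in> insert {x, y} ?B"
    then consider "e = {x, y}" |
      i where "e = {(y # zs) ! i, (y # zs) ! Suc i}" "Suc i < length (y # zs)"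
      by blast
    then show "e \<in> ?A"
    proof cases
      case 1
      then show ?thesis by (intro CollectI exI[of _ 0]) auto
    next
      case (2 i)
      then show ?thesis by (intro CollectI exI[of _ "Suc i"]) auto
    qed
  qed
  with 1 show ?case by simp
qed auto

lemma Union_path_edges: "2 \<le> length xs \<Longrightarrow> \<Union>(path_edges xs) = set xs"
proof (induction xs rule: path_edges.induct)
  case (1 x y zs)
  then show ?case by (cases zs) auto
qed auto

lemma card_path_edges: "distinct xs \<Longrightarrow> card (path_edges xs) = length xs - 1"
proof (induction xs rule: path_edges.induct)
  case (1 x y zs)
  have "{x, y} \<notin> path_edges (y # zs)"
    using 1(2) path_edges_subset[of "{x, y}" "y # zs"] by auto
  with 1 show ?case by simp
qed auto

text \<open>Consequently the edge that closes a cycle of length at least 3 is not yet among its path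
  edges.\<close>

lemma path_edges_ends: "distinct (a # vs @ [b]) \<Longrightarrow> {a, b} \<in> path_edges (a # vs @ [b]) \<Longrightarrow> vs = []"
proof (cases vs)
  case (Cons v vs')
  assume *: "distinct (a # vs @ [b])" "{a, b} \<in> path_edges (a # vs @ [b])"
  then have "{a, b} \<noteq> {a, v}" using Cons by (auto simp: doubleton_eq_iff)
  with * Cons path_edges_subset[of "{a, b}" "v # vs' @ [b]"] show ?thesis by auto
qed auto

lemma cycle_edges_conv_nth:
  assumes "xs \<noteq> []"
  shows "cycle_edges xs = {{xs ! i, xs ! (Suc i mod length xs)} | i. i < length xs}"
proof (intro equalityI subsetI)
  fix e assume "e \<in> cycle_edges xs"
  then consider "e = {last xs, hd xs}" | i where "e = {xs ! i, xs ! Suc i}" "Suc i < length xs"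
    by (auto simp: cycle_edges_def path_edges_conv_nth)
  then show "e \<in> {{xs ! i, xs ! (Suc i mod length xs)} | i. i < length xs}"
  proof cases
    case 1
    with assms show ?thesis
      by (intro CollectI exI[of _ "length xs - 1"]) (auto simp: last_conv_nth hd_conv_nth)
  next
    case (2 i)
    then show ?thesis by (intro CollectI exI[of _ i]) auto
  qed
next
  fix e assume "e \<in> {{xs ! i, xs ! (Suc i mod length xs)} | i. i < length xs}"
  then obtain i where i: "e = {xs ! i, xs ! (Suc i mod length xs)}" "i < length xs" by blast
  show "e \<in> cycle_edges xs"
  proof (cases "Suc i < length xs")
    case True
    with i show ?thesis by (auto simp: cycle_edges_def path_edges_conv_nth)
  next
    case False
    with i have "i = length xs - 1" by auto
    with i assms show ?thesis by (auto simp: cycle_edges_def last_conv_nth hd_conv_nth)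
  qed
qed

lemma Union_cycle_edges: "3 \<le> length xs \<Longrightarrow> \<Union>(cycle_edges xs) = set xs"
  using Union_path_edges[of xs] by (cases xs) (auto simp: cycle_edges_def)

lemma finite_cycle_edges [simp]: "finite (cycle_edges xs)"
  by (simp add: cycle_edges_def)

lemma card_cycle_edges: "distinct xs \<Longrightarrow> 3 \<le> length xs \<Longrightarrow> card (cycle_edges xs) = length xs"
proof -
  assume *: "distinct xs" "3 \<le> length xs"
  obtain a vs where xs1: "xs = a # vs" using * by (cases xs) auto
  obtain ws b where "vs = ws @ [b]" using * xs1 by (cases vs rule: rev_cases) auto
  with xs1 have xs: "xs = a # ws @ [b]" by simp
  have "{last xs, hd xs} \<notin> path_edges xs"
    using path_edges_ends[of a ws b] * xs by (auto simp: insert_commute)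
  with * show ?thesis by (simp add: cycle_edges_def card_path_edges)
qed

lemma cycle_edges_split:
  assumes "distinct xs" "3 \<le> length xs" "a \<in> set xs" "b \<in> set xs" "a \<noteq> b"
  obtains vs ws where "distinct (a # vs @ [b])" "distinct (a # ws @ [b])"
    "path_edges (a # vs @ [b]) \<union> path_edges (a # ws @ [b]) = cycle_edges xs"
    "path_edges (a # vs @ [b]) \<inter> path_edges (a # ws @ [b]) = {}"
    "set vs \<inter> set ws = {}" "set xs = insert a (insert b (set vs \<union> set ws))"
    "length xs = length vs + length ws + 2"
proof -
  have main: "\<exists>vs ws. distinct (a # vs @ [b]) \<and> distinct (a # ws @ [b]) \<and>
    path_edges (a # vs @ [b]) \<union> path_edges (a # ws @ [b]) = cycle_edges xs \<and>
    set vs \<inter> set ws = {} \<and> set xs = insert a (insert b (set vs \<union> set ws)) \<and>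
    length xs = length vs + length ws + 2"
  proof -
    obtain us rs where us: "xs = us @ a # rs" using assms by (meson split_list)
    consider "b \<in> set rs" | "b \<in> set us" using assms us by auto
    then show ?thesis
    proof cases
      case 1
      then obtain vs ws where rs: "rs = vs @ b # ws" by (meson split_list)
      have "path_edges (a # vs @ [b]) \<union> path_edges (a # (rev us @ rev ws) @ [b]) = cycle_edges xs"
      proof -
        have "path_edges (a # (rev us @ rev ws) @ [b]) = path_edges (rev (a # (rev us @ rev ws) @ [b]))"
          by (rule path_edges_rev[symmetric])
        also have "\<dots> = path_edges ((b # ws) @ (us @ [a]))" by simp
        finally show ?thesis unfolding us rs cycle_edges_def
          by (cases "us = []"; cases "ws = []"; cases "vs = []")
            (auto simp: path_edges_append path_edges_Cons insert_commute)
      qed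
      with assms show ?thesis unfolding us rs
        by (intro exI[of _ vs] exI[of _ "rev us @ rev ws"]) auto
    next
      case 2
      then obtain ws vs where rs: "us = ws @ b # vs" by (meson split_list)
      have "path_edges (a # rev vs @ [b]) \<union> path_edges (a # (rs @ ws) @ [b]) = cycle_edges xs"
      proof -
        have "path_edges (a # rev vs @ [b]) = path_edges (rev (a # rev vs @ [b]))"
          by (rule path_edges_rev[symmetric])
        also have "\<dots> = path_edges (b # vs @ [a])" by simp
        finally show ?thesis unfolding us rs cycle_edges_def
          by (cases "rs = []"; cases "ws = []"; cases "vs = []")
            (auto simp: path_edges_append path_edges_Cons insert_commute)
      qed
      with assms show ?thesis unfolding us rs
        by (intro exI[of _ "rev vs"] exI[of _ "rs @ ws"]) auto
    qed
  qed
  then obtain vs ws where *: "distinct (a # vs @ [b])" "distinct (a # ws @ [b])"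
    "path_edges (a # vs @ [b]) \<union> path_edges (a # ws @ [b]) = cycle_edges xs"
    "set vs \<inter> set ws = {}" "set xs = insert a (insert b (set vs \<union> set ws))"
    "length xs = length vs + length ws + 2" by blast
  \<comment> \<open>Disjointness is obtained by counting: the two arcs have
    \<open>length vs + 1\<close> and \<open>length ws + 1\<close> edges, together as many as the
    whole cycle.\<close>
  have "card (path_edges (a # vs @ [b]) \<union> path_edges (a # ws @ [b])) = length xs"
    using * assms by (simp add: card_cycle_edges)
  moreover have "card (path_edges (a # vs @ [b])) = length vs + 1" "card (path_edges (a # ws @ [b])) = length ws + 1"
    using card_path_edges[OF *(1)] card_path_edges[OF *(2)] by simp_all
  ultimately have "card (path_edges (a # vs @ [b]) \<inter> path_edges (a # ws @ [b])) = 0"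
    using * card_Un_Int[of "path_edges (a # vs @ [b])" "path_edges (a # ws @ [b])"] by simp
  then have "path_edges (a # vs @ [b]) \<inter> path_edges (a # ws @ [b]) = {}" by simp
  with * that show ?thesis by blast
qed

lemma cycle_edges_join:
  assumes "distinct (a # vs @ [b])" "distinct (a # ws @ [b])" "set vs \<inter> set ws = {}"
    "path_edges (a # vs @ [b]) \<inter> path_edges (a # ws @ [b]) = {}"
  obtains xs where "distinct xs" "3 \<le> length xs" "length xs = length vs + length ws + 2"
    "cycle_edges xs = path_edges (a # vs @ [b]) \<union> path_edges (a # ws @ [b])"
    "set xs = insert a (insert b (set vs \<union> set ws))"
proof
  let ?xs = "(a # vs @ [b]) @ rev ws"
  show "distinct ?xs" using assms by auto
  \<comment> \<open>If both were empty, the two paths would share the edge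
    \<open>{a, b}\<close>.\<close>
  have "vs \<noteq> [] \<or> ws \<noteq> []" using assms by auto
  then show "3 \<le> length ?xs" by (cases vs; cases ws) auto
  show "length ?xs = length vs + length ws + 2" by simp
  show "set ?xs = insert a (insert b (set vs \<union> set ws))" by auto
  have "path_edges (a # ws @ [b]) = path_edges (rev (a # ws @ [b]))"
    by (rule path_edges_rev[symmetric])
  also have "\<dots> = path_edges (b # rev ws @ [a])" by simp
  finally have *: "path_edges (a # ws @ [b]) = path_edges (b # rev ws @ [a])" .
  have "cycle_edges ?xs = path_edges (a # vs @ [b]) \<union> path_edges (b # rev ws @ [a])"
    by (cases "ws = []"; cases "vs = []")
      (auto simp: cycle_edges_def path_edges_append path_edges_Cons insert_commute hd_rev last_rev)
  then show "cycle_edges ?xs = path_edges (a # vs @ [b]) \<union> path_edges (a # ws @ [b])"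
    using * by simp
qed

section \<open>A fixed drawing; paths and cycles as arcs and closed curves\<close>

locale plane_drawing =
  fixes p :: "'v \<Rightarrow> complex" and \<gamma> :: "'v set \<Rightarrow> real \<Rightarrow> complex" and V :: "'v set" and E :: "'v set set"
  assumes inj_p: "inj_on p V"
    and edge: "\<And>e. e \<in> E \<Longrightarrow> e \<subseteq> V \<and> card e = 2"
    and arc_edge: "\<And>e. e \<in> E \<Longrightarrow> arc (\<gamma> e)"
    and ends_edge: "\<And>e. e \<in> E \<Longrightarrow> {pathstart (\<gamma> e), pathfinish (\<gamma> e)} = p ` e"
    and image_edge: "\<And>e. e \<in> E \<Longrightarrow> path_image (\<gamma> e) \<inter> p ` V = p ` e"
    and cross_edge: "\<And>e f. e \<in> E \<Longrightarrow> f \<in> E \<Longrightarrow> e \<noteq> f \<Longrightarrow>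
      path_image (\<gamma> e) \<inter> path_image (\<gamma> f) \<subseteq> p ` (e \<inter> f)"
begin

definition drawn :: "'v set set \<Rightarrow> complex set" where
  "drawn K = (\<Union>e\<in>K. path_image (\<gamma> e))"

text \<open>Without its ends an edge is connected and misses all other edges, so it lies in a single
  region of their complement.\<close>

definition open_edge :: "'v set \<Rightarrow> complex set" where
  "open_edge e = path_image (\<gamma> e) - p ` e"

lemma drawn_Un: "drawn (K \<union> K') = drawn K \<union> drawn K'"
  by (auto simp: drawn_def)

lemma p_in_drawn_iff:
  assumes "K \<subseteq> E" "v \<in> V"
  shows "p v \<in> drawn K \<longleftrightarrow> v \<in> \<Union>K"
proof
  assume "p v \<in> drawn K"
  then obtain e where e: "e \<in> K" "p v \<in> path_image (\<gamma> e)" by (auto simp: drawn_def)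
  with assms have "e \<in> E" by auto
  with e assms have "p v \<in> p ` e" using image_edge[of e] by auto
  with assms inj_p edge[OF \<open>e \<in> E\<close>] have "v \<in> e" by (auto dest: inj_onD)
  with e show "v \<in> \<Union>K" by auto
next
  assume "v \<in> \<Union>K"
  then obtain e where e: "e \<in> K" "v \<in> e" by auto
  with assms have "p v \<in> path_image (\<gamma> e)" using image_edge[of e] by auto
  with e show "p v \<in> drawn K" by (auto simp: drawn_def)
qed

lemma drawn_Int:
  assumes "K \<subseteq> E" "K' \<subseteq> E" "K \<inter> K' = {}"
  shows "drawn K \<inter> drawn K' \<subseteq> p ` (\<Union>K \<inter> \<Union>K')"
proof
  fix z assume "z \<in> drawn K \<inter> drawn K'"
  then obtain e f where "e \<in> K" "f \<in> K'" "z \<in> path_image (\<gamma> e) \<inter> path_image (\<gamma> f)"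
    by (auto simp: drawn_def)
  moreover from this assms have "e \<noteq> f" "e \<in> E" "f \<in> E" by auto
  ultimately show "z \<in> p ` (\<Union>K \<inter> \<Union>K')" using cross_edge[of e f] by blast
qed

lemma open_edge_drawn:
  assumes "e \<in> E" "K \<subseteq> E" "e \<notin> K"
  shows "open_edge e \<inter> drawn K = {}"
proof -
  have "drawn {e} \<inter> drawn K \<subseteq> p ` e" using drawn_Int[of "{e}" K] assms by auto
  then show ?thesis by (auto simp: open_edge_def drawn_def)
qed

lemma connected_open_edge: "e \<in> E \<Longrightarrow> connected (open_edge e)"
  using connected_simple_path_endless[of "\<gamma> e"] arc_edge[of e] ends_edge[of e]
  by (auto simp: open_edge_def arc_simple_path)

text \<open>Through this, information on the region containing an open edge passes to the ends of
  the edge.\<close>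

lemma edge_closure_open_edge:
  assumes "e \<in> E"
  shows "path_image (\<gamma> e) \<subseteq> closure (open_edge e)"
proof -
  have "closure (path_image (\<gamma> e) - {pathstart (\<gamma> e), pathfinish (\<gamma> e)}) = path_image (\<gamma> e)"
  proof (rule antisym)
    show "closure (path_image (\<gamma> e) - {pathstart (\<gamma> e), pathfinish (\<gamma> e)}) \<subseteq> path_image (\<gamma> e)"
      using arc_edge[OF assms] by (meson Diff_subset arc_imp_path closed_path_image closure_minimal)
    have "path_image (\<gamma> e) - {pathstart (\<gamma> e), pathfinish (\<gamma> e)} \<supseteq> \<gamma> e ` {0<..<1}"
      using arc_edge[OF assms] by (fastforce simp: path_image_def arc_def inj_on_def pathstart_def pathfinish_def)
    moreover have "\<gamma> e ` closure {0<..<1::real} \<subseteq> closure (\<gamma> e ` {0<..<1})"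
      using arc_edge[OF assms] by (intro image_closure_subset) (auto simp: arc_def path_def intro: closure_subset[THEN subsetD])
    ultimately show "path_image (\<gamma> e) \<subseteq> closure (path_image (\<gamma> e) - {pathstart (\<gamma> e), pathfinish (\<gamma> e)})"
      unfolding path_image_def by (metis closure_greaterThanLessThan closure_mono order_trans zero_less_one)
  qed
  then show ?thesis using ends_edge[OF assms] by (simp add: open_edge_def)
qed

lemma open_edge_nonempty: "e \<in> E \<Longrightarrow> open_edge e \<noteq> {}"
  using edge_closure_open_edge[of e] path_image_nonempty[of "\<gamma> e"] by auto

lemma arc_of_path:
  assumes "distinct ws" "2 \<le> length ws" "path_edges ws \<subseteq> E"
  shows "\<exists>g. arc g \<and> pathstart g = p (hd ws) \<and> pathfinish g = p (last ws) \<and>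
    path_image g = drawn (path_edges ws)"
  using assms
proof (induction ws rule: path_edges.induct)
  case (1 x y zs)
  have e: "{x, y} \<in> E" using 1(4) by auto
  have xy: "x \<noteq> y" "x \<in> V" "y \<in> V" using 1(2) edge[OF e] by auto
  then have pxy: "p x \<noteq> p y" using inj_p by (auto dest: inj_onD)
  have "\<exists>g. arc g \<and> pathstart g = p x \<and> pathfinish g = p y \<and> path_image g = drawn {{x, y}}"
  proof (cases "pathstart (\<gamma> {x, y}) = p x")
    case True
    with ends_edge[OF e] pxy have "pathfinish (\<gamma> {x, y}) = p y" by (auto simp: doubleton_eq_iff)
    with True arc_edge[OF e] show ?thesis by (intro exI[of _ "\<gamma> {x, y}"]) (auto simp: drawn_def)
  next
    case False
    with ends_edge[OF e] pxy have "pathstart (\<gamma> {x, y}) = p y" "pathfinish (\<gamma> {x, y}) = p x"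
      by (auto simp: doubleton_eq_iff)
    with False arc_edge[OF e] show ?thesis
      by (intro exI[of _ "reversepath (\<gamma> {x, y})"]) (auto simp: drawn_def arc_reversepath)
  qed
  then obtain g where g: "arc g" "pathstart g = p x" "pathfinish g = p y" "path_image g = drawn {{x, y}}"
    by blast
  show ?case
  proof (cases "zs = []")
    case True
    with g show ?thesis by auto
  next
    case False
    then obtain h where h: "arc h" "pathstart h = p y" "pathfinish h = p (last (y # zs))"
      "path_image h = drawn (path_edges (y # zs))"
      using 1 by (cases zs) auto
    have "{x, y} \<notin> path_edges (y # zs)"
      using 1(2) path_edges_subset[of "{x, y}" "y # zs"] by auto
    then have "drawn {{x, y}} \<inter> drawn (path_edges (y # zs)) \<subseteq> p ` ({x, y} \<inter> set (y # zs))"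
      using drawn_Int[of "{{x, y}}" "path_edges (y # zs)"] 1(4) path_edges_subset[of _ "y # zs"] by fastforce
    also have "\<dots> \<subseteq> {p y}" using 1(2) by auto
    finally have "arc (g +++ h)" using g h by (intro arc_join) auto
    with g h show ?thesis
      by (intro exI[of _ "g +++ h"]) (auto simp: path_image_join drawn_def False)
  qed
qed auto

lemma simple_path_of_cycle:
  assumes "cycle_in E xs"
  obtains g where "simple_path g" "pathfinish g = pathstart g" "path_image g = drawn (cycle_edges xs)"
proof -
  have d: "distinct xs" "3 \<le> length xs" and sub: "cycle_edges xs \<subseteq> E" using assms by (auto simp: cycle_in_def)
  define a b where "a = hd xs" and "b = last xs"
  have ab: "a \<in> set xs" "b \<in> set xs" "a \<noteq> b"
  proof -
    obtain x y zs where "xs = x # y # zs" using d by (cases xs rule: path_edges.cases) auto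
    with d show "a \<in> set xs" "b \<in> set xs" "a \<noteq> b" by (auto simp: a_def b_def split: if_splits)
  qed
  from cycle_edges_split[OF d ab] obtain vs ws where *: "distinct (a # vs @ [b])" "distinct (a # ws @ [b])"
    "path_edges (a # vs @ [b]) \<union> path_edges (a # ws @ [b]) = cycle_edges xs"
    "path_edges (a # vs @ [b]) \<inter> path_edges (a # ws @ [b]) = {}" "set vs \<inter> set ws = {}" by metis
  have sub': "path_edges (a # vs @ [b]) \<subseteq> E" "path_edges (a # ws @ [b]) \<subseteq> E" using * sub by auto
  obtain g where g: "arc g" "pathstart g = p a" "pathfinish g = p b" "path_image g = drawn (path_edges (a # vs @ [b]))"
    using arc_of_path[OF *(1) _ sub'(1)] by auto
  obtain h where h: "arc h" "pathstart h = p a" "pathfinish h = p b" "path_image h = drawn (path_edges (a # ws @ [b]))"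
    using arc_of_path[OF *(2) _ sub'(2)] by auto
  have "drawn (path_edges (a # vs @ [b])) \<inter> drawn (path_edges (a # ws @ [b])) \<subseteq> p ` (set (a # vs @ [b]) \<inter> set (a # ws @ [b]))"
    using drawn_Int[OF sub' *(4)] by (simp add: Union_path_edges)
  also have "\<dots> \<subseteq> {p a, p b}" using * by auto
  finally have "simple_path (g +++ reversepath h)"
    using g h by (intro simple_path_join_loop) (auto simp: arc_reversepath)
  moreover have "path_image (g +++ reversepath h) = drawn (cycle_edges xs)"
    using g h *(3) by (simp add: path_image_join drawn_Un[symmetric])
  ultimately show ?thesis using that[of "g +++ reversepath h"] g h by simp
qed

end

section \<open>Ears, pendant parts and leaves\<close>

lemma path_of_rtrancl:
  assumes "(x, y) \<in> {(x, y). {x, y} \<in> F \<and> x \<notin> W \<and> y \<notin> W}\<^sup>*" "x \<notin> W"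
  shows "\<exists>ps. distinct ps \<and> ps \<noteq> [] \<and> hd ps = x \<and> last ps = y \<and> path_edges ps \<subseteq> F \<and> set ps \<inter> W = {}"
  using assms(1)
proof (induction rule: rtrancl_induct)
  case base
  with assms show ?case by (intro exI[of _ "[x]"]) auto
next
  case (step y z)
  then obtain ps where ps: "distinct ps" "ps \<noteq> []" "hd ps = x" "last ps = y" "path_edges ps \<subseteq> F" "set ps \<inter> W = {}"
    by blast
  show ?case
  proof (cases "z \<in> set ps")
    case True
    then obtain us vs where us: "ps = us @ z # vs" by (meson split_list)
    then have "path_edges (us @ [z]) \<subseteq> path_edges ps"
      using path_edges_prefix[of us z vs] by simp
    with ps us show ?thesis
      by (intro exI[of _ "us @ [z]"]) (cases "us = []"; auto)
  next
    case False
    with ps step show ?thesis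
      by (intro exI[of _ "ps @ [z]"]) (auto simp: path_edges_append insert_commute)
  qed
qed

text \<open>\<open>M\<close> is the component of \<open>v\<close> after deleting \<open>W\<close>,
  and \<open>K\<close> consists of the edges meeting \<open>M\<close>. Two attachments of
  \<open>K\<close> in \<open>W\<close> could be joined through \<open>M\<close> by an ear.\<close>

lemma pendant_part:
  assumes F: "\<And>e. e \<in> F \<Longrightarrow> card e = 2" and v: "v \<in> \<Union>F" "v \<notin> W"
    and no_ear: "\<not> (\<exists>a es b. a \<in> W \<and> b \<in> W \<and> a \<noteq> b \<and> distinct (a # es @ [b]) \<and>
       set es \<inter> W = {} \<and> path_edges (a # es @ [b]) \<subseteq> F)"
  obtains M K where "K \<subseteq> F" "K \<noteq> {}" "\<Union>K \<subseteq> M \<union> W" "\<forall>a\<in>\<Union>K \<inter> W. \<forall>b\<in>\<Union>K \<inter> W. a = b"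
    "M \<inter> W = {}" "M \<inter> \<Union>(F - K) = {}" "M \<subseteq> \<Union>F"
proof
  define R where "R = {(x, y). {x, y} \<in> F \<and> x \<notin> W \<and> y \<notin> W}"
  let ?M = "R\<^sup>* `` {v}"
  let ?K = "{e \<in> F. e \<inter> ?M \<noteq> {}}"
  show MW: "?M \<inter> W = {}"
  proof -
    have "y \<notin> W" if "(v, y) \<in> R\<^sup>*" for y
      using that v by (induction rule: rtrancl_induct) (auto simp: R_def)
    then show ?thesis by auto
  qed
  show "?M \<subseteq> \<Union>F"
  proof -
    have "y \<in> \<Union>F" if "(v, y) \<in> R\<^sup>*" for y
      using that v by (induction rule: rtrancl_induct) (auto simp: R_def)
    then show ?thesis by auto
  qed
  have other: "\<exists>m. m \<in> ?M \<and> e = {m, u}" if eu: "e \<in> ?K" "u \<in> e" "u \<notin> ?M" for e u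
  proof -
    obtain m where "m \<in> e" "m \<in> ?M" using eu(1) by blast
    moreover have "card e = 2" using F eu by auto
    ultimately show ?thesis using eu by (auto simp: card_2_iff)
  qed
  show "\<Union>?K \<subseteq> ?M \<union> W"
  proof
    fix u assume "u \<in> \<Union>?K"
    then obtain e where e: "e \<in> ?K" "u \<in> e" by auto
    show "u \<in> ?M \<union> W"
    proof (rule ccontr)
      assume *: "u \<notin> ?M \<union> W"
      then obtain m where m: "m \<in> ?M" "e = {m, u}" using other[OF e] by auto
      then have "(m, u) \<in> R" using * e MW by (auto simp: R_def)
      with m * show False by (auto intro: rtrancl_into_rtrancl)
    qed
  qed
  show "?K \<subseteq> F" "?K \<noteq> {}" "?M \<inter> \<Union>(F - ?K) = {}" using v by auto
  show "\<forall>a\<in>\<Union>?K \<inter> W. \<forall>b\<in>\<Union>?K \<inter> W. a = b"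
  proof (intro ballI, rule ccontr)
    fix a b assume a: "a \<in> \<Union>?K \<inter> W" and b: "b \<in> \<Union>?K \<inter> W"
    assume ab: "a \<noteq> b"
    obtain m1 where m1: "m1 \<in> ?M" "{m1, a} \<in> F" using a other MW by (smt (verit) Int_iff UnionE disjoint_iff mem_Collect_eq)
    obtain m2 where m2: "m2 \<in> ?M" "{m2, b} \<in> F" using b other MW by (smt (verit) Int_iff UnionE disjoint_iff mem_Collect_eq)
    have "sym R" by (auto simp: sym_def R_def insert_commute)
    then have "(m1, m2) \<in> R\<^sup>*" using m1 m2 by (metis ImageE rtrancl_trans singletonD sym_rtrancl symD)
    then obtain ps where ps: "distinct ps" "ps \<noteq> []" "hd ps = m1" "last ps = m2" "path_edges ps \<subseteq> F" "set ps \<inter> W = {}"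
      using path_of_rtrancl[of m1 m2 F W] m1 MW unfolding R_def by blast
    then have "path_edges (a # ps @ [b]) \<subseteq> F"
      using m1 m2 by (auto simp: path_edges_append path_edges_Cons insert_commute)
    moreover have "distinct (a # ps @ [b])" using ps a b ab by auto
    ultimately show False using no_ear a b ab ps by blast
  qed
qed

text \<open>The leaf is the first vertex of a longest path: another neighbor would either prolong
  the path or lie on it and close a cycle.\<close>

lemma leaf_or_cycle:
  assumes F: "finite F" "F \<noteq> {}" "\<And>e. e \<in> F \<Longrightarrow> card e = 2" and no: "\<And>xs. \<not> cycle_in F xs"
  obtains e u where "e \<in> F" "u \<in> e" "u \<notin> \<Union>(F - {e})"
proof -
  define Q where "Q = (\<lambda>xs. distinct xs \<and> 2 \<le> length xs \<and> path_edges xs \<subseteq> F)"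
  have fin: "finite (\<Union>F)" using F by (auto intro!: finite_Union dest: card_ge_0_finite[rotated] intro: card_ge_0_finite)
  have bound: "length xs < Suc (card (\<Union>F))" if "Q xs" for xs
  proof -
    have "set xs \<subseteq> \<Union>F" using that Union_path_edges[of xs] by (auto simp: Q_def)
    then have "card (set xs) \<le> card (\<Union>F)" using fin card_mono by blast
    with that show ?thesis by (simp add: Q_def distinct_card)
  qed
  obtain e0 where "e0 \<in> F" using F by auto
  then obtain x0 y0 where "e0 = {x0, y0}" "x0 \<noteq> y0" using F by (meson card_2_iff)
  with \<open>e0 \<in> F\<close> have "Q [x0, y0]" by (auto simp: Q_def)
  then obtain xs where xs: "Q xs" "\<And>ys. Q ys \<Longrightarrow> length ys \<le> length xs"
    using ex_has_greatest_nat[of Q "[x0, y0]" length "Suc (card (\<Union>F))"] bound by (metis less_imp_le)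
  then obtain x y zs where xyz: "xs = x # y # zs" by (cases xs rule: path_edges.cases) (auto simp: Q_def)
  have "x \<notin> \<Union>(F - {{x, y}})"
  proof
    assume "x \<in> \<Union>(F - {{x, y}})"
    then obtain e where e: "e \<in> F" "x \<in> e" "e \<noteq> {x, y}" by auto
    then obtain w where w: "e = {w, x}" "w \<noteq> x" using F(3)[OF e(1)] by (auto simp: card_2_iff)
    have "w \<in> set xs"
    proof (rule ccontr)
      assume "w \<notin> set xs"
      then have "Q (w # xs)" using xs xyz e w by (auto simp: Q_def)
      then show False using xs(2)[of "w # xs"] by simp
    qed
    with w e xyz have "w \<in> set zs" by auto
    then obtain us rs where zs: "zs = us @ w # rs" by (meson split_list)
    have "path_edges ((x # y # us) @ [w]) \<subseteq> path_edges ((x # y # us) @ w # rs)"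
      by (rule path_edges_prefix)
    then have "cycle_in F (x # y # us @ [w])"
      using xs xyz zs e w by (auto simp: cycle_in_def cycle_edges_def Q_def)
    with no show False by blast
  qed
  moreover have "{x, y} \<in> F" using xs xyz by (auto simp: Q_def)
  ultimately show ?thesis using that[of "{x, y}" x] by auto
qed

text \<open>If the component of an image point \<open>w\<close> were unbounded, its preimage would
  be connected, avoid \<open>S\<close>, and contain both \<open>z\<close> and points arbitrarily
  close to \<open>a\<close>; it would join the outside to the inside.\<close>

lemma inversion_outside_inside:
  fixes S :: "complex set"
  assumes S: "compact S" and a: "a \<in> inside S"
  shows "(\<lambda>z. inverse (z - a)) ` outside S \<subseteq> inside ((\<lambda>z. inverse (z - a)) ` S)"
proof
  let ?f = "\<lambda>z. inverse (z - a)"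
  let ?g = "\<lambda>w. inverse w + a"
  have aS: "a \<notin> S" and ao: "a \<notin> outside S" using a by (auto simp: inside_def outside_def)
  fix w assume "w \<in> ?f ` outside S"
  then obtain z where z: "z \<in> outside S" "w = ?f z" by auto
  then have za: "z \<noteq> a" and zS: "z \<notin> S" using ao by (auto simp: outside_def)
  have wS: "w \<notin> ?f ` S" using z zS za aS by auto
  show "w \<in> inside (?f ` S)"
  proof (rule ccontr)
    assume "w \<notin> inside (?f ` S)"
    let ?U = "connected_component_set (- ?f ` S) w"
    have unb: "\<not> bounded ?U" using \<open>w \<notin> inside (?f ` S)\<close> wS by (auto simp: inside_def)
    have "compact (?f ` S)" using S aS by (intro compact_continuous_image continuous_intros) auto
    then have "open ?U" by (intro open_connected_component) (simp add: compact_imp_closed open_Compl)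
    \<comment> \<open>0 corresponds to the point at infinity and has no preimage. In the plane, an
      open connected set stays connected without one point.\<close>
    then have "connected (?U - {0})" by (intro connected_open_delete) auto
    then have conn: "connected (?g ` (?U - {0}))"
      by (intro connected_continuous_image continuous_intros) auto
    have sub: "?g ` (?U - {0}) \<subseteq> - S"
    proof
      fix y assume "y \<in> ?g ` (?U - {0})"
      then obtain u where u: "u \<in> ?U" "u \<noteq> 0" "y = ?g u" by auto
      then have "u \<notin> ?f ` S" using connected_component_subset by blast
      moreover have "u = ?f y" using u by simp
      ultimately show "y \<in> - S" by auto
    qed
    have zin: "z \<in> ?g ` (?U - {0})"
    proof -
      have "w \<in> ?U" using wS by auto
      moreover have "w \<noteq> 0" "z = ?g w" using z za by auto
      ultimately show ?thesis by blast
    qed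
    have gout: "?g ` (?U - {0}) \<subseteq> outside S"
    proof
      fix y assume "y \<in> ?g ` (?U - {0})"
      then have "connected_component (- S) z y"
        using conn sub zin unfolding connected_component_def by blast
      then show "y \<in> outside S" using outside_same_component z(1) by blast
    qed
    have "open (inside S)" using S by (simp add: compact_imp_closed open_inside)
    then obtain e where e: "e > 0" "ball a e \<subseteq> inside S" using a by (meson openE)
    obtain u where u: "u \<in> ?U" "norm u > 1 / e" using unb by (meson boundedI not_less)
    then have "u \<noteq> 0" using e by auto
    have "norm (inverse u) < e"
      using u e by (metis \<open>u \<noteq> 0\<close> divide_less_eq inverse_eq_divide mult.commute norm_inverse zero_less_norm_iff)
    then have "?g u \<in> ball a e" by (simp add: dist_norm norm_minus_commute)
    moreover have "?g u \<in> outside S" using gout u \<open>u \<noteq> 0\<close> by blast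
    ultimately show False using e inside_Int_outside by blast
  qed
qed

section \<open>Dividing the inside of a cycle by an ear\<close>

context plane_drawing
begin

lemma compact_drawn: "finite K \<Longrightarrow> K \<subseteq> E \<Longrightarrow> compact (drawn K)"
  unfolding drawn_def using arc_edge by (auto intro!: compact_UN compact_path_image arc_imp_path)

lemma vertex_inside:
  assumes K: "finite K" "K \<subseteq> E" and e: "e \<in> E" "open_edge e \<subseteq> inside (drawn K)"
    and v: "v \<in> e" "v \<notin> \<Union>K"
  shows "p v \<in> inside (drawn K)"
proof -
  have "p v \<in> path_image (\<gamma> e)" using image_edge[OF e(1)] v by auto
  also have "\<dots> \<subseteq> closure (inside (drawn K))"
    using edge_closure_open_edge[OF e(1)] closure_mono[OF e(2)] by blast
  also have "\<dots> \<subseteq> drawn K \<union> inside (drawn K)"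
    using compact_drawn[OF K] by (intro closure_inside_subset compact_imp_closed)
  finally show ?thesis using p_in_drawn_iff[OF K(2)] v edge[OF e(1)] by auto
qed

lemma drawn_paths_Int:
  assumes "path_edges (a # vs @ [b]) \<subseteq> E" "path_edges (a # ws @ [b]) \<subseteq> E" "set vs \<inter> set ws = {}"
    "path_edges (a # vs @ [b]) \<inter> path_edges (a # ws @ [b]) = {}"
    "distinct (a # vs @ [b])" "distinct (a # ws @ [b])"
  shows "drawn (path_edges (a # vs @ [b])) \<inter> drawn (path_edges (a # ws @ [b])) = {p a, p b}"
proof (rule antisym)
  have "drawn (path_edges (a # vs @ [b])) \<inter> drawn (path_edges (a # ws @ [b])) \<subseteq> p ` (set (a # vs @ [b]) \<inter> set (a # ws @ [b]))"
    using drawn_Int[OF assms(1,2,4)] by (simp add: Union_path_edges)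
  also have "\<dots> \<subseteq> {p a, p b}" using assms by auto
  finally show "drawn (path_edges (a # vs @ [b])) \<inter> drawn (path_edges (a # ws @ [b])) \<subseteq> {p a, p b}" .
  have "a \<in> \<Union>(path_edges (a # vs @ [b]))" "b \<in> \<Union>(path_edges (a # vs @ [b]))"
     "a \<in> \<Union>(path_edges (a # ws @ [b]))" "b \<in> \<Union>(path_edges (a # ws @ [b]))"
    by (simp_all add: Union_path_edges)
  moreover from this have "a \<in> V" "b \<in> V" using assms(1) edge by blast+
  ultimately show "{p a, p b} \<subseteq> drawn (path_edges (a # vs @ [b])) \<inter> drawn (path_edges (a # ws @ [b]))"
    using p_in_drawn_iff[OF assms(1)] p_in_drawn_iff[OF assms(2)] by auto
qed

text \<open>The two arcs of the cycle and the ear form a theta curve. Every other edge of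
  \<open>F\<close> falls into one of the two smaller regions, being connected and disjoint from the
  ear. The last three facts make the numbers of inner vertices add up; in the sum of the lengths
  each edge of the ear counts twice.\<close>

lemma split_face:
  assumes cyc: "cycle_in E xs" and ab: "a \<in> set xs" "b \<in> set xs" "a \<noteq> b"
    and P: "distinct (a # es @ [b])" "set es \<inter> set xs = {}" "path_edges (a # es @ [b]) \<subseteq> F"
    and F: "F \<subseteq> E" "F \<inter> cycle_edges xs = {}"
    and ins: "\<And>e. e \<in> F \<Longrightarrow> open_edge e \<subseteq> inside (drawn (cycle_edges xs))"
  obtains ys zs F1 F2 where "cycle_in E ys" "cycle_in E zs"
    "length ys + length zs = length xs + 2 * (length es + 1)"
    "F = path_edges (a # es @ [b]) \<union> (F1 \<union> F2)" "path_edges (a # es @ [b]) \<inter> (F1 \<union> F2) = {}" "F1 \<inter> F2 = {}"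
    "F1 \<inter> cycle_edges ys = {}" "F2 \<inter> cycle_edges zs = {}"
    "\<And>e. e \<in> F1 \<Longrightarrow> open_edge e \<subseteq> inside (drawn (cycle_edges ys))"
    "\<And>e. e \<in> F2 \<Longrightarrow> open_edge e \<subseteq> inside (drawn (cycle_edges zs))"
    "(\<Union>F1 - set ys) \<inter> (\<Union>F2 - set zs) = {}"
    "(\<Union>F1 - set ys) \<inter> (set es \<union> set xs) = {}" "(\<Union>F2 - set zs) \<inter> (set es \<union> set xs) = {}"
proof -
  have d: "distinct xs" "3 \<le> length xs" and subc: "cycle_edges xs \<subseteq> E" using cyc by (auto simp: cycle_in_def)
  from cycle_edges_split[OF d ab] obtain vs ws where s: "distinct (a # vs @ [b])" "distinct (a # ws @ [b])"
    "path_edges (a # vs @ [b]) \<union> path_edges (a # ws @ [b]) = cycle_edges xs"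
    "path_edges (a # vs @ [b]) \<inter> path_edges (a # ws @ [b]) = {}"
    "set vs \<inter> set ws = {}" "set xs = insert a (insert b (set vs \<union> set ws))"
    "length xs = length vs + length ws + 2" by metis
  define A1 A2 B where "A1 = path_edges (a # vs @ [b])" and "A2 = path_edges (a # ws @ [b])"
    and "B = path_edges (a # es @ [b])"
  note AB = A1_def A2_def B_def
  have sub: "A1 \<subseteq> E" "A2 \<subseteq> E" "B \<subseteq> E" using s(3) subc P F unfolding AB by auto
  have disj: "A1 \<inter> A2 = {}" "A1 \<inter> B = {}" "A2 \<inter> B = {}" using s(3,4) P(3) F(2) unfolding AB by auto
  have vdisj: "set vs \<inter> set es = {}" "set ws \<inter> set es = {}" using P(2) s(6) by auto
  obtain c1 where c1: "arc c1" "pathstart c1 = p a" "pathfinish c1 = p b" "path_image c1 = drawn A1"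
    using arc_of_path[OF s(1)] sub unfolding AB by auto
  obtain c2 where c2: "arc c2" "pathstart c2 = p a" "pathfinish c2 = p b" "path_image c2 = drawn A2"
    using arc_of_path[OF s(2)] sub unfolding AB by auto
  obtain c where c: "arc c" "pathstart c = p a" "pathfinish c = p b" "path_image c = drawn B"
    using arc_of_path[OF P(1)] sub unfolding AB by auto
  have I: "drawn A1 \<inter> drawn A2 = {p a, p b}" "drawn A1 \<inter> drawn B = {p a, p b}" "drawn A2 \<inter> drawn B = {p a, p b}"
    using drawn_paths_Int sub disj s(1,2,5) P(1) vdisj unfolding AB by blast+
  have Cx: "drawn (cycle_edges xs) = drawn A1 \<union> drawn A2" using s(3) drawn_Un unfolding AB by metis
  \<comment> \<open>The theorem on theta curves asks that the third arc enter the inside; any edge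
    of the ear witnesses this.\<close>
  have ne: "path_image c \<inter> inside (path_image c1 \<union> path_image c2) \<noteq> {}"
  proof -
    obtain e where e: "e \<in> B" by (cases es) (auto simp: B_def)
    then have "e \<in> F" "e \<in> E" using P(3) F(1) by (auto simp: B_def)
    then have "open_edge e \<noteq> {}" "open_edge e \<subseteq> inside (drawn A1 \<union> drawn A2)"
      using open_edge_nonempty ins[of e] unfolding Cx by blast+
    moreover have "open_edge e \<subseteq> drawn B" using e by (auto simp: open_edge_def drawn_def)
    ultimately show ?thesis using c1 c2 c by auto
  qed
  have pab: "p a \<noteq> p b" using c1 arc_distinct_ends by metis
  define I1 I2 where "I1 = inside (drawn A1 \<union> drawn B)" and "I2 = inside (drawn A2 \<union> drawn B)"
  have split: "I1 \<inter> I2 = {}" "I1 \<union> I2 \<union> (drawn B - {p a, p b}) = inside (drawn A1 \<union> drawn A2)"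
  proof -
    have sp: "simple_path c1" "simple_path c2" "simple_path c"
      using c1 c2 c by (simp_all add: arc_imp_simple_path)
    have i: "path_image c1 \<inter> path_image c2 = {p a, p b}" "path_image c1 \<inter> path_image c = {p a, p b}"
      "path_image c2 \<inter> path_image c = {p a, p b}"
      using I c1 c2 c by simp_all
    have "I1 \<inter> I2 = {} \<and> I1 \<union> I2 \<union> (drawn B - {p a, p b}) = inside (drawn A1 \<union> drawn A2)"
      by (rule split_inside_simple_closed_curve[OF sp(1) c1(2,3) sp(2) c2(2,3) sp(3) c(2,3) pab i ne])
        (simp add: c1 c2 c I1_def I2_def)
    then show "I1 \<inter> I2 = {}" "I1 \<union> I2 \<union> (drawn B - {p a, p b}) = inside (drawn A1 \<union> drawn A2)"
      by blast+
  qed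
  obtain ys where ys: "distinct ys" "3 \<le> length ys" "length ys = length vs + length es + 2"
    "cycle_edges ys = A1 \<union> B" "set ys = insert a (insert b (set vs \<union> set es))"
    using cycle_edges_join[OF s(1) P(1) vdisj(1)] disj unfolding AB by metis
  obtain zs where zs: "distinct zs" "3 \<le> length zs" "length zs = length ws + length es + 2"
    "cycle_edges zs = A2 \<union> B" "set zs = insert a (insert b (set ws \<union> set es))"
    using cycle_edges_join[OF s(2) P(1) vdisj(2)] disj unfolding AB by metis
  have cy: "cycle_in E ys" "cycle_in E zs" using ys zs sub by (auto simp: cycle_in_def)
  have Iy: "inside (drawn (cycle_edges ys)) = I1" and Iz: "inside (drawn (cycle_edges zs)) = I2"
    unfolding ys(4) zs(4) I1_def I2_def by (simp_all add: drawn_Un)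
  have op: "open I1" "open I2" unfolding Iy[symmetric] Iz[symmetric]
    using cy by (auto intro!: open_inside compact_imp_closed compact_drawn simp: cycle_in_def)
  define F1 F2 where "F1 = {e \<in> F - B. open_edge e \<subseteq> I1}" and "F2 = {e \<in> F - B. open_edge e \<subseteq> I2}"
  have "e \<in> F1 \<union> F2" if e: "e \<in> F - B" for e
  proof -
    have eE: "e \<in> E" using e F by auto
    have "open_edge e \<inter> drawn B = {}" using open_edge_drawn eE sub e by blast
    moreover have "open_edge e \<subseteq> inside (drawn A1 \<union> drawn A2)" using ins[of e] e unfolding Cx by auto
    ultimately have "open_edge e \<subseteq> I1 \<union> I2" using split by blast
    moreover from this have "I1 \<inter> open_edge e = {} \<or> I2 \<inter> open_edge e = {}"
      using connectedD[OF connected_open_edge[OF eE] op] split by blast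
    ultimately show ?thesis using e by (auto simp: F1_def F2_def)
  qed
  then have FU: "F = B \<union> (F1 \<union> F2)" using P(3) unfolding F1_def F2_def B_def by auto
  have dF: "F1 \<inter> F2 = {}" using split(1) open_edge_nonempty F unfolding F1_def F2_def by blast
  have in1: "p v \<in> I1" if vF: "v \<in> \<Union>F1 - set ys" for v
  proof -
    obtain e where e: "e \<in> F1" "v \<in> e" using vF by auto
    then have "e \<in> E" "open_edge e \<subseteq> I1" using F by (auto simp: F1_def)
    then show ?thesis using vertex_inside[of "cycle_edges ys" e v] cy(1) vF e ys(2)
      by (auto simp: Iy cycle_in_def Union_cycle_edges)
  qed
  have in2: "p v \<in> I2" if vF: "v \<in> \<Union>F2 - set zs" for v
  proof -
    obtain e where e: "e \<in> F2" "v \<in> e" using vF by auto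
    then have "e \<in> E" "open_edge e \<subseteq> I2" using F by (auto simp: F2_def)
    then show ?thesis using vertex_inside[of "cycle_edges zs" e v] cy(2) vF e zs(2)
      by (auto simp: Iz cycle_in_def Union_cycle_edges)
  qed
  have dr: "p v \<in> drawn (A1 \<union> A2)" if "v \<in> set xs" for v
  proof -
    have "v \<in> \<Union>(A1 \<union> A2)" using that s(3) d(2) Union_cycle_edges[of xs] unfolding AB by auto
    then show ?thesis using p_in_drawn_iff[of "A1 \<union> A2" v] sub edge by blast
  qed
  have notin: "v \<notin> set xs" if "p v \<in> I1 \<union> I2" for v
  proof -
    have "p v \<in> inside (drawn (A1 \<union> A2))" using that split(2) unfolding drawn_Un by blast
    then show ?thesis using dr[of v] inside_no_overlap by blast
  qed
  show ?thesis
  proof (rule that[OF cy, of F1 F2])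
    show "length ys + length zs = length xs + 2 * (length es + 1)" using ys zs s by simp
    show "F = path_edges (a # es @ [b]) \<union> (F1 \<union> F2)" using FU by (simp add: B_def)
    show "path_edges (a # es @ [b]) \<inter> (F1 \<union> F2) = {}" by (auto simp: F1_def F2_def B_def)
    show "F1 \<inter> F2 = {}" by fact
    have "A1 \<union> A2 = cycle_edges xs" using s(3) unfolding AB .
    then show "F1 \<inter> cycle_edges ys = {}" "F2 \<inter> cycle_edges zs = {}"
      using F(2) ys(4) zs(4) by (auto simp: F1_def F2_def)
    show "open_edge e \<subseteq> inside (drawn (cycle_edges ys))" if "e \<in> F1" for e using that by (auto simp: F1_def Iy)
    show "open_edge e \<subseteq> inside (drawn (cycle_edges zs))" if "e \<in> F2" for e using that by (auto simp: F2_def Iz)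
    show "(\<Union>F1 - set ys) \<inter> (\<Union>F2 - set zs) = {}" using in1 in2 split(1) by blast
    show "(\<Union>F1 - set ys) \<inter> (set es \<union> set xs) = {}" using in1 notin ys(5) by blast
    show "(\<Union>F2 - set zs) \<inter> (set es \<union> set xs) = {}" using in2 notin zs(5) by blast
  qed
qed

end

section \<open>Subdrawings and inverted drawings\<close>

context plane_drawing
begin

lemma closure_outside_edge:
  assumes K: "finite K" "K \<subseteq> E" and e: "e \<in> E" "open_edge e \<subseteq> outside (drawn K)"
  shows "path_image (\<gamma> e) \<subseteq> drawn K \<union> outside (drawn K)"
proof -
  have "path_image (\<gamma> e) \<subseteq> closure (outside (drawn K))"
    using edge_closure_open_edge[OF e(1)] closure_mono[OF e(2)] by blast
  also have "\<dots> \<subseteq> drawn K \<union> outside (drawn K)"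
    using compact_drawn[OF K] by (intro closure_outside_subset compact_imp_closed)
  finally show ?thesis .
qed

text \<open>An inversion needs a center off the drawing. A center inside a cycle becomes available
  once everything drawn there has been dropped.\<close>

lemma restrict_drawing:
  assumes "E' \<subseteq> E"
  shows "plane_drawing p \<gamma> (\<Union>E') E'"
proof
  have "\<Union>E' \<subseteq> V" using assms edge by blast
  then show "inj_on p (\<Union>E')" by (rule inj_on_subset[OF inj_p])
  fix e assume e: "e \<in> E'"
  then have eE: "e \<in> E" using assms by auto
  show "e \<subseteq> \<Union>E' \<and> card e = 2" using e edge[OF eE] by auto
  show "arc (\<gamma> e)" "{pathstart (\<gamma> e), pathfinish (\<gamma> e)} = p ` e" using arc_edge ends_edge eE by auto
  show "path_image (\<gamma> e) \<inter> p ` (\<Union>E') = p ` e"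
  proof -
    have "p ` e \<subseteq> p ` (\<Union>E')" "p ` (\<Union>E') \<subseteq> p ` V" using e \<open>\<Union>E' \<subseteq> V\<close> by (auto intro!: image_mono)
    then show ?thesis using image_edge[OF eE] by blast
  qed
  fix f assume "f \<in> E'" "e \<noteq> f"
  then show "path_image (\<gamma> e) \<inter> path_image (\<gamma> f) \<subseteq> p ` (e \<inter> f)" using cross_edge[OF eE] assms by auto
qed

lemma inverted_drawing:
  assumes a: "a \<notin> drawn E" "a \<notin> p ` V"
  defines "f \<equiv> \<lambda>z. inverse (z - a)"
  shows "plane_drawing (f \<circ> p) (\<lambda>e. f \<circ> \<gamma> e) V E"
proof
  have inj: "inj_on f (- {a})" by (auto simp: f_def inj_on_def)
  have im: "path_image (\<gamma> e) \<subseteq> - {a}" if "e \<in> E" for e using a that by (auto simp: drawn_def)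
  have pV: "p ` V \<subseteq> - {a}" using a by auto
  show "inj_on (f \<circ> p) V" using inj_p inj pV by (auto intro!: comp_inj_on inj_on_subset[OF inj])
  fix e assume e: "e \<in> E"
  show "e \<subseteq> V \<and> card e = 2" using edge e by auto
  have cf: "continuous_on (- {a}) f" unfolding f_def by (intro continuous_intros) auto
  have "path (f \<circ> \<gamma> e)"
    using im[OF e] arc_edge[OF e] cf by (intro path_continuous_image arc_imp_path continuous_on_subset[OF cf])
  moreover have "inj_on (f \<circ> \<gamma> e) {0..1}"
    using im[OF e] arc_edge[OF e] inj by (intro comp_inj_on) (auto simp: arc_def path_image_def inj_on_def)
  ultimately show "arc (f \<circ> \<gamma> e)" by (simp add: arc_def)
  have pim: "path_image (f \<circ> \<gamma> e) = f ` path_image (\<gamma> e)" if "e \<in> E" for e by (simp add: path_image_compose)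
  have "{pathstart (f \<circ> \<gamma> e), pathfinish (f \<circ> \<gamma> e)} = f ` {pathstart (\<gamma> e), pathfinish (\<gamma> e)}"
    by (simp add: pathstart_compose pathfinish_compose)
  then show "{pathstart (f \<circ> \<gamma> e), pathfinish (f \<circ> \<gamma> e)} = (f \<circ> p) ` e" using ends_edge[OF e] by (simp add: image_comp)
  have "path_image (f \<circ> \<gamma> e) \<inter> (f \<circ> p) ` V = f ` (path_image (\<gamma> e) \<inter> p ` V)"
    using inj_on_image_Int[OF inj im[OF e] pV] pim[OF e] by (simp add: image_comp)
  then show "path_image (f \<circ> \<gamma> e) \<inter> (f \<circ> p) ` V = (f \<circ> p) ` e" using image_edge[OF e] by (simp add: image_comp)
  fix e' assume e': "e' \<in> E" "e \<noteq> e'"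
  have "path_image (f \<circ> \<gamma> e) \<inter> path_image (f \<circ> \<gamma> e') = f ` (path_image (\<gamma> e) \<inter> path_image (\<gamma> e'))"
    using inj_on_image_Int[OF inj im[OF e] im[OF e'(1)]] pim e e' by simp
  then show "path_image (f \<circ> \<gamma> e) \<inter> path_image (f \<circ> \<gamma> e') \<subseteq> (f \<circ> p) ` (e \<inter> e')"
    using cross_edge[OF e e'] by (auto simp: image_comp[symmetric])
qed

end

section \<open>Edge bounds by induction on the edge set\<close>

definition girth_ge :: "nat \<Rightarrow> 'v set set \<Rightarrow> bool" where
  "girth_ge g E \<longleftrightarrow> (\<forall>xs. cycle_in E xs \<longrightarrow> g \<le> length xs)"

lemma girth_ge_subset: "girth_ge g E \<Longrightarrow> E' \<subseteq> E \<Longrightarrow> girth_ge g E'"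
  by (auto simp: girth_ge_def cycle_in_def)

text \<open>These are the bounds that Euler's formula gives when all faces have length at least \<open>h + 2\<close>.\<close>

definition face_bound :: "nat \<Rightarrow> 'v set set \<Rightarrow> bool" where
  "face_bound h F \<longleftrightarrow> (\<forall>p \<gamma> V E xs. plane_drawing p \<gamma> V E \<longrightarrow> girth_ge (h + 2) E \<longrightarrow> F \<subseteq> E \<longrightarrow>
     cycle_in E xs \<longrightarrow> F \<inter> cycle_edges xs = {} \<longrightarrow>
     (\<forall>e\<in>F. plane_drawing.open_edge p \<gamma> e \<subseteq> inside (plane_drawing.drawn \<gamma> (cycle_edges xs))) \<longrightarrow>
     h * card F + (h + 2) \<le> (h + 2) * card (\<Union>F - set xs) + length xs)"

definition total_bound :: "nat \<Rightarrow> 'v set set \<Rightarrow> bool" where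
  "total_bound h F \<longleftrightarrow> (\<forall>p \<gamma> V E. plane_drawing p \<gamma> V E \<longrightarrow> girth_ge (h + 2) E \<longrightarrow> F \<subseteq> E \<longrightarrow> F \<noteq> {} \<longrightarrow>
     h * card F + (h + 2) \<le> (h + 2) * card (\<Union>F) \<and>
     ((\<exists>xs. cycle_in F xs) \<longrightarrow> h * card F + 2 * (h + 2) \<le> (h + 2) * card (\<Union>F)))"

lemma finite_Union_card2: "finite F \<Longrightarrow> (\<And>e. e \<in> F \<Longrightarrow> card e = 2) \<Longrightarrow> finite (\<Union>F)"
  by (auto intro!: finite_Union intro: card_ge_0_finite)

lemma face_boundD:
  assumes "face_bound h F" "plane_drawing p \<gamma> V E" "girth_ge (h + 2) E" "F \<subseteq> E"
    "cycle_in E xs" "F \<inter> cycle_edges xs = {}"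
    "\<And>e. e \<in> F \<Longrightarrow> plane_drawing.open_edge p \<gamma> e \<subseteq> inside (plane_drawing.drawn \<gamma> (cycle_edges xs))"
  shows "h * card F + (h + 2) \<le> (h + 2) * card (\<Union>F - set xs) + length xs"
  using assms unfolding face_bound_def by blast

lemma total_boundD:
  assumes "total_bound h F" "plane_drawing p \<gamma> V E" "girth_ge (h + 2) E" "F \<subseteq> E" "F \<noteq> {}"
  shows "h * card F + (h + 2) \<le> (h + 2) * card (\<Union>F)"
    and "cycle_in F xs \<Longrightarrow> h * card F + 2 * (h + 2) \<le> (h + 2) * card (\<Union>F)"
  using assms unfolding total_bound_def by blast+

text \<open>The part of the drawing outside a cycle is turned into a drawing inside it by an inversion
  of the plane centred at a point inside the cycle.\<close>

lemma face_bound_outside: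
  assumes "face_bound h F" "plane_drawing p \<gamma> V E" "girth_ge (h + 2) E" "F \<subseteq> E"
    "cycle_in E xs" "F \<inter> cycle_edges xs = {}"
    "\<And>e. e \<in> F \<Longrightarrow> plane_drawing.open_edge p \<gamma> e \<subseteq> outside (plane_drawing.drawn \<gamma> (cycle_edges xs))"
  shows "h * card F + (h + 2) \<le> (h + 2) * card (\<Union>F - set xs) + length xs"
proof -
  define E' where "E' = F \<union> cycle_edges xs"
  interpret A: plane_drawing p \<gamma> V E by fact
  have E': "E' \<subseteq> E" using assms by (auto simp: E'_def cycle_in_def)
  interpret B: plane_drawing p \<gamma> "\<Union>E'" E' by (rule A.restrict_drawing[OF E'])
  let ?C = "A.drawn (cycle_edges xs)"
  have cyc: "cycle_in E' xs" using assms by (auto simp: cycle_in_def E'_def)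
  have CE: "cycle_edges xs \<subseteq> E" using assms(5) by (simp add: cycle_in_def)
  obtain g where g: "simple_path g" "pathfinish g = pathstart g" "path_image g = ?C"
    using A.simple_path_of_cycle[OF assms(5)] by metis
  then obtain a where a: "a \<in> inside ?C" using Jordan_inside_outside[of g] by auto
  have "A.drawn E' \<subseteq> ?C \<union> outside ?C"
  proof -
    have "path_image (\<gamma> e) \<subseteq> ?C \<union> outside ?C" if "e \<in> E'" for e
    proof (cases "e \<in> F")
      case True
      then show ?thesis using A.closure_outside_edge[of "cycle_edges xs" e] assms(4,7) CE by auto
    next
      case False
      with that show ?thesis by (auto simp: E'_def A.drawn_def)
    qed
    then show ?thesis by (auto simp: A.drawn_def)
  qed
  then have aE: "a \<notin> A.drawn E'"
    using a inside_no_overlap[of ?C] inside_Int_outside[of ?C] by blast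
  then have aV: "a \<notin> p ` \<Union>E'" using B.p_in_drawn_iff[of E'] by auto
  define f where "f = (\<lambda>z. inverse (z - a))"
  interpret I: plane_drawing "f \<circ> p" "\<lambda>e. f \<circ> \<gamma> e" "\<Union>E'" E'
    unfolding f_def by (rule B.inverted_drawing[OF aE aV])
  have dr: "I.drawn K = f ` A.drawn K" for K
    by (auto simp: I.drawn_def A.drawn_def path_image_compose)
  have "I.open_edge e \<subseteq> inside (I.drawn (cycle_edges xs))" if "e \<in> F" for e
  proof -
    have "I.open_edge e \<subseteq> f ` A.open_edge e"
      by (auto simp: I.open_edge_def A.open_edge_def path_image_compose)
    also have "\<dots> \<subseteq> f ` outside ?C" using assms(7)[OF that] by auto
    also have "\<dots> \<subseteq> inside (f ` ?C)"
      unfolding f_def using A.compact_drawn[of "cycle_edges xs"] CE a by (intro inversion_outside_inside) auto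
    finally show ?thesis by (simp add: dr)
  qed
  then show ?thesis
    using assms(6)
    by (intro face_boundD[OF assms(1) I.plane_drawing_axioms girth_ge_subset[OF assms(3) E'] _ cyc])
      (auto simp: E'_def)
qed

text \<open>A cycle separates the other edges into those inside and those outside, and the two face
  bounds add up to the stronger inequality. A forest loses a leaf instead, and thereby at least one
  vertex.\<close>

lemma total_bound_step:
  assumes F: "finite F" and IH: "\<And>F'. F' \<subset> F \<Longrightarrow> face_bound h F'" "\<And>F'. F' \<subset> F \<Longrightarrow> total_bound h F'"
  shows "total_bound h F"
  unfolding total_bound_def
proof (intro allI impI)
  fix p \<gamma> V E assume D: "plane_drawing p \<gamma> V E" and g: "girth_ge (h + 2) E" and FE: "F \<subseteq> E" and ne: "F \<noteq> {}"
  interpret plane_drawing p \<gamma> V E by fact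
  have finU: "finite (\<Union>F)" using F FE edge by (intro finite_Union_card2) auto
  have strong: "h * card F + 2 * (h + 2) \<le> (h + 2) * card (\<Union>F)" if cF: "cycle_in F xs" for xs
  proof -
    have cyc: "cycle_in E xs" and CF: "cycle_edges xs \<subseteq> F" using cF FE by (auto simp: cycle_in_def)
    let ?C = "drawn (cycle_edges xs)"
    have d: "distinct xs" "3 \<le> length xs" and CE: "cycle_edges xs \<subseteq> E" using cyc by (auto simp: cycle_in_def)
    define F1 F2 where "F1 = {e \<in> F - cycle_edges xs. open_edge e \<subseteq> inside ?C}"
      and "F2 = {e \<in> F - cycle_edges xs. open_edge e \<subseteq> outside ?C}"
    have cl: "closed ?C" using compact_drawn CE by (simp add: compact_imp_closed)
    have "e \<in> F1 \<union> F2" if e: "e \<in> F - cycle_edges xs" for e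
    proof -
      have eE: "e \<in> E" using e FE by auto
      have "open_edge e \<inter> ?C = {}" using open_edge_drawn eE CE e by blast
      then have "open_edge e \<subseteq> inside ?C \<union> outside ?C" using inside_Un_outside by blast
      moreover from this have "inside ?C \<inter> open_edge e = {} \<or> outside ?C \<inter> open_edge e = {}"
        using connectedD[OF connected_open_edge[OF eE] open_inside[OF cl] open_outside[OF cl]]
          inside_Int_outside by blast
      ultimately have "open_edge e \<subseteq> inside ?C \<or> open_edge e \<subseteq> outside ?C" by blast
      then show ?thesis using e by (simp add: F1_def F2_def)
    qed
    then have FU: "F = cycle_edges xs \<union> (F1 \<union> F2)" using CF by (auto simp: F1_def F2_def)
    have dF: "F1 \<inter> F2 = {}"
      using open_edge_nonempty FE inside_Int_outside[of ?C] unfolding F1_def F2_def by blast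
    have dC: "F1 \<inter> cycle_edges xs = {}" "F2 \<inter> cycle_edges xs = {}" by (auto simp: F1_def F2_def)
    have "hd xs \<in> \<Union>(cycle_edges xs)" using d Union_cycle_edges[of xs] by (cases xs) auto
    then have "cycle_edges xs \<noteq> {}" by auto
    then have psub: "F1 \<subset> F" "F2 \<subset> F" using FU dC by blast+
    have b1: "h * card F1 + (h + 2) \<le> (h + 2) * card (\<Union>F1 - set xs) + length xs"
      using psub FE cyc dC by (intro face_boundD[OF IH(1)[OF psub(1)] D g]) (auto simp: F1_def)
    have b2: "h * card F2 + (h + 2) \<le> (h + 2) * card (\<Union>F2 - set xs) + length xs"
      using psub FE cyc dC by (intro face_bound_outside[OF IH(1)[OF psub(2)] D g]) (auto simp: F2_def)
    have fin: "finite F1" "finite F2" using F psub by (auto intro: finite_subset)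
    have cardF: "card F = length xs + (card F1 + card F2)"
    proof -
      have "card F = card (cycle_edges xs) + card (F1 \<union> F2)"
        using FU dC fin card_Un_disjoint[of "cycle_edges xs" "F1 \<union> F2"] by auto
      then show ?thesis using card_Un_disjoint[OF fin dF] d by (simp add: card_cycle_edges)
    qed
    have v1: "p v \<in> inside ?C" if vF: "v \<in> \<Union>F1 - set xs" for v
    proof -
      obtain e where "e \<in> F1" "v \<in> e" using vF by auto
      then show ?thesis using vertex_inside[of "cycle_edges xs" e v] vF CE d FE
        by (auto simp: Union_cycle_edges F1_def)
    qed
    have v2: "p v \<in> outside ?C" if vF: "v \<in> \<Union>F2 - set xs" for v
    proof -
      obtain e where e: "e \<in> F2" "v \<in> e" using vF by auto
      then have eE: "e \<in> E" using FE by (auto simp: F2_def)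
      have "p v \<in> ?C \<union> outside ?C"
        using closure_outside_edge[of "cycle_edges xs" e] e CE eE image_edge[OF eE] by (auto simp: F2_def)
      moreover have "p v \<notin> ?C" using p_in_drawn_iff[OF CE] vF d edge[OF eE] e by (auto simp: Union_cycle_edges)
      ultimately show ?thesis by blast
    qed
    have "(\<Union>F1 - set xs) \<inter> (\<Union>F2 - set xs) = {}" using v1 v2 inside_Int_outside[of ?C] by blast
    moreover have fin': "finite (\<Union>F1 - set xs)" "finite (\<Union>F2 - set xs)"
      using psub finU by (meson finite_Diff finite_subset Union_mono psubset_imp_subset)+
    moreover have "\<Union>F = set xs \<union> ((\<Union>F1 - set xs) \<union> (\<Union>F2 - set xs))"
    proof -
      have "\<Union>F = \<Union>(cycle_edges xs) \<union> (\<Union>F1 \<union> \<Union>F2)" by (subst FU) (simp only: Union_Un_distrib)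
      then show ?thesis using Union_cycle_edges[OF d(2)] by auto
    qed
    ultimately have "card (\<Union>F) = card (set xs) + (card (\<Union>F1 - set xs) + card (\<Union>F2 - set xs))"
      using card_Un_disjoint[of "set xs" "(\<Union>F1 - set xs) \<union> (\<Union>F2 - set xs)"]
        card_Un_disjoint[of "\<Union>F1 - set xs" "\<Union>F2 - set xs"] by auto
    then have cU: "card (\<Union>F) = length xs + (card (\<Union>F1 - set xs) + card (\<Union>F2 - set xs))"
      using d by (simp add: distinct_card)
    show ?thesis unfolding cardF cU using b1 b2 by (simp add: algebra_simps)
  qed
  show "h * card F + (h + 2) \<le> (h + 2) * card (\<Union>F) \<and>
     ((\<exists>xs. cycle_in F xs) \<longrightarrow> h * card F + 2 * (h + 2) \<le> (h + 2) * card (\<Union>F))"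
  proof (cases "\<exists>xs. cycle_in F xs")
    case True
    then show ?thesis using strong by fastforce
  next
    case False
    obtain e u where e: "e \<in> F" "u \<in> e" "u \<notin> \<Union>(F - {e})"
    proof (rule leaf_or_cycle[OF F ne])
      show "card e = 2" if "e \<in> F" for e using that FE edge by auto
      show "\<not> cycle_in F xs" for xs using False by blast
    qed
    have ce: "card e = 2" using e FE edge by auto
    have cF: "card F = Suc (card (F - {e}))" by (rule card.remove[OF F e(1)])
    show ?thesis
    proof (cases "F - {e} = {}")
      case True
      then have "F = {e}" using e by auto
      then show ?thesis using ce False by (simp add: algebra_simps)
    next
      case ne': False
      have "h * card (F - {e}) + (h + 2) \<le> (h + 2) * card (\<Union>(F - {e}))"
        using FE e ne' by (intro total_boundD(1)[OF IH(2) D g]) auto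
      moreover have "card (\<Union>(F - {e})) < card (\<Union>F)"
        using e finU by (intro psubset_card_mono) auto
      then have "(h + 2) * (card (\<Union>(F - {e})) + 1) \<le> (h + 2) * card (\<Union>F)" by (intro mult_left_mono) auto
      ultimately show ?thesis using cF False by (simp add: algebra_simps)
    qed
  qed
qed

text \<open>An ear leads to two smaller regions, and counting its edges on both boundaries pays for
  them. If \<open>F\<close> is empty, the girth gives the bound. Otherwise some vertex lies off the
  cycle, and its pendant part is split off and estimated by \<open>total_bound\<close>.\<close>

lemma face_bound_step:
  assumes F: "finite F" and IH: "\<And>F'. F' \<subset> F \<Longrightarrow> face_bound h F'" "\<And>F'. F' \<subseteq> F \<Longrightarrow> total_bound h F'"
  shows "face_bound h F"
  unfolding face_bound_def
proof (intro allI impI)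
  fix p \<gamma> V E xs assume D: "plane_drawing p \<gamma> V E" and g: "girth_ge (h + 2) E" and FE: "F \<subseteq> E"
    and cyc: "cycle_in E xs" and FC: "F \<inter> cycle_edges xs = {}"
    and ins: "\<forall>e\<in>F. plane_drawing.open_edge p \<gamma> e \<subseteq> inside (plane_drawing.drawn \<gamma> (cycle_edges xs))"
  interpret plane_drawing p \<gamma> V E by fact
  have finU: "finite (\<Union>F)" using F FE edge by (intro finite_Union_card2) auto
  let ?W = "set xs"
  show "h * card F + (h + 2) \<le> (h + 2) * card (\<Union>F - ?W) + length xs"
  proof (cases "\<exists>a es b. a \<in> ?W \<and> b \<in> ?W \<and> a \<noteq> b \<and> distinct (a # es @ [b]) \<and>
       set es \<inter> ?W = {} \<and> path_edges (a # es @ [b]) \<subseteq> F")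
    case True
    then obtain a es b where ear: "a \<in> ?W" "b \<in> ?W" "a \<noteq> b" "distinct (a # es @ [b])"
       "set es \<inter> ?W = {}" "path_edges (a # es @ [b]) \<subseteq> F" by blast
    obtain ys zs F1 F2 where s: "cycle_in E ys" "cycle_in E zs"
      "length ys + length zs = length xs + 2 * (length es + 1)"
      "F = path_edges (a # es @ [b]) \<union> (F1 \<union> F2)" "path_edges (a # es @ [b]) \<inter> (F1 \<union> F2) = {}" "F1 \<inter> F2 = {}"
      "F1 \<inter> cycle_edges ys = {}" "F2 \<inter> cycle_edges zs = {}"
      "\<And>e. e \<in> F1 \<Longrightarrow> open_edge e \<subseteq> inside (drawn (cycle_edges ys))"
      "\<And>e. e \<in> F2 \<Longrightarrow> open_edge e \<subseteq> inside (drawn (cycle_edges zs))"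
      "(\<Union>F1 - set ys) \<inter> (\<Union>F2 - set zs) = {}"
      "(\<Union>F1 - set ys) \<inter> (set es \<union> set xs) = {}" "(\<Union>F2 - set zs) \<inter> (set es \<union> set xs) = {}"
      using split_face[OF cyc ear FE FC] ins by metis
    have "path_edges (a # es @ [b]) \<noteq> {}" by (cases es) auto
    then have psub: "F1 \<subset> F" "F2 \<subset> F" using s(4,5) by blast+
    have b1: "h * card F1 + (h + 2) \<le> (h + 2) * card (\<Union>F1 - set ys) + length ys"
      using psub FE by (intro face_boundD[OF IH(1)[OF psub(1)] D g _ s(1,7,9)]) auto
    have b2: "h * card F2 + (h + 2) \<le> (h + 2) * card (\<Union>F2 - set zs) + length zs"
      using psub FE by (intro face_boundD[OF IH(1)[OF psub(2)] D g _ s(2,8,10)]) auto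
    have fin: "finite F1" "finite F2" using F psub by (auto intro: finite_subset)
    have cardF: "card F = (length es + 1) + (card F1 + card F2)"
    proof -
      have "card F = card (path_edges (a # es @ [b])) + card (F1 \<union> F2)"
        using s(4,5) fin card_Un_disjoint[of "path_edges (a # es @ [b])" "F1 \<union> F2"] by auto
      then show ?thesis using card_Un_disjoint[OF fin s(6)] card_path_edges[OF ear(4)] by simp
    qed
    have fin': "finite (\<Union>F1 - set ys)" "finite (\<Union>F2 - set zs)"
      using psub finU by (meson finite_Diff finite_subset Union_mono psubset_imp_subset)+
    have esF: "set es \<subseteq> \<Union>F" using Union_mono[OF ear(6)] Union_path_edges[of "a # es @ [b]"] by auto
    have "card (set es \<union> ((\<Union>F1 - set ys) \<union> (\<Union>F2 - set zs))) \<le> card (\<Union>F - ?W)"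
      using psub s(12,13) ear(5) esF finU by (intro card_mono) auto
    moreover have "card (set es \<union> ((\<Union>F1 - set ys) \<union> (\<Union>F2 - set zs))) =
        card (set es) + (card (\<Union>F1 - set ys) + card (\<Union>F2 - set zs))"
    proof -
      have "set es \<inter> ((\<Union>F1 - set ys) \<union> (\<Union>F2 - set zs)) = {}" using s(12,13) by blast
      then show ?thesis using fin' s(11) by (simp add: card_Un_disjoint)
    qed
    moreover have "card (set es) = length es" using ear(4) by (simp add: distinct_card)
    ultimately have "(h + 2) * (length es + (card (\<Union>F1 - set ys) + card (\<Union>F2 - set zs))) \<le> (h + 2) * card (\<Union>F - ?W)"
      by (intro mult_left_mono) auto
    then show ?thesis unfolding cardF using b1 b2 s(3) by (simp add: algebra_simps)
  next
    case no_ear: False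
    show ?thesis
    proof (cases "F = {}")
      case True
      then show ?thesis using g cyc by (simp add: girth_ge_def)
    next
      case False
      then obtain e where e: "e \<in> F" by auto
      then obtain u v where uv: "e = {u, v}" "u \<noteq> v" using FE edge by (metis card_2_iff subsetD)
      \<comment> \<open>A single edge with both ends on the cycle would be an ear without inner
        vertices.\<close>
      have "\<not> (u \<in> ?W \<and> v \<in> ?W)"
      proof
        assume "u \<in> ?W \<and> v \<in> ?W"
        then have "u \<in> ?W \<and> v \<in> ?W \<and> u \<noteq> v \<and> distinct (u # [] @ [v]) \<and>
          set [] \<inter> ?W = {} \<and> path_edges (u # [] @ [v]) \<subseteq> F" using uv e by auto
        with no_ear show False by blast
      qed
      moreover have "u \<in> \<Union>F" "v \<in> \<Union>F" using uv e by auto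
      ultimately obtain w where w: "w \<in> \<Union>F" "w \<notin> ?W" by blast
      have c2: "card e = 2" if "e \<in> F" for e using that FE edge by auto
      obtain M K where MK: "K \<subseteq> F" "K \<noteq> {}" "\<Union>K \<subseteq> M \<union> ?W"
        "\<forall>a\<in>\<Union>K \<inter> ?W. \<forall>b\<in>\<Union>K \<inter> ?W. a = b"
        "M \<inter> ?W = {}" "M \<inter> \<Union>(F - K) = {}" "M \<subseteq> \<Union>F"
        using pendant_part[OF c2 w no_ear] by metis
      have finM: "finite M" using MK(7) finU finite_subset by blast
      have t: "h * card K + (h + 2) \<le> (h + 2) * card (\<Union>K)"
        using MK(1,2) FE by (intro total_boundD(1)[OF IH(2)[OF MK(1)] D g]) auto
      \<comment> \<open>The one vertex that \<open>K\<close> may share with the cycle is compensated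
        by the additive \<open>h + 2\<close> in \<open>total_bound\<close>.\<close>
      have "card (\<Union>K) \<le> card M + 1"
      proof -
        have "\<Union>K = (\<Union>K - ?W) \<union> (\<Union>K \<inter> ?W)" by auto
        then have "card (\<Union>K) \<le> card (\<Union>K - ?W) + card (\<Union>K \<inter> ?W)" by (metis card_Un_le)
        moreover have "card (\<Union>K - ?W) \<le> card M" using MK(3) finM by (intro card_mono) auto
        moreover have "card (\<Union>K \<inter> ?W) \<le> 1" using MK(4) card_le_Suc0_iff_eq[of "\<Union>K \<inter> ?W"] by simp
        ultimately show ?thesis by simp
      qed
      then have "(h + 2) * card (\<Union>K) \<le> (h + 2) * (card M + 1)" by (intro mult_left_mono) auto
      with t have t': "h * card K \<le> (h + 2) * card M" by (simp add: algebra_simps)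
      have f: "h * card (F - K) + (h + 2) \<le> (h + 2) * card (\<Union>(F - K) - ?W) + length xs"
      proof -
        have "F - K \<subset> F" using MK by blast
        then show ?thesis using FC FE ins by (intro face_boundD[OF IH(1) D g _ cyc]) auto
      qed
      have cF: "card F = card K + card (F - K)"
        using F MK(1) card_Un_disjoint[of K "F - K"] by (simp add: Un_absorb1 finite_subset)
      have "card M + card (\<Union>(F - K) - ?W) = card (M \<union> (\<Union>(F - K) - ?W))"
      proof (rule card_Un_disjoint[symmetric])
        show "finite M" by fact
        show "finite (\<Union>(F - K) - ?W)" by (rule finite_subset[OF _ finU]) auto
        show "M \<inter> (\<Union>(F - K) - ?W) = {}" using MK(6) by blast
      qed
      also have "\<dots> \<le> card (\<Union>F - ?W)" using MK(5,7) finU by (intro card_mono) auto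
      finally have "(h + 2) * (card M + card (\<Union>(F - K) - ?W)) \<le> (h + 2) * card (\<Union>F - ?W)"
        by (intro mult_left_mono) auto
      with t' f show ?thesis unfolding cF by (simp add: algebra_simps)
    qed
  qed
qed

text \<open>The total bound of \<open>F\<close> has to precede its face bound, because a pendant
  part may be all of \<open>F\<close>.\<close>

lemma face_total_bound: "finite F \<Longrightarrow> face_bound h F \<and> total_bound h F"
proof (induction F rule: finite_psubset_induct)
  case (psubset F)
  have IH: "face_bound h F'" "total_bound h F'" if "F' \<subset> F" for F' using psubset.IH[OF that] by blast+
  have t: "total_bound h F" by (rule total_bound_step[OF psubset.hyps(1) IH])
  have t': "total_bound h F'" if "F' \<subseteq> F" for F'
    using IH(2)[of F'] t that by (cases "F' = F") (simp_all add: psubset_eq)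
  have "face_bound h F" by (rule face_bound_step[OF psubset.hyps(1) IH(1) t'])
  with t show ?case by blast
qed

text \<open>The drawing is restricted to \<open>F\<close>, so only cycles in \<open>F\<close> have
  to be long. This matters for balls, whose girth may exceed that of the graph.\<close>

lemma planar_edge_bound:
  assumes "finite F" "F \<noteq> {}" "F \<subseteq> E" "\<And>e. e \<in> E \<Longrightarrow> e \<subseteq> V \<and> card e = 2" "planar V E" "girth_ge (h + 2) F"
  shows "h * card F + (h + 2) \<le> (h + 2) * card (\<Union>F)"
    and "cycle_in F xs \<Longrightarrow> h * card F + 2 * (h + 2) \<le> (h + 2) * card (\<Union>F)"
proof -
  from assms(5) obtain p :: "_ \<Rightarrow> complex" and \<gamma> where "inj_on p V \<and>
      (\<forall>e\<in>E. arc (\<gamma> e) \<and> {pathstart (\<gamma> e), pathfinish (\<gamma> e)} = p ` e \<and> path_image (\<gamma> e) \<inter> p ` V = p ` e) \<and>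
      (\<forall>e\<in>E. \<forall>f\<in>E. e \<noteq> f \<longrightarrow> path_image (\<gamma> e) \<inter> path_image (\<gamma> f) \<subseteq> p ` (e \<inter> f))"
    unfolding planar_def by (elim exE) (rule that)
  note * = conjunct1[OF this] conjunct1[OF conjunct2[OF this]] conjunct2[OF conjunct2[OF this]]
  have "plane_drawing p \<gamma> V E"
  proof
    show "inj_on p V" by (rule *)
    fix e assume e: "e \<in> E"
    show "e \<subseteq> V \<and> card e = 2" by (rule assms(4)[OF e])
    show "arc (\<gamma> e)" "{pathstart (\<gamma> e), pathfinish (\<gamma> e)} = p ` e" "path_image (\<gamma> e) \<inter> p ` V = p ` e"
      using bspec[OF *(2) e] by simp_all
    fix f assume "f \<in> E" "e \<noteq> f"
    then show "path_image (\<gamma> e) \<inter> path_image (\<gamma> f) \<subseteq> p ` (e \<inter> f)"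
      using bspec[OF bspec[OF *(3) e]] by simp
  qed
  then interpret plane_drawing p \<gamma> V E .
  have "plane_drawing p \<gamma> (\<Union>F) F" by (rule restrict_drawing[OF assms(3)])
  then show "h * card F + (h + 2) \<le> (h + 2) * card (\<Union>F)"
    "cycle_in F xs \<Longrightarrow> h * card F + 2 * (h + 2) \<le> (h + 2) * card (\<Union>F)"
    using total_boundD[OF _ _ assms(6) subset_refl assms(2), of p \<gamma>] face_total_bound[OF assms(1), of h] by blast+
qed

section \<open>Completing partial list colorings\<close>

text \<open>From here on graphs are neighborhood functions: a local computation sees precisely the
  values of such a function near a vertex. Elements that are not vertices are isolated.\<close>

definition graph :: "('v \<Rightarrow> 'v set) \<Rightarrow> bool" where
  "graph N \<longleftrightarrow> (\<forall>u v. u \<in> N v \<longrightarrow> v \<in> N u) \<and> (\<forall>v. v \<notin> N v) \<and> (\<forall>v. finite (N v))"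

lemma graphD: "graph N \<Longrightarrow> u \<in> N v \<Longrightarrow> v \<in> N u" "graph N \<Longrightarrow> v \<notin> N v" "graph N \<Longrightarrow> finite (N v)"
  by (auto simp: graph_def)

definition proper :: "('v \<Rightarrow> 'v set) \<Rightarrow> ('v \<Rightarrow> 'c set) \<Rightarrow> 'v set \<Rightarrow> ('v \<Rightarrow> 'c) \<Rightarrow> bool" where
  "proper N L B c \<longleftrightarrow> (\<forall>u\<in>B. c u \<in> L u \<and> (\<forall>w\<in>N u \<inter> B. c u \<noteq> c w))"

text \<open>Degeneracy relative to the lists: the vertex found for \<open>W = B\<close> is colored
  last, after the rest has been colored by induction.\<close>

lemma greedy_coloring:
  assumes "graph N" "finite B" "\<And>u. u \<in> B \<Longrightarrow> finite (L u)"
    "\<And>W. W \<subseteq> B \<Longrightarrow> W \<noteq> {} \<Longrightarrow> \<exists>v\<in>W. card (N v \<inter> W) < card (L v)"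
  shows "\<exists>c. proper N L B c"
  using assms(2-)
proof (induction B rule: finite_psubset_induct)
  case (psubset B)
  show ?case
  proof (cases "B = {}")
    case True
    then show ?thesis by (simp add: proper_def)
  next
    case False
    then obtain v where v: "v \<in> B" "card (N v \<inter> B) < card (L v)" using psubset.prems(2)[of B] by auto
    have sub: "B - {v} \<subset> B" using v by auto
    have "\<exists>c. proper N L (B - {v}) c"
      using psubset.prems by (intro psubset.IH[OF sub]) auto
    then obtain c where c: "proper N L (B - {v}) c" ..
    have "card (c ` (N v \<inter> B)) < card (L v)"
      using v card_image_le[of "N v \<inter> B" c] psubset.hyps by simp
    then have "\<not> L v \<subseteq> c ` (N v \<inter> B)" using psubset.hyps card_mono[of "c ` (N v \<inter> B)" "L v"] by auto
    then obtain x where x: "x \<in> L v" "x \<notin> c ` (N v \<inter> B)" by auto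
    have "proper N L B (c(v := x))"
      unfolding proper_def
    proof (intro ballI conjI)
      fix u assume u: "u \<in> B"
      show "(c(v := x)) u \<in> L u" using c x u by (auto simp: proper_def)
      fix w assume w: "w \<in> N u \<inter> B"
      then have "w \<noteq> u" "u \<in> N w" using graphD[OF assms(1)] by blast+
      then show "(c(v := x)) u \<noteq> (c(v := x)) w" using c x u w by (auto simp: proper_def)
    qed
    then show ?thesis by blast
  qed
qed

text \<open>Connectedness expressed by cuts. Greedy coloring uses it in this form: any proper part
  of \<open>Q\<close> has a vertex with a neighbor left out.\<close>

definition linked :: "('v \<Rightarrow> 'v set) \<Rightarrow> 'v set \<Rightarrow> bool" where
  "linked N Q \<longleftrightarrow> (\<forall>W\<subseteq>Q. W \<noteq> {} \<longrightarrow> W \<noteq> Q \<longrightarrow> (\<exists>v\<in>W. N v \<inter> (Q - W) \<noteq> {}))"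

lemma linkedD:
  assumes "linked N Q" "W \<subseteq> Q" "W \<noteq> {}" "W \<noteq> Q"
  shows "\<exists>v\<in>W. \<exists>u\<in>Q - W. u \<in> N v"
proof -
  obtain v where "v \<in> W" "N v \<inter> (Q - W) \<noteq> {}" using assms unfolding linked_def by blast
  then show ?thesis by blast
qed

lemma linked_card_less:
  assumes "linked N Q" "finite Q" "W \<subseteq> Q" "W \<noteq> {}" "W \<noteq> Q"
  obtains v where "v \<in> W" "card (N v \<inter> W) < card (N v \<inter> Q)"
proof -
  obtain v where "v \<in> W" "N v \<inter> (Q - W) \<noteq> {}" using assms unfolding linked_def by blast
  moreover from this have "N v \<inter> W \<subset> N v \<inter> Q" using assms by blast
  ultimately show ?thesis using that assms psubset_card_mono[of "N v \<inter> Q" "N v \<inter> W"] by auto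
qed

text \<open>In a proper part, a vertex with a neighbor left out has a color to spare; in all of
  \<open>Q\<close> this is true of \<open>v\<close>.\<close>

lemma slack_coloring:
  assumes "graph N" "finite Q" "linked N Q" "\<And>u. u \<in> Q \<Longrightarrow> finite (L u)"
    "\<And>u. u \<in> Q \<Longrightarrow> card (N u \<inter> Q) \<le> card (L u)" "v \<in> Q" "card (N v \<inter> Q) < card (L v)"
  shows "\<exists>c. proper N L Q c"
proof (rule greedy_coloring[OF assms(1,2,4)])
  fix W assume W: "W \<subseteq> Q" "W \<noteq> {}"
  show "\<exists>v\<in>W. card (N v \<inter> W) < card (L v)"
  proof (cases "W = Q")
    case False
    then obtain u where "u \<in> W" "card (N u \<inter> W) < card (N u \<inter> Q)"
      using linked_card_less[OF assms(3,2) W] by metis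
    then show ?thesis using assms(5)[of u] W by (intro bexI[of _ u]) auto
  qed (use assms in auto)
qed auto

section \<open>Even cycles as the source of completability\<close>

definition cycle :: "('v \<Rightarrow> 'v set) \<Rightarrow> 'v list \<Rightarrow> bool" where
  "cycle N xs \<longleftrightarrow> distinct xs \<and> 3 \<le> length xs \<and>
     (\<forall>i<length xs. xs ! (Suc i mod length xs) \<in> N (xs ! i))"

lemma linked_path:
  assumes "graph N" "\<And>i. Suc i < length zs \<Longrightarrow> zs ! Suc i \<in> N (zs ! i)"
  shows "linked N (set zs)"
  unfolding linked_def
proof (intro allI impI)
  fix W assume W: "W \<subseteq> set zs" "W \<noteq> {}" "W \<noteq> set zs"
  have "\<exists>i. Suc i < length zs \<and> (zs ! i \<in> W) \<noteq> (zs ! Suc i \<in> W)"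
  proof (rule ccontr)
    assume "\<not> ?thesis"
    then have same: "Suc i < length zs \<Longrightarrow> (zs ! i \<in> W) = (zs ! Suc i \<in> W)" for i by blast
    have "i < length zs \<Longrightarrow> (zs ! i \<in> W) = (zs ! 0 \<in> W)" for i
      by (induction i) (use same in auto)
    then have "W = {} \<or> W = set zs" using W(1) by (metis in_set_conv_nth subset_antisym subset_iff empty_iff)
    with W show False by blast
  qed
  then obtain i where i: "Suc i < length zs" "(zs ! i \<in> W) \<noteq> (zs ! Suc i \<in> W)" by blast
  have "zs ! i \<in> set zs" "zs ! Suc i \<in> set zs" using i by auto
  moreover have "zs ! Suc i \<in> N (zs ! i)" "zs ! i \<in> N (zs ! Suc i)" 
    using assms(2)[OF i(1)] graphD(1)[OF assms(1) assms(2)[OF i(1)]] by blast+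
  ultimately show "\<exists>v\<in>W. N v \<inter> (set zs - W) \<noteq> {}" using i(2) by blast
qed

lemma linked_cycle: "graph N \<Longrightarrow> cycle N xs \<Longrightarrow> linked N (set xs)"
proof (rule linked_path)
  fix i assume "cycle N xs" "Suc i < length xs"
  then show "xs ! Suc i \<in> N (xs ! i)" by (auto simp: cycle_def dest!: spec[of _ i])
qed

lemma cycle_rotate:
  assumes "cycle N xs"
  shows "cycle N (rotate n xs)"
  unfolding cycle_def
proof (intro conjI allI impI)
  show "distinct (rotate n xs)" "3 \<le> length (rotate n xs)" using assms by (auto simp: cycle_def)
  fix i assume i: "i < length (rotate n xs)"
  let ?m = "length xs"
  have m: "0 < ?m" using assms by (auto simp: cycle_def)
  have "rotate n xs ! (Suc i mod ?m) = xs ! ((n + Suc i mod ?m) mod ?m)" using m by (simp add: nth_rotate)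
  also have "(n + Suc i mod ?m) mod ?m = Suc ((n + i) mod ?m) mod ?m" by (simp add: mod_Suc_eq mod_add_right_eq)
  also have "xs ! \<dots> \<in> N (xs ! ((n + i) mod ?m))" using assms m by (auto simp: cycle_def)
  finally show "rotate n xs ! (Suc i mod length (rotate n xs)) \<in> N (rotate n xs ! i)"
    using i by (simp add: nth_rotate)
qed

lemma cycle_hd:
  assumes "cycle N xs" "a \<in> set xs"
  obtains ys where "cycle N ys" "set ys = set xs" "length ys = length xs" "ys \<noteq> []" "hd ys = a"
proof -
  obtain i where i: "i < length xs" "xs ! i = a" using assms by (auto simp: in_set_conv_nth)
  have "xs \<noteq> []" using i by auto
  then have "hd (rotate i xs) = a" using i by (simp add: hd_rotate_conv_nth)
  then show ?thesis using that[of "rotate i xs"] cycle_rotate[OF assms(1), of i] \<open>xs \<noteq> []\<close> by simp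
qed

lemma linked_cycle_remove:
  assumes "graph N" "cycle N xs" "a \<in> set xs"
  shows "linked N (set xs - {a})"
proof -
  obtain ys where ys: "cycle N ys" "set ys = set xs" "ys \<noteq> []" "hd ys = a" using cycle_hd[OF assms(2,3)] by metis
  then obtain zs where zs: "ys = a # zs" by (cases ys) auto
  have "linked N (set zs)"
  proof (rule linked_path[OF assms(1)])
    fix i assume "Suc i < length zs"
    then show "zs ! Suc i \<in> N (zs ! i)" using ys(1) zs by (auto simp: cycle_def dest!: spec[of _ "Suc i"])
  qed
  moreover have "set zs = set xs - {a}" using ys zs by (auto simp: cycle_def)
  ultimately show ?thesis by simp
qed

lemma cycle_two_neighbors:
  assumes "graph N" "cycle N xs" "i < length xs"
  shows "\<exists>j<length xs. Suc j mod length xs = i \<and> xs ! (Suc i mod length xs) \<noteq> xs ! j \<and>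
    {xs ! (Suc i mod length xs), xs ! j} \<subseteq> N (xs ! i) \<inter> set xs"
proof -
  let ?m = "length xs"
  have d: "distinct xs" "3 \<le> ?m" using assms(2) by (auto simp: cycle_def)
  define j where "j = (if i = 0 then ?m - 1 else i - 1)"
  have j: "j < ?m" "Suc j mod ?m = i" using assms(3) d by (auto simp: j_def)
  have "Suc i mod ?m \<noteq> j"
  proof (cases "Suc i = ?m")
    case True
    then show ?thesis using d by (auto simp: j_def)
  next
    case False
    then show ?thesis using assms(3) d by (auto simp: j_def)
  qed
  moreover have s: "Suc i mod ?m < ?m" by (rule mod_less_divisor) (use d in auto)
  ultimately have "xs ! (Suc i mod ?m) \<noteq> xs ! j" using d j by (simp add: nth_eq_iff_index_eq)
  moreover have "xs ! (Suc i mod ?m) \<in> N (xs ! i)" using assms by (auto simp: cycle_def)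
  moreover have "xs ! j \<in> N (xs ! i)"
    using assms(2) j graphD(1)[OF assms(1)] unfolding cycle_def by metis
  ultimately show ?thesis using j s by auto
qed

text \<open>If the list of a vertex \<open>a\<close> is not contained in that of its neighbor \<open>b\<close>, then \<open>a\<close> takes a
  color missing at \<open>b\<close> and the rest is colored greedily, ending at \<open>b\<close>; otherwise all lists are
  equal.\<close>

lemma even_cycle_coloring:
  assumes G: "graph N" and C: "cycle N xs" and ev: "even (length xs)"
    and v: "v \<in> set xs" "card (N v \<inter> set xs) \<le> 2"
    and L: "\<And>u. u \<in> set xs \<Longrightarrow> finite (L u)" "\<And>u. u \<in> set xs \<Longrightarrow> card (N u \<inter> set xs) \<le> card (L u)"
  shows "\<exists>c. proper N L (set xs) c"
proof (cases "\<exists>a\<in>set xs. \<exists>b\<in>N a \<inter> set xs. \<not> L a \<subseteq> L b")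
  case True
  let ?Q = "set xs"
  from True obtain a b x where ab: "a \<in> ?Q" "b \<in> N a" "b \<in> ?Q" "x \<in> L a" "x \<notin> L b" by blast
  \<comment> \<open>The neighbor \<open>b\<close> of \<open>a\<close> loses a competitor but no
    color, since \<open>x\<close> is not in its list; this is the slack that colors the
    rest.\<close>
  define L' where "L' = (\<lambda>u. if u \<in> N a then L u - {x} else L u)"
  have "\<exists>c. proper N L' (?Q - {a}) c"
  proof (rule slack_coloring[OF G _ linked_cycle_remove[OF G C ab(1)]])
    show "finite (?Q - {a})" by simp
    show "finite (L' u)" if "u \<in> ?Q - {a}" for u using L that by (auto simp: L'_def)
    have less: "card (N u \<inter> (?Q - {a})) < card (N u \<inter> ?Q)" if "u \<in> N a" for u
      using graphD(1)[OF G that] ab by (intro psubset_card_mono) auto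
    show "card (N u \<inter> (?Q - {a})) \<le> card (L' u)" if u: "u \<in> ?Q - {a}" for u
    proof (cases "u \<in> N a")
      case True
      have "card (N u \<inter> ?Q) \<le> card (L u)" "finite (L u)" using L u by auto
      moreover have "card (L u) \<le> Suc (card (L u - {x}))"
        using \<open>finite (L u)\<close> by (metis card_Diff1_le card_Suc_Diff1 Diff_empty Diff_insert0 le_Suc_eq order_refl)
      ultimately show ?thesis using less[OF True] True by (simp add: L'_def)
    next
      case False
      then have "N u \<inter> (?Q - {a}) = N u \<inter> ?Q" using graphD(1)[OF G] by blast
      then show ?thesis using False L(2)[of u] u by (simp add: L'_def)
    qed
    show "b \<in> ?Q - {a}" using ab graphD(2)[OF G] by auto
    show "card (N b \<inter> (?Q - {a})) < card (L' b)"
      using less[OF ab(2)] L(2)[OF ab(3)] ab by (simp add: L'_def)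
  qed
  then obtain c where c: "proper N L' (?Q - {a}) c" ..
  have "proper N L ?Q (c(a := x))"
    unfolding proper_def
  proof (intro ballI conjI)
    fix u assume u: "u \<in> ?Q"
    show "(c(a := x)) u \<in> L u" using ab u c by (auto simp: proper_def L'_def split: if_splits)
    fix w assume w: "w \<in> N u \<inter> ?Q"
    then have "w \<noteq> u" "u \<in> N w" using graphD[OF G] by blast+
    then show "(c(a := x)) u \<noteq> (c(a := x)) w"
      using c u w unfolding proper_def L'_def by (cases "u = a"; cases "w = a") (auto split: if_splits)
  qed
  then show ?thesis by blast
next
  case False
  let ?Q = "set xs" and ?m = "length xs"
  have d: "distinct xs" "3 \<le> ?m" using C by (auto simp: cycle_def)
  have eq: "L a = L b" if "a \<in> ?Q" "b \<in> N a" "b \<in> ?Q" for a b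
    using False that graphD(1)[OF G, of b a] by blast
  have all: "L u = L v" if "u \<in> ?Q" for u
  proof -
    let ?W = "{u \<in> ?Q. L u = L v}"
    have "?W = ?Q"
    proof (rule ccontr)
      assume "?W \<noteq> ?Q"
      moreover have "?W \<subseteq> ?Q" "?W \<noteq> {}" using v by auto
      ultimately obtain a b where "a \<in> ?W" "b \<in> ?Q - ?W" "b \<in> N a"
        using linkedD[OF linked_cycle[OF G C]] by meson
      then show False using eq[of a b] by auto
    qed
    with that show ?thesis by blast
  qed
  have deg: "2 \<le> card (N u \<inter> ?Q)" if u: "u \<in> ?Q" for u
  proof -
    obtain i where "i < ?m" "u = xs ! i" using u by (auto simp: in_set_conv_nth)
    then obtain a b where "a \<noteq> b" "{a, b} \<subseteq> N u \<inter> ?Q" using cycle_two_neighbors[OF G C] by metis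
    then show ?thesis using card_mono[of "N u \<inter> ?Q" "{a, b}"] by simp
  qed
  show ?thesis
  proof (cases "card (L v) \<le> 2")
    case False
    show ?thesis by (rule slack_coloring[OF G _ linked_cycle[OF G C] L v(1)]) (use False v in auto)
  next
    case True
    \<comment> \<open>All lists are now the same pair of colors. Hence no vertex has a chord, and
      the colors can alternate because the length is even.\<close>
    then have "card (L v) = 2" using deg[OF v(1)] L(2)[OF v(1)] by simp
    then obtain p q where pq: "L v = {p, q}" "p \<noteq> q" by (meson card_2_iff)
    define c where "c = (\<lambda>w. if \<exists>i<?m. even i \<and> xs ! i = w then p else q)"
    have ci: "c (xs ! i) = (if even i then p else q)" if "i < ?m" for i
      using that d unfolding c_def by (auto simp: nth_eq_iff_index_eq)
    have par: "even (Suc i mod ?m) \<longleftrightarrow> even (Suc i)" for i using ev by (metis dvd_mod_iff)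
    have "proper N L ?Q c"
      unfolding proper_def
    proof (intro ballI conjI)
      fix u assume u: "u \<in> ?Q"
      show "c u \<in> L u" using all[OF u] pq by (auto simp: c_def)
      fix w assume w: "w \<in> N u \<inter> ?Q"
      obtain i where i: "i < ?m" "u = xs ! i" using u by (auto simp: in_set_conv_nth)
      obtain j where j: "j < ?m" "Suc j mod ?m = i" "xs ! (Suc i mod ?m) \<noteq> xs ! j"
        "{xs ! (Suc i mod ?m), xs ! j} \<subseteq> N u \<inter> ?Q" using cycle_two_neighbors[OF G C i(1)] i by auto
      have "card (N u \<inter> ?Q) \<le> card {xs ! (Suc i mod ?m), xs ! j}"
        using L(2)[OF u] all[OF u] True j(3) by simp
      then have "{xs ! (Suc i mod ?m), xs ! j} = N u \<inter> ?Q" using j(4) by (intro card_seteq) auto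
      with w consider "w = xs ! (Suc i mod ?m)" | "w = xs ! j" by blast
      then show "c u \<noteq> c w"
      proof cases
        case 1
        moreover have "Suc i mod ?m < ?m" by (rule mod_less_divisor) (use d in auto)
        ultimately show ?thesis using ci i par[of i] pq by simp
      next
        case 2
        then show ?thesis using ci[OF i(1)] ci[OF j(1)] i j(2) par[of j] pq by auto
      qed
    qed
    then show ?thesis by blast
  qed
qed

text \<open>The bound 2 says that \<open>v\<close> has no chord: its two neighbors along the cycle
  are the only ones on it.\<close>

definition soft_cycle :: "('v \<Rightarrow> 'v set) \<Rightarrow> 'v set \<Rightarrow> bool" where
  "soft_cycle N B \<longleftrightarrow> (\<exists>xs v. cycle N xs \<and> even (length xs) \<and> set xs \<subseteq> B \<and> v \<in> set xs \<and>
     card (N v \<inter> set xs) \<le> 2)"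

text \<open>The lists \<open>L'\<close> are what may be left of lists of size \<open>d\<close> once the neighbors outside \<open>B\<close>
  have been colored.\<close>

definition completable :: "nat \<Rightarrow> ('v \<Rightarrow> 'v set) \<Rightarrow> ('v \<Rightarrow> 'c set) \<Rightarrow> 'v set \<Rightarrow> bool" where
  "completable d N L B \<longleftrightarrow> (\<forall>L'. (\<forall>u\<in>B. L' u \<subseteq> L u \<and> finite (L' u) \<and>
     d + card (N u \<inter> B) \<le> card (L' u) + card (N u)) \<longrightarrow> (\<exists>c. proper N L' B c))"

text \<open>A vertex of degree below \<open>d\<close> has a spare color, so
  \<open>slack_coloring\<close> applies. With a soft cycle, the vertices off the cycle are colored
  first, by connectedness; a vertex on the cycle then loses at most one color for each neighbor
  lost.\<close>

lemma completableI:
  assumes G: "graph N" and B: "finite B" "linked N B" and deg: "\<And>u. u \<in> B \<Longrightarrow> card (N u) \<le> d"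
    and cases: "(\<exists>u\<in>B. card (N u) < d) \<or> soft_cycle N B"
  shows "completable d N L B"
  unfolding completable_def
proof (intro allI impI)
  fix L' assume "\<forall>u\<in>B. L' u \<subseteq> L u \<and> finite (L' u) \<and> d + card (N u \<inter> B) \<le> card (L' u) + card (N u)"
  then have L': "finite (L' u)" "d + card (N u \<inter> B) \<le> card (L' u) + card (N u)" if "u \<in> B" for u
    using that by auto
  have le: "card (N u \<inter> B) \<le> card (L' u)" if "u \<in> B" for u using L'(2)[OF that] deg[OF that] by simp
  from cases show "\<exists>c. proper N L' B c"
  proof
    assume "\<exists>u\<in>B. card (N u) < d"
    then obtain u where "u \<in> B" "card (N u) < d" by auto
    then show ?thesis using L'(2)[of u] by (intro slack_coloring[OF G B L'(1) le, of u]) auto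
  next
    assume "soft_cycle N B"
    then obtain xs v where xs: "cycle N xs" "even (length xs)" "set xs \<subseteq> B" "v \<in> set xs" "card (N v \<inter> set xs) \<le> 2"
      by (auto simp: soft_cycle_def)
    let ?Q = "set xs"
    have "\<exists>c. proper N L' (B - ?Q) c"
    proof (rule greedy_coloring[OF G])
      fix W assume W: "W \<subseteq> B - ?Q" "W \<noteq> {}"
      then have "W \<subseteq> B" "W \<noteq> B" using xs by auto
      then obtain u where u: "u \<in> W" "card (N u \<inter> W) < card (N u \<inter> B)"
        using linked_card_less[OF B(2,1) _ W(2)] by metis
      then show "\<exists>v\<in>W. card (N v \<inter> W) < card (L' v)" using le[of u] \<open>W \<subseteq> B\<close> by (intro bexI[of _ u]) auto
    qed (use B L' in auto)
    then obtain c1 where c1: "proper N L' (B - ?Q) c1" ..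
    define L'' where "L'' = (\<lambda>u. L' u - c1 ` (N u \<inter> (B - ?Q)))"
    have "\<exists>c. proper N L'' ?Q c"
    proof (rule even_cycle_coloring[OF G xs(1,2,4,5)])
      fix u assume u: "u \<in> ?Q"
      then have uB: "u \<in> B" using xs by auto
      show "finite (L'' u)" using L'(1)[OF uB] by (simp add: L''_def)
      have "card (N u \<inter> B) = card (N u \<inter> ?Q) + card (N u \<inter> (B - ?Q))"
        using B xs(3) by (subst card_Un_disjoint[symmetric]) (auto intro!: arg_cong[of _ _ card])
      moreover have "card (L' u) - card (c1 ` (N u \<inter> (B - ?Q))) \<le> card (L'' u)"
        unfolding L''_def using B by (intro diff_card_le_card_Diff) auto
      moreover have "card (c1 ` (N u \<inter> (B - ?Q))) \<le> card (N u \<inter> (B - ?Q))"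
        using B by (intro card_image_le) auto
      ultimately show "card (N u \<inter> ?Q) \<le> card (L'' u)" using le[OF uB] by linarith
    qed
    then obtain c2 where c2: "proper N L'' ?Q c2" ..
    have "proper N L' B (\<lambda>u. if u \<in> ?Q then c2 u else c1 u)"
      unfolding proper_def
    proof (intro ballI conjI)
      fix u assume u: "u \<in> B"
      show "(if u \<in> ?Q then c2 u else c1 u) \<in> L' u" using c1 c2 u by (auto simp: proper_def L''_def)
      fix w assume w: "w \<in> N u \<inter> B"
      then have "u \<in> N w" using graphD[OF G] by blast
      have k: "c1 x \<noteq> c2 y" if "x \<in> B - ?Q" "y \<in> ?Q" "x \<in> N y" for x y
      proof -
        have "c2 y \<notin> c1 ` (N y \<inter> (B - ?Q))" using c2 that by (auto simp: proper_def L''_def)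
        moreover have "c1 x \<in> c1 ` (N y \<inter> (B - ?Q))" using that by blast
        ultimately show ?thesis by metis
      qed
      have "c1 u \<noteq> c2 w" if "u \<notin> ?Q" "w \<in> ?Q" using k[of u w] u that \<open>u \<in> N w\<close> by simp
      moreover have "c2 u \<noteq> c1 w" if "u \<in> ?Q" "w \<notin> ?Q" using k[of w u] w that by (metis DiffI IntE)
      ultimately show "(if u \<in> ?Q then c2 u else c1 u) \<noteq> (if w \<in> ?Q then c2 w else c1 w)"
        using c1 c2 u w unfolding proper_def by (cases "u \<in> ?Q"; cases "w \<in> ?Q") auto
    qed
    then show ?thesis by blast
  qed
qed

section \<open>Balls\<close>

fun near :: "('v \<Rightarrow> 'v set) \<Rightarrow> nat \<Rightarrow> 'v \<Rightarrow> 'v \<Rightarrow> bool" where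
  "near N 0 v u \<longleftrightarrow> u = v"
| "near N (Suc t) v u \<longleftrightarrow> near N t v u \<or> (\<exists>w\<in>N v. near N t w u)"

lemma near_refl [simp]: "near N t v v"
  by (induction t) auto

lemma near_mono: "near N s v u \<Longrightarrow> s \<le> t \<Longrightarrow> near N t v u"
  by (induction t) (auto simp: le_Suc_eq)

lemma near_trans: "near N s v u \<Longrightarrow> near N t u w \<Longrightarrow> near N (s + t) v w"
  by (induction s arbitrary: v) auto

lemma near_step: "near N t v u \<Longrightarrow> w \<in> N u \<Longrightarrow> near N (Suc t) v w"
  using near_trans[of N t v u 1 w] by simp

lemma near_Suc_right: "near N (Suc t) v u \<longleftrightarrow> near N t v u \<or> (\<exists>w. near N t v w \<and> u \<in> N w)"
proof
  show "near N (Suc t) v u \<Longrightarrow> near N t v u \<or> (\<exists>w. near N t v w \<and> u \<in> N w)"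
  proof (induction t arbitrary: v)
    case (Suc t)
    from Suc.prems consider "near N (Suc t) v u" | x where "x \<in> N v" "near N (Suc t) x u"
      by (metis near.simps(2))
    then show ?case
    proof cases
      case (2 x)
      from Suc.IH[OF 2(2)] show ?thesis
      proof
        assume "near N t x u"
        with 2 show ?thesis by auto
      next
        assume "\<exists>w. near N t x w \<and> u \<in> N w"
        then obtain w where "near N t x w" "u \<in> N w" by blast
        with 2 show ?thesis by auto
      qed
    qed blast
  qed auto
  show "near N (Suc t) v u" if "near N t v u \<or> (\<exists>w. near N t v w \<and> u \<in> N w)"
    using that near_step[of N t v] near_mono[of N t v u "Suc t"] by (elim disjE exE) (simp, blast)
qed

lemma near_sym: "graph N \<Longrightarrow> near N t v u \<Longrightarrow> near N t u v"
proof (induction t arbitrary: v)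
  case (Suc t)
  from Suc.prems(2) consider "near N t v u" | w where "w \<in> N v" "near N t w u" by auto
  then show ?case
  proof cases
    case 1
    then show ?thesis using Suc by simp
  next
    case (2 w)
    then have "near N t u w" "v \<in> N w" using Suc graphD(1) by metis+
    then show ?thesis by (rule near_step)
  qed
qed auto

definition ball_in :: "('v \<Rightarrow> 'v set) \<Rightarrow> nat \<Rightarrow> 'v \<Rightarrow> 'v set" where
  "ball_in N t v = {u. near N t v u}"

lemma ball_in_Suc: "ball_in N (Suc t) v = ball_in N t v \<union> (\<Union>u\<in>ball_in N t v. N u)"
  by (auto simp: ball_in_def near_Suc_right simp del: near.simps)

lemma finite_ball_in: "graph N \<Longrightarrow> finite (ball_in N t v)"
proof (induction t)
  case (Suc t)
  then show ?case using graphD(3) by (auto simp: ball_in_Suc)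
qed (simp add: ball_in_def)

lemma linked_ball_in:
  assumes "graph N"
  shows "linked N (ball_in N r v)"
  unfolding linked_def
proof (intro allI impI)
  let ?B = "ball_in N r v"
  \<comment> \<open>A walk from \<open>v\<close> to a point off \<open>W\<close> leaves
    \<open>W\<close> at some step. If \<open>v\<close> itself is off the given part, this is applied
    to the complement in the ball.\<close>
  have key: "\<exists>b\<in>W. \<exists>c\<in>N b. c \<in> ?B - W" if W: "v \<in> W" and x: "near N t v x" "t \<le> r" "x \<notin> W" for W t x
    using x
  proof (induction t arbitrary: x)
    case (Suc t)
    from Suc.prems(1) consider "near N t v x" | y where "near N t v y" "x \<in> N y"
      by (auto simp: near_Suc_right simp del: near.simps)
    then show ?case
    proof cases
      case 1
      then show ?thesis using Suc by simp
    next
      case (2 y)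
      show ?thesis
      proof (cases "y \<in> W")
        case True
        have "x \<in> ?B" using near_mono[OF Suc.prems(1,2)] by (simp add: ball_in_def)
        then show ?thesis using True 2 Suc by blast
      next
        case False
        then show ?thesis using Suc 2 by simp
      qed
    qed
  qed (use W in auto)
  fix W assume W: "W \<subseteq> ?B" "W \<noteq> {}" "W \<noteq> ?B"
  show "\<exists>u\<in>W. N u \<inter> (?B - W) \<noteq> {}"
  proof (cases "v \<in> W")
    case True
    obtain x where "x \<in> ?B" "x \<notin> W" using W by blast
    then show ?thesis using key[OF True, of r x] by (auto simp: ball_in_def)
  next
    case False
    obtain x where x: "x \<in> W" using W by blast
    have v: "v \<in> ?B" by (simp add: ball_in_def)
    have "near N r v x" using x W(1) by (auto simp: ball_in_def)
    then obtain b c where "b \<in> ?B - W" "c \<in> N b" "c \<in> ?B - (?B - W)"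
      using key[of "?B - W" r x] False v x by auto
    then show ?thesis using graphD(1)[OF assms, of c b] by blast
  qed
qed

definition restr :: "('v \<Rightarrow> 'v set) \<Rightarrow> 'v set \<Rightarrow> 'v \<Rightarrow> 'v set" where
  "restr N X v = (if v \<in> X then N v \<inter> X else {})"

lemma restr_subset: "restr N X v \<subseteq> N v" "restr N X v \<subseteq> X"
  by (auto simp: restr_def)

lemma graph_restr: "graph N \<Longrightarrow> graph (restr N X)"
  by (auto simp: graph_def restr_def)

lemma near_subgraph: "(\<And>u. M u \<subseteq> N u) \<Longrightarrow> near M t v u \<Longrightarrow> near N t v u"
  by (induction t arbitrary: v) auto

lemma near_restr: "near (restr N X) t v u \<Longrightarrow> v \<in> X \<Longrightarrow> u \<in> X"
  by (induction t arbitrary: v) (auto simp: restr_def)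

lemma ball_in_restr: "v \<in> X \<Longrightarrow> ball_in (restr N X) t v \<subseteq> X"
  by (auto simp: ball_in_def dest: near_restr)

lemma linked_mono:
  assumes "linked M Q" "\<And>u. M u \<subseteq> N u"
  shows "linked N Q"
  unfolding linked_def
proof (intro allI impI)
  fix W assume "W \<subseteq> Q" "W \<noteq> {}" "W \<noteq> Q"
  then obtain v u where "v \<in> W" "u \<in> Q - W" "u \<in> M v" using linkedD[OF assms(1)] by metis
  then show "\<exists>v\<in>W. N v \<inter> (Q - W) \<noteq> {}" using assms(2)[of v] by blast
qed

section \<open>Happy vertices\<close>

definition vol :: "('v \<Rightarrow> 'v set) \<Rightarrow> 'v set \<Rightarrow> nat" where
  "vol N X = (\<Sum>v\<in>X. card (N v \<inter> X))"

lemma vol_eq_card: "finite X \<Longrightarrow> vol N X = card (SIGMA v:X. N v \<inter> X)"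
  by (simp add: vol_def)

lemma sum_card_Int_swap:
  assumes "graph N" "finite S" "finite T"
  shows "(\<Sum>v\<in>S. card (N v \<inter> T)) = (\<Sum>u\<in>T. card (N u \<inter> S))"
proof -
  have *: "card (N v \<inter> T) = (\<Sum>u\<in>T. if u \<in> N v then 1 else 0)" if "finite T" for v T
    using that by (simp add: sum.If_cases Int_commute Int_def)
  have "(\<Sum>v\<in>S. card (N v \<inter> T)) = (\<Sum>v\<in>S. \<Sum>u\<in>T. if u \<in> N v then 1 else 0)"
    using *[OF assms(3)] by simp
  also have "\<dots> = (\<Sum>u\<in>T. \<Sum>v\<in>S. if u \<in> N v then 1 else 0)" by (rule sum.swap)
  also have "\<dots> = (\<Sum>u\<in>T. \<Sum>v\<in>S. if v \<in> N u then 1 else 0)"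
    using assms(1) by (intro sum.cong refl if_cong) (auto simp: graph_def)
  finally show ?thesis using *[OF assms(2)] by simp
qed

definition low :: "nat \<Rightarrow> ('v \<Rightarrow> 'v set) \<Rightarrow> 'v set" where
  "low d N = {v. card (N v) \<le> d}"

definition happy :: "nat \<Rightarrow> nat \<Rightarrow> ('v \<Rightarrow> 'v set) \<Rightarrow> ('v \<Rightarrow> 'c set) \<Rightarrow> 'v \<Rightarrow> bool" where
  "happy d r N L v \<longleftrightarrow> v \<in> low d N \<and> completable d N L (ball_in (restr N (low d N)) r v)"

text \<open>Since \<^term>\<open>vol N X\<close> is twice the number of edges in \<open>X\<close>, the second condition says that the
  ball has average degree at most \<open>d - 1/5\<close>.\<close>

definition sparse :: "nat \<Rightarrow> ('v \<Rightarrow> 'v set) \<Rightarrow> 'v set \<Rightarrow> bool" where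
  "sparse d N V \<longleftrightarrow>
     (\<forall>X\<subseteq>V. X \<noteq> {} \<longrightarrow> vol N X < d * card X) \<and>
     (\<forall>X\<subseteq>V. \<forall>v\<in>X. \<forall>i. \<not> soft_cycle N (ball_in (restr N X) i v) \<longrightarrow>
        10 * vol N (ball_in (restr N X) i v) + 2 * card (ball_in (restr N X) i v)
          \<le> 10 * d * card (ball_in (restr N X) i v))"

text \<open>An edge of \<open>H\<close> either misses the ball of radius \<open>i\<close> or has
  both ends in the ball of radius \<open>Suc i\<close>.\<close>

lemma vol_ball_step:
  assumes "graph N" "finite H" "v \<in> H"
  shows "vol N H \<le> vol N (H - ball_in (restr N H) i v) + vol N (ball_in (restr N H) (Suc i) v)"
proof -
  let ?B = "ball_in (restr N H) i v" and ?B' = "ball_in (restr N H) (Suc i) v"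
  have sub: "?B \<subseteq> ?B'" "?B' \<subseteq> H" by (simp add: ball_in_Suc) (rule ball_in_restr[OF assms(3)])
  have nb: "w \<in> ?B'" if "u \<in> ?B" "w \<in> N u" "w \<in> H" for u w
    using that ball_in_restr[OF assms(3), of N i] by (auto simp: ball_in_Suc restr_def)
  have "(SIGMA u:H. N u \<inter> H) \<subseteq> (SIGMA u:H - ?B. N u \<inter> (H - ?B)) \<union> (SIGMA u:?B'. N u \<inter> ?B')"
  proof
    fix z assume "z \<in> (SIGMA u:H. N u \<inter> H)"
    then obtain u w where z: "z = (u, w)" "u \<in> H" "w \<in> N u" "w \<in> H" by auto
    have "u \<in> N w" using graphD(1)[OF assms(1)] z by auto
    show "z \<in> (SIGMA u:H - ?B. N u \<inter> (H - ?B)) \<union> (SIGMA u:?B'. N u \<inter> ?B')"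
      using nb[of u w] nb[of w u] z \<open>u \<in> N w\<close> sub by auto
  qed
  then have "card (SIGMA u:H. N u \<inter> H) \<le> card ((SIGMA u:H - ?B. N u \<inter> (H - ?B)) \<union> (SIGMA u:?B'. N u \<inter> ?B'))"
    using assms(2) sub by (intro card_mono) (auto intro!: finite_SigmaI intro: finite_subset)
  also have "\<dots> \<le> card (SIGMA u:H - ?B. N u \<inter> (H - ?B)) + card (SIGMA u:?B'. N u \<inter> ?B')" by (rule card_Un_le)
  finally show ?thesis using assms(2) sub finite_subset[OF sub(2)] by (simp add: vol_eq_card)
qed

text \<open>An instance of Bernoulli's inequality: \<open>58 * l\<close> growth steps by the factor
  59/58 multiply a size by at least \<open>2 ^ l\<close>.\<close>

lemma two_le_59_58: "2 * 58 ^ 58 \<le> (59 :: nat) ^ 58"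
  by simp

text \<open>In a subgraph that is minimal with the density of \<open>S\<close>, balls are sparser than the edges
  leaving them require, so they grow exponentially.\<close>

lemma no_dense_subgraph:
  assumes G: "graph N" and S: "finite S" "S \<noteq> {}" "10 * d * card S \<le> 10 * vol N S + card S"
    and d: "d \<le> 6" and l: "card S < 2 ^ l"
    and sp: "\<And>H v i. H \<subseteq> S \<Longrightarrow> v \<in> H \<Longrightarrow> i \<le> 58 * l \<Longrightarrow>
      10 * vol N (ball_in (restr N H) i v) + 2 * card (ball_in (restr N H) i v)
          \<le> 10 * d * card (ball_in (restr N H) i v)"
  shows False
proof -
  define Q where "Q = (\<lambda>H. H \<subseteq> S \<and> H \<noteq> {} \<and> 10 * d * card H \<le> 10 * vol N H + card H)"
  have "Q S" using S by (auto simp: Q_def)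
  then obtain H where H: "Q H" "\<And>H'. Q H' \<Longrightarrow> card H \<le> card H'"
    using ex_has_least_nat[of Q S card] by blast
  have HS: "H \<subseteq> S" and fH: "finite H" using H(1) S finite_subset by (auto simp: Q_def)
  obtain v where v: "v \<in> H" using H(1) by (auto simp: Q_def)
  let ?b = "\<lambda>i. card (ball_in (restr N H) i v)"
  have step: "59 * ?b i \<le> 58 * ?b (Suc i)" if i: "Suc i \<le> 58 * l" for i
  proof -
    let ?B = "ball_in (restr N H) i v" and ?B' = "ball_in (restr N H) (Suc i) v"
    have sub: "?B \<subseteq> ?B'" "?B' \<subseteq> H" by (simp add: ball_in_Suc) (rule ball_in_restr[OF v])
    then have fin: "finite ?B" "finite ?B'" using fH by (meson finite_subset)+
    have vB: "v \<in> ?B" by (simp add: ball_in_def)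
    have "card (H - ?B) < card H" using fH v vB by (intro psubset_card_mono) auto
    then have "\<not> Q (H - ?B)" using H(2)[of "H - ?B"] by linarith
    then have 1: "10 * vol N (H - ?B) + card (H - ?B) \<le> 10 * d * card (H - ?B)"
    proof (cases "H - ?B = {}")
      case True
      show ?thesis unfolding True by (simp add: vol_def)
    next
      case False
      have "H - ?B \<subseteq> S" using HS by auto
      with False \<open>\<not> Q (H - ?B)\<close> show ?thesis by (simp add: Q_def)
    qed
    have 2: "10 * d * card H \<le> 10 * vol N H + card H" using H(1) by (simp add: Q_def)
    have c: "card H = card ?B + card (H - ?B)"
      using sub fH fin card_Un_disjoint[of ?B "H - ?B"] by (simp add: Un_absorb1)
    have 3: "10 * d * card ?B \<le> 10 * vol N ?B' + card ?B"
      using 1 2 vol_ball_step[OF G fH v, of i] unfolding c by (simp add: algebra_simps)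
    have 4: "10 * vol N ?B' + 2 * card ?B' \<le> 10 * d * card ?B'" by (rule sp[OF HS v i])
    obtain \<delta> where \<delta>: "card ?B' = card ?B + \<delta>" using card_mono[OF fin(2) sub(1)] by (metis le_Suc_ex)
    \<comment> \<open>The facts 3 and 4 combine to
      \<open>card ?B <= (10 * d - 2) * \<delta>\<close>, and \<open>10 * 6 - 2 = 58\<close>.\<close>
    have "d * \<delta> \<le> 6 * \<delta>" using d by (intro mult_right_mono) auto
    moreover have "10 * d * card ?B' = 10 * (d * card ?B) + 10 * (d * \<delta>)" "10 * d * card ?B = 10 * (d * card ?B)"
      by (simp_all add: \<delta> algebra_simps)
    ultimately show ?thesis using 3 4 \<delta> by linarith
  qed
  have pow: "59 ^ i \<le> 58 ^ i * ?b i" if "i \<le> 58 * l" for i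
    using that
  proof (induction i)
    case 0
    then show ?case by (simp add: ball_in_def)
  next
    case (Suc i)
    have "59 ^ Suc i \<le> 58 ^ i * (59 * ?b i)" using Suc by simp
    also have "\<dots> \<le> 58 ^ i * (58 * ?b (Suc i))" using step[OF Suc.prems] by (intro mult_left_mono) auto
    finally show ?case by simp
  qed
  have "(2 * 58 ^ 58) ^ l \<le> ((59 :: nat) ^ 58) ^ l" by (rule power_mono[OF two_le_59_58]) simp
  also have "\<dots> = 59 ^ (58 * l)" by (simp add: power_mult)
  also have "\<dots> \<le> 58 ^ (58 * l) * ?b (58 * l)" by (rule pow) simp
  finally have "58 ^ (58 * l) * 2 ^ l \<le> (58 :: nat) ^ (58 * l) * ?b (58 * l)"
    by (simp only: power_mult_distrib power_mult[symmetric] mult.commute[of "2 ^ l"])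
  then have "2 ^ l \<le> ?b (58 * l)" by simp
  moreover have "?b (58 * l) \<le> card S" using ball_in_restr[OF v] HS S(1) by (intro card_mono) auto
  ultimately show False using l by simp
qed

lemma soft_cycle_mono: "soft_cycle N B \<Longrightarrow> B \<subseteq> B' \<Longrightarrow> soft_cycle N B'"
  unfolding soft_cycle_def by (meson order_trans)

lemma ball_in_mono:
  assumes "X \<subseteq> Y" "i \<le> r"
  shows "ball_in (restr N X) i v \<subseteq> ball_in (restr N Y) r v"
proof -
  have "restr N X u \<subseteq> restr N Y u" for u using assms(1) by (auto simp: restr_def)
  then show ?thesis using assms(2) near_subgraph[of "restr N X" "restr N Y"] near_mono
    by (fastforce simp: ball_in_def)
qed

lemma unhappy_ball:
  assumes "graph N" "v \<in> low d N" "\<not> happy d r N L v"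
  shows "u \<in> ball_in (restr N (low d N)) r v \<Longrightarrow> card (N u) = d"
    and "\<not> soft_cycle N (ball_in (restr N (low d N)) r v)"
proof -
  let ?B = "ball_in (restr N (low d N)) r v"
  have B: "finite ?B" using assms(1) by (intro finite_ball_in graph_restr)
  have "linked (restr N (low d N)) ?B" using assms(1) by (intro linked_ball_in graph_restr)
  then have l: "linked N ?B" by (rule linked_mono) (rule restr_subset)
  have deg: "card (N u) \<le> d" if "u \<in> ?B" for u using ball_in_restr[OF assms(2)] that by (auto simp: low_def)
  have nc: "\<not> completable d N L ?B" using assms by (simp add: happy_def)
  then have *: "\<not> ((\<exists>u\<in>?B. card (N u) < d) \<or> soft_cycle N ?B)" using completableI[OF assms(1) B l deg] by blast
  show "card (N u) = d" if "u \<in> ?B" using * deg[OF that] that by auto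
  show "\<not> soft_cycle N ?B" using * by blast
qed

text \<open>The average degree is below \<open>d\<close>, and the vertices of \<open>S\<close> have
  degree exactly \<open>d\<close>. So the excess of the vertices in \<open>P\<close>, whose degrees
  exceed \<open>d\<close>, is paid for by the happy ones in \<open>A\<close>: both the size and the
  total degree of \<open>P\<close> are linear in \<open>card A\<close>. Therefore few edges leave
  \<open>S\<close>, and a large \<open>S\<close> would be too dense inside.\<close>

lemma many_happy:
  assumes G: "graph N" and V: "finite V" "\<And>v. v \<in> V \<Longrightarrow> N v \<subseteq> V" and sp: "sparse d N V"
    and d: "d \<le> 6" and l: "card V < 2 ^ l"
  shows "card V \<le> 487 * card {v \<in> V. happy d (58 * l) N L v}"
proof (cases "V = {}")
  case False
  define A where "A = {v \<in> V. happy d (58 * l) N L v}"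
  define S where "S = {v \<in> V. v \<in> low d N \<and> \<not> happy d (58 * l) N L v}"
  define P where "P = {v \<in> V. v \<notin> low d N}"
  have fin: "finite A" "finite S" "finite P" using V by (auto simp: A_def S_def P_def)
  have VU: "V = S \<union> (P \<union> A)" "S \<inter> (P \<union> A) = {}" "P \<inter> A = {}"
    by (auto simp: A_def S_def P_def happy_def)
  have cV: "card V = card S + (card P + card A)"
    unfolding VU(1) using fin VU(2,3) by (simp add: card_Un_disjoint)
  have sV: "sum f V = sum f S + (sum f P + sum f A)" for f :: "_ \<Rightarrow> nat"
    unfolding VU(1) using fin VU(2,3) by (simp add: sum.union_disjoint)
  have "vol N V < d * card V" using sp False by (auto simp: sparse_def)
  moreover have "vol N V = (\<Sum>v\<in>V. card (N v))"
    unfolding vol_def using V(2) by (intro sum.cong refl) (simp add: Int_absorb2)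
  ultimately have tot: "(\<Sum>v\<in>V. card (N v)) < d * card V" by simp
  have degS: "card (N v) = d" if "v \<in> S" for v
    using unhappy_ball(1)[OF G, of v d "58 * l" L v] that by (auto simp: S_def ball_in_def)
  have SS: "(\<Sum>v\<in>S. card (N v)) = d * card S" using degS by simp
  have SP: "Suc d * card P \<le> (\<Sum>v\<in>P. card (N v))"
    using sum_mono[of P "\<lambda>_. Suc d" "\<lambda>v. card (N v)"] by (simp add: P_def low_def not_le Suc_le_eq mult.commute)
  have SA: "(\<Sum>v\<in>A. card (N v)) \<le> d * card A"
    using sum_mono[of A "\<lambda>v. card (N v)" "\<lambda>_. d"] by (simp add: A_def happy_def low_def mult.commute)
  have p: "card P \<le> d * card A" using tot SS SP unfolding sV cV by (simp add: algebra_simps)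
  have SP': "(\<Sum>v\<in>P. card (N v)) \<le> d * (card P + card A)" using tot SS unfolding sV cV by (simp add: algebra_simps)
  have "d * card S = (\<Sum>v\<in>S. card (N v \<inter> S) + card (N v \<inter> (P \<union> A)))"
  proof -
    have "card (N v) = card (N v \<inter> S) + card (N v \<inter> (P \<union> A))" if "v \<in> S" for v
    proof -
      have "N v = (N v \<inter> S) \<union> (N v \<inter> (P \<union> A))" using V(2)[of v] that VU(1) by auto
      then show ?thesis using fin VU(2) card_Un_disjoint[of "N v \<inter> S" "N v \<inter> (P \<union> A)"]
        by (metis finite_Int finite_UnI Int_assoc inf_bot_right Int_left_commute)
    qed
    then show ?thesis using SS by simp
  qed
  also have "\<dots> = vol N S + (\<Sum>u\<in>P \<union> A. card (N u \<inter> S))"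
    using sum_card_Int_swap[OF G, of S "P \<union> A"] fin by (simp add: sum.distrib vol_def)
  also have "(\<Sum>u\<in>P \<union> A. card (N u \<inter> S)) \<le> (\<Sum>u\<in>P \<union> A. card (N u))"
    using graphD(3)[OF G] by (intro sum_mono card_mono) auto
  also have "\<dots> = (\<Sum>v\<in>P. card (N v)) + (\<Sum>v\<in>A. card (N v))"
    using fin VU(3) by (simp add: sum.union_disjoint)
  also have "\<dots> \<le> d * (card P + card A) + d * card A" using SP' SA by simp
  also have "\<dots> \<le> d * (d * card A + card A) + d * card A" using p by simp
  finally have vS: "d * card S \<le> vol N S + (d * d + 2 * d) * card A" by (simp add: algebra_simps)
  have "card S \<le> 480 * card A"
  proof (rule ccontr)
    assume "\<not> card S \<le> 480 * card A"
    then have s: "480 * card A \<le> card S" "S \<noteq> {}" by auto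
    \<comment> \<open>The factor 480 is \<open>10 * (d * d + 2 * d)\<close> for
      \<open>d = 6\<close>: the edges leaving \<open>S\<close> then cost at most 1/10 of the average
      degree.\<close>
    have "d * d \<le> 6 * 6" using d by (intro mult_mono) auto
    then have "10 * (d * d + 2 * d) * card A \<le> 480 * card A" using d by (intro mult_right_mono) auto
    then have dense: "10 * d * card S \<le> 10 * vol N S + card S" using vS s by (simp add: algebra_simps)
    show False
    proof (rule no_dense_subgraph[OF G fin(2) s(2) dense d])
      show "card S < 2 ^ l" using l cV by simp
      fix H v i assume H: "H \<subseteq> S" "v \<in> H" "i \<le> 58 * l"
      have "H \<subseteq> low d N" using H by (auto simp: S_def)
      then have "ball_in (restr N H) i v \<subseteq> ball_in (restr N (low d N)) (58 * l) v" using H(3) by (rule ball_in_mono)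
      moreover have "\<not> soft_cycle N (ball_in (restr N (low d N)) (58 * l) v)"
      proof -
        have "v \<in> S" using H by auto
        then show ?thesis using unhappy_ball(2)[OF G, of v d "58 * l" L] by (simp add: S_def)
      qed
      ultimately have "\<not> soft_cycle N (ball_in (restr N H) i v)" using soft_cycle_mono by blast
      moreover have "H \<subseteq> V" using H by (auto simp: S_def)
      ultimately show "10 * vol N (ball_in (restr N H) i v) + 2 * card (ball_in (restr N H) i v)
          \<le> 10 * d * card (ball_in (restr N H) i v)"
        using sp H(2) unfolding sparse_def by blast
    qed
  qed
  moreover have "d * card A \<le> 6 * card A" using d by (intro mult_right_mono) auto
  \<comment> \<open>The factor 487 is 480 for \<open>S\<close>, 6 for \<open>P\<close> and 1 for
    \<open>A\<close>.\<close>
  ultimately show ?thesis using p unfolding cV A_def[symmetric] by linarith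
qed simp

section \<open>Planar graphs without soft cycles are sparse\<close>

lemma cycleI:
  assumes "distinct xs" "3 \<le> length xs" "successively (\<lambda>a b. b \<in> N a) xs" "hd xs \<in> N (last xs)"
  shows "cycle N xs"
  unfolding cycle_def
proof (intro conjI allI impI)
  fix i assume i: "i < length xs"
  show "xs ! (Suc i mod length xs) \<in> N (xs ! i)"
  proof (cases "Suc i < length xs")
    case True
    then show ?thesis using assms(3) by (simp add: successively_conv_nth)
  next
    case False
    with i have "Suc i = length xs" by simp
    then have "i = length xs - 1" "xs \<noteq> []" using i by auto
    then show ?thesis using assms(4) by (simp add: last_conv_nth hd_conv_nth)
  qed
qed (use assms in auto)

lemma sum_card_swap:
  assumes "finite A" "finite B"
  shows "(\<Sum>x\<in>A. card {y \<in> B. R x y}) = (\<Sum>y\<in>B. card {x \<in> A. R x y})"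
proof -
  have "(\<Sum>x\<in>A. card {y \<in> B. R x y}) = (\<Sum>x\<in>A. \<Sum>y\<in>B. if R x y then 1 else 0)"
    using assms by (simp add: sum.If_cases Int_def)
  also have "\<dots> = (\<Sum>y\<in>B. \<Sum>x\<in>A. if R x y then 1 else 0)" by (rule sum.swap)
  also have "\<dots> = (\<Sum>y\<in>B. card {x \<in> A. R x y})"
    using assms by (simp add: sum.If_cases Int_def)
  finally show ?thesis .
qed

text \<open>Breadth-first search in a ball without soft cycles. It is applied for six colors, where
  triangles are allowed and no girth bound helps.\<close>

locale layered =
  fixes N :: "'v \<Rightarrow> 'v set" and H :: "'v set" and v0 :: 'v and i :: nat
  assumes G: "graph N" and v0: "v0 \<in> H"
    and hard: "\<not> soft_cycle N (ball_in (restr N H) i v0)"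
begin

abbreviation "M \<equiv> restr N H"
abbreviation "B \<equiv> ball_in M i v0"

definition level :: "'v \<Rightarrow> nat" where
  "level u = (LEAST t. near M t v0 u)"

lemma finite_B: "finite B"
  using G by (intro finite_ball_in graph_restr)

lemma near_level: "u \<in> B \<Longrightarrow> near M (level u) v0 u" "u \<in> B \<Longrightarrow> level u \<le> i"
  unfolding level_def by (auto simp: ball_in_def intro: LeastI Least_le)

lemma level_le: "near M t v0 u \<Longrightarrow> level u \<le> t"
  unfolding level_def by (rule Least_le)

lemma in_H: "u \<in> B \<Longrightarrow> u \<in> H"
  using ball_in_restr[OF v0] by blast

lemma level_adj: "u \<in> B \<Longrightarrow> w \<in> B \<Longrightarrow> w \<in> N u \<Longrightarrow> level w \<le> Suc (level u)"
  using near_level(1)[of u] in_H by (intro level_le near_step[of M _ v0 u]) (auto simp: restr_def)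

definition par :: "'v \<Rightarrow> 'v" where
  "par u = (SOME w. w \<in> B \<and> Suc (level w) = level u \<and> w \<in> N u)"

lemma par:
  assumes "u \<in> B" "0 < level u"
  shows "par u \<in> B" "Suc (level (par u)) = level u" "par u \<in> N u" "u \<in> N (par u)"
proof -
  obtain t where t: "level u = Suc t" using assms(2) by (cases "level u") auto
  have n: "near M (Suc t) v0 u" using near_level(1)[OF assms(1)] t by simp
  have "\<not> near M t v0 u" using level_le[of t u] t by auto
  then obtain w where w: "near M t v0 w" "u \<in> M w" using n by (auto simp: near_Suc_right simp del: near.simps)
  have "t \<le> i" using near_level(2)[OF assms(1)] t by simp
  then have wB: "w \<in> B" using near_mono[OF w(1)] by (simp add: ball_in_def)
  have "u \<in> N w" using w(2) restr_subset(1)[of N H w] by blast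
  then have "w \<in> N u" "level u \<le> Suc (level w)" using graphD(1)[OF G] level_adj[OF wB assms(1)] by auto
  moreover have "level w \<le> t" using level_le[OF w(1)] .
  ultimately have "\<exists>w. w \<in> B \<and> Suc (level w) = level u \<and> w \<in> N u" using t wB by (intro exI[of _ w]) auto
  then have "par u \<in> B \<and> Suc (level (par u)) = level u \<and> par u \<in> N u" unfolding par_def by (rule someI_ex)
  then show "par u \<in> B" "Suc (level (par u)) = level u" "par u \<in> N u" "u \<in> N (par u)"
    using graphD(1)[OF G] by auto
qed

abbreviation "up j u \<equiv> (par ^^ j) u"

lemma up:
  assumes "u \<in> B" "j \<le> level u"
  shows "up j u \<in> B \<and> level (up j u) = level u - j"
  using assms(2)
proof (induction j)
  case (Suc j)
  then show ?case using par(1,2)[of "up j u"] by auto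
qed (use assms in auto)

lemma up_adj:
  assumes "u \<in> B" "Suc j \<le> level u"
  shows "up (Suc j) u \<in> N (up j u)" "up j u \<in> N (up (Suc j) u)"
  using up[OF assms(1), of j] par(3,4)[of "up j u"] assms(2) by auto

lemma level_0: "u \<in> B \<Longrightarrow> level u = 0 \<Longrightarrow> u = v0"
  using near_level(1)[of u] by simp

text \<open>The paths upwards from \<open>y\<close> and \<open>z\<close> close an even cycle through \<open>x\<close>. Its top vertex has no
  other neighbors on the cycle, unless it is the common parent and adjacent to \<open>x\<close>.\<close>

lemma diamond:
  assumes x: "x \<in> B" and y: "y \<in> B" "y \<in> N x" and z: "z \<in> B" "z \<in> N x" "y \<noteq> z"
    and lev: "level y = t" "level z = t" "level x = t \<or> level x = Suc t"
  shows "level x = t \<and> par y = par z \<and> par y \<in> B \<and> par y \<in> N x \<and> par y \<in> N y \<and> z \<in> N y \<and> level (par y) < t"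
proof -
  have ne: "x \<noteq> y" "x \<noteq> z" using y z graphD(2)[OF G] by auto
  \<comment> \<open>The height at which the upward paths from \<open>y\<close> and \<open>z\<close>
    first meet; they do so at \<open>v0\<close> at the latest.\<close>
  define k where "k = (LEAST j. up j y = up j z)"
  have ex: "up t y = up t z"
    using up[OF y(1), of t] up[OF z(1), of t] lev level_0 by (metis diff_self_eq_0 order_refl)
  then have k: "up k y = up k z" "k \<le> t" unfolding k_def by (auto intro: LeastI Least_le)
  have nk: "up j y \<noteq> up j z" if "j < k" for j using that not_less_Least unfolding k_def by blast
  have k0: "0 < k" using k(1) z(3) by (cases k) auto
  have Y: "up j y \<in> B" "level (up j y) = t - j" if "j \<le> k" for j using up[OF y(1), of j] lev k that by auto
  have Z: "up j z \<in> B" "level (up j z) = t - j" if "j \<le> k" for j using up[OF z(1), of j] lev k that by auto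
  \<comment> \<open>The cycle goes from \<open>x\<close> to \<open>y\<close>, up to just below the
    meeting point, then from the meeting point down to \<open>z\<close>. Its length is
    \<open>2 * k + 2\<close>.\<close>
  define ys where "ys = map (\<lambda>j. up j y) [0..<k]"
  define zs where "zs = map (\<lambda>j. up (k - j) z) [0..<Suc k]"
  have sy: "set ys = (\<lambda>j. up j y) ` {..<k}" by (auto simp: ys_def)
  have sz: "set zs = (\<lambda>j. up j z) ` {..k}"
  proof -
    have "(\<lambda>j. k - j) ` {..k} = {..k}"
    proof (intro equalityI subsetI)
      fix j assume "j \<in> {..k}"
      then show "j \<in> (\<lambda>j. k - j) ` {..k}" by (intro image_eqI[of _ _ "k - j"]) auto
    qed auto
    moreover have "set zs = (\<lambda>j. up j z) ` (\<lambda>j. k - j) ` set [0..<Suc k]"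
      unfolding zs_def set_map image_image ..
    moreover have "set [0..<Suc k] = {..k}" by auto
    ultimately show ?thesis by (simp only:)
  qed
  have inj: "j = j'" if "t - j = t - j'" "j \<le> k" "j' \<le> k" for j j' using that k(2) by linarith
  let ?xs = "x # ys @ zs"
  have cyc: "cycle N ?xs"
  proof (rule cycleI)
    have "distinct ys" unfolding ys_def using inj Y(2)
      by (auto simp: distinct_map inj_on_def) (metis less_imp_le_nat)
    moreover have "distinct zs" unfolding zs_def distinct_map
    proof (intro conjI inj_onI)
      fix a b assume "a \<in> set [0..<Suc k]" "b \<in> set [0..<Suc k]" "up (k - a) z = up (k - b) z"
      then have "k - a = k - b" "a \<le> k" "b \<le> k" using inj[of "k - a" "k - b"] Z(2)[of "k - a"] Z(2)[of "k - b"] by auto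
      then show "a = b" by linarith
    qed simp
    moreover have "set ys \<inter> set zs = {}"
    proof -
      have "up j y \<noteq> up j' z" if "j < k" "j' \<le> k" for j j'
        using inj[of j j'] Y(2)[of j] Z(2)[of j'] nk[of j] that by (metis less_imp_le_nat)
      then show ?thesis by (auto simp: sy sz)
    qed
    moreover have "x \<notin> set ys"
    proof
      assume "x \<in> set ys"
      then obtain j where j: "j < k" "x = up j y" by (auto simp: sy)
      then have "level x = t - j" using Y(2)[of j] by simp
      then have "j = 0" using lev(3) k(2) j by linarith
      then show False using j ne by simp
    qed
    moreover have "x \<notin> set zs"
    proof
      assume "x \<in> set zs"
      then obtain j where j: "j \<le> k" "x = up j z" by (auto simp: sz)
      then have "level x = t - j" using Z(2)[of j] by simp
      then have "j = 0" using lev(3) k(2) j by linarith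
      then show False using j ne by simp
    qed
    ultimately show "distinct ?xs" by auto
    show "3 \<le> length ?xs" using k0 by (simp add: ys_def zs_def)
    have "hd ys = y" using k0 by (simp add: ys_def hd_map)
    have ly: "last ys = up (k - 1) y" using k0 by (simp add: ys_def last_map)
    have hz: "hd zs = up k z" unfolding zs_def by (simp add: hd_map del: upt_Suc)
    have "last zs = z" by (simp add: zs_def)
    have "ys \<noteq> []" "zs \<noteq> []" using k0 by (auto simp: ys_def zs_def)
    have "successively (\<lambda>a b. b \<in> N a) ys"
      unfolding ys_def successively_conv_nth
    proof (intro allI impI)
      fix j assume "Suc j < length (map (\<lambda>j. up j y) [0..<k])"
      then have "Suc j < k" by simp
      then show "map (\<lambda>j. up j y) [0..<k] ! Suc j \<in> N (map (\<lambda>j. up j y) [0..<k] ! j)"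
        using up_adj(1)[OF y(1), of j] lev k by simp
    qed
    moreover have "successively (\<lambda>a b. b \<in> N a) zs"
      unfolding zs_def successively_conv_nth
    proof (intro allI impI)
      fix j assume "Suc j < length (map (\<lambda>j. up (k - j) z) [0..<Suc k])"
      then have j: "j < k" by simp
      then have "Suc (k - Suc j) = k - j" by simp
      then show "map (\<lambda>j. up (k - j) z) [0..<Suc k] ! Suc j \<in> N (map (\<lambda>j. up (k - j) z) [0..<Suc k] ! j)"
        using up_adj(2)[OF z(1), of "k - Suc j"] lev k j by (simp del: upt_Suc funpow.simps)
    qed
    moreover have "hd zs \<in> N (last ys)"
      using up_adj(1)[OF y(1), of "k - 1"] lev k k0 hz ly by simp
    ultimately have "successively (\<lambda>a b. b \<in> N a) (ys @ zs)"
      by (simp add: successively_append_iff)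
    then show "successively (\<lambda>a b. b \<in> N a) ?xs"
      using y(2) \<open>hd ys = y\<close> \<open>ys \<noteq> []\<close> by (simp add: successively_Cons)
    show "hd ?xs \<in> N (last ?xs)" using graphD(1)[OF G z(2)] \<open>last zs = z\<close> \<open>zs \<noteq> []\<close> by simp
  qed
  have ev: "even (length ?xs)" by (simp add: ys_def zs_def)
  have sub: "set ?xs \<subseteq> B" using x Y(1) Z(1) by (auto simp: sy sz)
  \<comment> \<open>As the ball has no soft cycle, every vertex of this even cycle has a
    chord.\<close>
  have deg: "2 < card (N u \<inter> set ?xs)" if "u \<in> set ?xs" for u
    using hard cyc ev sub that unfolding soft_cycle_def by (meson not_le)
  let ?w = "up k y"
  have w: "?w \<in> set ?xs" "?w \<in> B" "level ?w = t - k" using Y[of k] k by (auto simp: sz)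
  have main: "k = 1 \<and> level x = t \<and> ?w \<in> N x"
  proof (rule ccontr)
    assume no: "\<not> ?thesis"
    have "N ?w \<inter> set ?xs \<subseteq> {up (k - 1) y, up (k - 1) z}"
    proof
      fix u assume u: "u \<in> N ?w \<inter> set ?xs"
      have uB: "u \<in> B" using u sub by blast
      have lu: "level u \<le> Suc (t - k)" using level_adj[OF w(2) uB] u w(3) by simp
      have uw: "u \<noteq> ?w" using u graphD(2)[OF G] by auto
      from u consider "u = x" | j where "j < k" "u = up j y" | j where "j \<le> k" "u = up j z"
        by (auto simp: sy sz)
      then show "u \<in> {up (k - 1) y, up (k - 1) z}"
      proof cases
        case 1
        then have "level x \<le> Suc (t - k)" using lu by simp
        then have "level x = t" "k = 1" using lev(3) k(2) k0 by arith+
        moreover have "?w \<in> N x" using u 1 graphD(1)[OF G] by blast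
        ultimately show ?thesis using no by blast
      next
        case (2 j)
        then have "j = k - 1" using lu Y(2)[of j] k by simp
        with 2 show ?thesis by simp
      next
        case (3 j)
        then have "j \<noteq> k" using uw k by auto
        then have "j = k - 1" using lu Z(2)[of j] k 3 by simp
        with 3 show ?thesis by simp
      qed
    qed
    then have "card (N ?w \<inter> set ?xs) \<le> card {up (k - 1) y, up (k - 1) z}" by (intro card_mono) auto
    also have "\<dots> \<le> 2" by (simp add: card_insert_if)
    finally show False using deg[OF w(1)] by simp
  qed
  then have k1: "k = 1" by blast
  have s: "set ?xs = {x, y, par y, z}"
    unfolding sy sz set_simps set_append k1 using k(1) k1 by (auto simp: lessThan_Suc atMost_Suc)
  \<comment> \<open>For \<open>k = 1\<close> the cycle has four vertices, so a chord at
    \<open>y\<close> can only lead to \<open>z\<close>.\<close>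
  have "z \<in> N y"
  proof (rule ccontr)
    assume "z \<notin> N y"
    then have "N y \<inter> set ?xs \<subseteq> {x, par y}" using graphD(2)[OF G, of y] unfolding s by auto
    then have "card (N y \<inter> set ?xs) \<le> card {x, par y}" by (intro card_mono) auto
    also have "\<dots> \<le> 2" by (simp add: card_insert_if)
    finally show False using deg[of y] unfolding s by simp
  qed
  moreover have "par y \<in> N y" using up_adj(1)[OF y(1), of 0] lev k k0 by simp
  ultimately show ?thesis using main k w k1 by auto
qed

text \<open>By \<open>diamond\<close>, a vertex has at most one neighbor on the previous level, and
  any two neighbors on its own level are adjacent and share a parent, which is adjacent to the
  vertex too. Four of the latter would thus complete a clique on six vertices. Edges between levels
  count once from each end, which gives \<open>3 + 1 + 1\<close>.\<close>

lemma vol_layered: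
  assumes no_K6: "\<And>X. X \<subseteq> B \<Longrightarrow> card X = 6 \<Longrightarrow> \<exists>a\<in>X. \<exists>b\<in>X. a \<noteq> b \<and> b \<notin> N a"
  shows "vol N B \<le> 5 * card B"
proof -
  define S U D where "S = (\<lambda>x. {y \<in> B. y \<in> N x \<and> level y = level x})"
    and "U = (\<lambda>x. {y \<in> B. y \<in> N x \<and> Suc (level y) = level x})"
    and "D = (\<lambda>x. {y \<in> B. y \<in> N x \<and> level y = Suc (level x)})"
  have U1: "card (U x) \<le> 1" if "x \<in> B" for x
  proof -
    have "a = b" if "a \<in> U x" "b \<in> U x" for a b
      using that diamond[OF \<open>x \<in> B\<close>, of a b "level a"] by (fastforce simp: U_def)
    then show ?thesis using finite_B card_le_Suc0_iff_eq[of "U x"] by (simp add: U_def)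
  qed
  have S3: "card (S x) \<le> 3" if x: "x \<in> B" for x
  proof (rule ccontr)
    assume "\<not> ?thesis"
    then obtain Y where Y: "Y \<subseteq> S x" "card Y = 4" by (metis not_le obtain_subset_with_card_n Suc_leI eval_nat_numeral(2) semiring_norm(26,27) numeral_3_eq_3 numeral_eq_Suc pred_numeral_simps(2))
    have fY: "finite Y" using Y(2) by (intro card_ge_0_finite) simp
    have YS: "y \<in> B" "y \<in> N x" "level y = level x" if "y \<in> Y" for y using that Y(1) by (auto simp: S_def)
    obtain y where y: "y \<in> Y" using Y(2) by fastforce
    have pair: "par a = par b \<and> par a \<in> B \<and> par a \<in> N x \<and> par a \<in> N a \<and> b \<in> N a \<and> level (par a) < level x"
      if "a \<in> Y" "b \<in> Y" "a \<noteq> b" for a b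
      using diamond[OF x, of a b "level x"] YS[OF that(1)] YS[OF that(2)] that(3) by auto
    have "Y \<noteq> {y}" using Y(2) by auto
    then obtain y' where y': "y' \<in> Y" "y' \<noteq> y" using y by blast
    let ?w = "par y"
    have w: "?w \<in> B" "?w \<in> N x" "level ?w < level x" using pair[of y y'] y y' by auto
    have wa: "?w \<in> N a" if a: "a \<in> Y" for a
      using pair[of y y'] pair[of a y] a y y' by (cases "a = y") auto
    have xY: "x \<notin> Y" using YS(2) graphD(2)[OF G] by blast
    have wY: "?w \<notin> Y" "?w \<noteq> x" using YS(3) w(3) by force+
    have "card (insert x (insert ?w Y)) = 6" using xY wY fY Y(2) by simp
    moreover have "insert x (insert ?w Y) \<subseteq> B" using x w YS by auto
    ultimately obtain a b where ab: "a \<in> insert x (insert ?w Y)" "b \<in> insert x (insert ?w Y)" "a \<noteq> b" "b \<notin> N a"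
      using no_K6 by blast
    then show False
      using w(2) wa YS(2) pair[of a b] graphD(1)[OF G] by blast
  qed
  have dU: "D x = {y \<in> B. x \<in> U y}" if "x \<in> B" for x
    using that graphD(1)[OF G] by (auto simp: D_def U_def)
  have "(\<Sum>x\<in>B. card (D x)) = (\<Sum>x\<in>B. card {y \<in> B. x \<in> U y})" using dU by simp
  also have "\<dots> = (\<Sum>y\<in>B. card {x \<in> B. x \<in> U y})" by (rule sum_card_swap[OF finite_B finite_B])
  also have "\<dots> = (\<Sum>y\<in>B. card (U y))" by (intro sum.cong refl arg_cong[of _ _ card]) (auto simp: U_def)
  finally have DU: "(\<Sum>x\<in>B. card (D x)) = (\<Sum>x\<in>B. card (U x))" .
  have "card (N x \<inter> B) \<le> card (S x) + card (U x) + card (D x)" if x: "x \<in> B" for x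
  proof -
    have "level y = level x \<or> Suc (level y) = level x \<or> level y = Suc (level x)" if "y \<in> N x \<inter> B" for y
      using level_adj[of x y] level_adj[of y x] x that graphD(1)[OF G, of y x] by force
    then have "N x \<inter> B \<subseteq> (S x \<union> U x) \<union> D x" by (auto simp: S_def U_def D_def)
    then have "card (N x \<inter> B) \<le> card ((S x \<union> U x) \<union> D x)"
      using finite_B by (intro card_mono) (auto simp: S_def U_def D_def)
    then show ?thesis using card_Un_le[of "S x \<union> U x" "D x"] card_Un_le[of "S x" "U x"] by linarith
  qed
  then have "vol N B \<le> (\<Sum>x\<in>B. card (S x) + card (U x) + card (D x))" unfolding vol_def by (rule sum_mono)
  also have "\<dots> = (\<Sum>x\<in>B. card (S x)) + 2 * (\<Sum>x\<in>B. card (U x))" by (simp add: sum.distrib DU)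
  also have "\<dots> \<le> 3 * card B + 2 * card B"
    using sum_mono[of B "\<lambda>x. card (S x)" "\<lambda>_. 3"] sum_mono[of B "\<lambda>x. card (U x)" "\<lambda>_. 1"] S3 U1
    by (simp add: mult.commute)
  finally show ?thesis by simp
qed

end

section \<open>The edge bounds in terms of neighborhood functions\<close>

definition nbrs :: "'v set set \<Rightarrow> 'v \<Rightarrow> 'v set" where
  "nbrs E v = {u. {u, v} \<in> E}"

lemma nbrs_subset: "simple_graph V E \<Longrightarrow> nbrs E v \<subseteq> V"
  by (auto simp: nbrs_def simple_graph_def)

lemma graph_nbrs: "simple_graph V E \<Longrightarrow> graph (nbrs E)"
  unfolding graph_def
proof (intro conjI allI impI)
  assume g: "simple_graph V E"
  show "v \<in> nbrs E u" if "u \<in> nbrs E v" for u v using that by (simp add: nbrs_def insert_commute)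
  show "v \<notin> nbrs E v" for v
  proof
    assume "v \<in> nbrs E v"
    then have "card {v, v} = 2" using g unfolding nbrs_def simple_graph_def by blast
    then show False by simp
  qed
  show "finite (nbrs E v)" for v 
    using g finite_subset[OF nbrs_subset[OF g]] by (simp add: simple_graph_def)
qed

lemma vol_nbrs:
  assumes "simple_graph V E" "finite X"
  shows "vol (nbrs E) X = 2 * card {e \<in> E. e \<subseteq> X}"
proof -
  let ?F = "{e \<in> E. e \<subseteq> X}"
  have fF: "finite ?F" using assms(2) by (intro finite_subset[of ?F "Pow X"]) auto
  have "card (nbrs E v \<inter> X) = card {e \<in> ?F. v \<in> e}" if v: "v \<in> X" for v
  proof (rule bij_betw_same_card)
    show "bij_betw (\<lambda>u. {u, v}) (nbrs E v \<inter> X) {e \<in> ?F. v \<in> e}"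
      unfolding bij_betw_def
    proof
      show "inj_on (\<lambda>u. {u, v}) (nbrs E v \<inter> X)" by (auto simp: inj_on_def doubleton_eq_iff)
      show "(\<lambda>u. {u, v}) ` (nbrs E v \<inter> X) = {e \<in> ?F. v \<in> e}"
      proof (intro equalityI subsetI)
        fix e assume "e \<in> {e \<in> ?F. v \<in> e}"
        then have e: "e \<in> E" "e \<subseteq> X" "v \<in> e" by auto
        then have "card e = 2" using assms(1) by (auto simp: simple_graph_def)
        then obtain u where "e = {u, v}" using e(3) by (auto simp: card_2_iff)
        then show "e \<in> (\<lambda>u. {u, v}) ` (nbrs E v \<inter> X)" using e by (auto simp: nbrs_def)
      qed (use v in \<open>auto simp: nbrs_def\<close>)
    qed
  qed
  then have "vol (nbrs E) X = (\<Sum>v\<in>X. card {e \<in> ?F. v \<in> e})" unfolding vol_def by (rule sum.cong[OF refl])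
  also have "\<dots> = (\<Sum>e\<in>?F. card {v \<in> X. v \<in> e})" by (rule sum_card_swap[OF assms(2) fF])
  also have "\<dots> = (\<Sum>e\<in>?F. 2)"
  proof (intro sum.cong refl)
    fix e assume "e \<in> ?F"
    then have "{v \<in> X. v \<in> e} = e" "card e = 2" using assms(1) by (auto simp: simple_graph_def)
    then show "card {v \<in> X. v \<in> e} = 2" by simp
  qed
  finally show ?thesis by simp
qed

lemma cycle_in_nbrs:
  assumes "cycle_in {e \<in> E. e \<subseteq> X} xs"
  shows "cycle (nbrs E) xs" "set xs \<subseteq> X"
proof -
  have d: "distinct xs" "3 \<le> length xs" "cycle_edges xs \<subseteq> {e \<in> E. e \<subseteq> X}" using assms by (auto simp: cycle_in_def)
  then have "xs \<noteq> []" by auto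
  then show "cycle (nbrs E) xs"
    using d cycle_edges_conv_nth[of xs] by (auto simp: cycle_def nbrs_def insert_commute)
  show "set xs \<subseteq> X" using d Union_cycle_edges[of xs] by auto
qed

lemma planar_vol_bound:
  assumes g: "simple_graph V E" and pl: "planar V E" and X: "X \<subseteq> V" "X \<noteq> {}"
    and gir: "\<And>xs. cycle (nbrs E) xs \<Longrightarrow> set xs \<subseteq> X \<Longrightarrow> h + 2 \<le> length xs"
  shows "h * vol (nbrs E) X + 2 * (h + 2) \<le> 2 * (h + 2) * card X"
    and "cycle_in {e \<in> E. e \<subseteq> X} xs \<Longrightarrow> h * vol (nbrs E) X + 4 * (h + 2) \<le> 2 * (h + 2) * card X"
proof -
  let ?F = "{e \<in> E. e \<subseteq> X}"
  have fX: "finite X" using X g finite_subset by (auto simp: simple_graph_def)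
  have fF: "finite ?F" using fX by (intro finite_subset[of ?F "Pow X"]) auto
  have v: "vol (nbrs E) X = 2 * card ?F" by (rule vol_nbrs[OF g fX])
  have cX: "0 < card X" using X fX by auto
  have UX: "(h + 2) * card (\<Union>?F) \<le> (h + 2) * card X" using fX by (intro mult_left_mono card_mono) auto
  have E2: "\<And>e. e \<in> E \<Longrightarrow> e \<subseteq> V \<and> card e = 2" using g by (auto simp: simple_graph_def)
  have gg: "girth_ge (h + 2) ?F" using gir cycle_in_nbrs unfolding girth_ge_def by metis
  show "h * vol (nbrs E) X + 2 * (h + 2) \<le> 2 * (h + 2) * card X"
  proof (cases "?F = {}")
    case True
    have "2 * (h + 2) * 1 \<le> 2 * (h + 2) * card X" using cX by (intro mult_left_mono) auto
    then show ?thesis unfolding v True by simp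
  next
    case False
    have "h * card ?F + (h + 2) \<le> (h + 2) * card (\<Union>?F)"
      by (rule planar_edge_bound(1)[OF fF False _ E2 pl gg]) auto
    then show ?thesis using UX unfolding v by (simp add: algebra_simps)
  qed
  assume c: "cycle_in ?F xs"
  then have "cycle_edges xs \<subseteq> ?F" "cycle_edges xs \<noteq> {}" by (auto simp: cycle_in_def cycle_edges_def)
  then have ne: "?F \<noteq> {}" by blast
  have "h * card ?F + 2 * (h + 2) \<le> (h + 2) * card (\<Union>?F)"
    by (rule planar_edge_bound(2)[OF fF ne _ E2 pl gg c]) auto
  then show "h * vol (nbrs E) X + 4 * (h + 2) \<le> 2 * (h + 2) * card X"
    using UX unfolding v by (simp add: algebra_simps)
qed

text \<open>A chord at a vertex of a 6-cycle would close a cycle of length 3 or 4.\<close>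

lemma soft_cycle_6:
  assumes G: "graph N" and c: "cycle N xs" "length xs = 6" "set xs \<subseteq> B"
    and gir: "\<And>xs. cycle N xs \<Longrightarrow> set xs \<subseteq> B \<Longrightarrow> 6 \<le> length xs"
  shows "soft_cycle N B"
proof -
  obtain a b c' d e f where xs: "xs = [a, b, c', d, e, f]"
    using c(2) by (auto simp: numeral_eq_Suc length_Suc_conv)
  have adj: "b \<in> N a" "c' \<in> N b" "d \<in> N c'" "e \<in> N d" "f \<in> N e" "a \<in> N f" "distinct [a, b, c', d, e, f]"
  proof -
    have step: "xs ! (Suc i mod 6) \<in> N (xs ! i)" if "i < 6" for i using c(1,2) that unfolding cycle_def by simp
    show "b \<in> N a" "c' \<in> N b" "d \<in> N c'" "e \<in> N d" "f \<in> N e" "a \<in> N f"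
      using step[of 0] step[of 1] step[of 2] step[of 3] step[of 4] step[of 5] unfolding xs by simp_all
    show "distinct [a, b, c', d, e, f]" using c(1) unfolding xs cycle_def by blast
  qed
  have "c' \<notin> N a"
  proof
    assume "c' \<in> N a"
    then have "cycle N [a, b, c']" using adj graphD(1)[OF G] by (intro cycleI) auto
    then show False using gir[of "[a, b, c']"] c(3) xs by auto
  qed
  moreover have "e \<notin> N a"
  proof
    assume "e \<in> N a"
    then have "cycle N [a, e, f]" using adj graphD(1)[OF G] by (intro cycleI) auto
    then show False using gir[of "[a, e, f]"] c(3) xs by auto
  qed
  moreover have "d \<notin> N a"
  proof
    assume "d \<in> N a"
    then have "cycle N [a, b, c', d]" using adj graphD(1)[OF G] by (intro cycleI) auto
    then show False using gir[of "[a, b, c', d]"] c(3) xs by auto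
  qed
  ultimately have "N a \<inter> set xs \<subseteq> {b, f}" using graphD(2)[OF G, of a] xs by auto
  then have "card (N a \<inter> set xs) \<le> card {b, f}" by (intro card_mono) auto
  also have "\<dots> \<le> 2" by (simp add: card_insert_if)
  finally show ?thesis unfolding soft_cycle_def using c xs by (intro exI[of _ xs] exI[of _ a]) auto
qed

lemma soft_cycle_4:
  assumes G: "graph N" and c: "cycle N xs" "length xs = 4" "set xs \<subseteq> B"
    and gir: "\<And>xs. cycle N xs \<Longrightarrow> set xs \<subseteq> B \<Longrightarrow> 4 \<le> length xs"
  shows "soft_cycle N B"
proof -
  obtain a b c' d where xs: "xs = [a, b, c', d]"
    using c(2) by (auto simp: numeral_eq_Suc length_Suc_conv)
  have adj: "b \<in> N a" "c' \<in> N b" "d \<in> N c'" "a \<in> N d" "distinct [a, b, c', d]"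
  proof -
    have step: "xs ! (Suc i mod 4) \<in> N (xs ! i)" if "i < 4" for i using c(1,2) that unfolding cycle_def by simp
    show "b \<in> N a" "c' \<in> N b" "d \<in> N c'" "a \<in> N d"
      using step[of 0] step[of 1] step[of 2] step[of 3] unfolding xs by simp_all
    show "distinct [a, b, c', d]" using c(1) unfolding xs cycle_def by blast
  qed
  have "c' \<notin> N a"
  proof
    assume "c' \<in> N a"
    then have "cycle N [a, b, c']" using adj graphD(1)[OF G] by (intro cycleI) auto
    then show False using gir[of "[a, b, c']"] c(3) xs by auto
  qed
  then have "N a \<inter> set xs \<subseteq> {b, d}" using graphD(2)[OF G, of a] xs by auto
  then have "card (N a \<inter> set xs) \<le> card {b, d}" by (intro card_mono) auto
  also have "\<dots> \<le> 2" by (simp add: card_insert_if)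
  finally show ?thesis unfolding soft_cycle_def using c xs by (intro exI[of _ xs] exI[of _ a]) auto
qed

text \<open>The weaker bound, which also covers forests, still allows the 15 edges of this clique
  with equality; the stronger one, available because of a triangle, does not.\<close>

lemma planar_no_K6:
  assumes g: "simple_graph V E" and pl: "planar V E" and X: "X \<subseteq> V" "card X = 6"
  shows "\<exists>a\<in>X. \<exists>b\<in>X. a \<noteq> b \<and> b \<notin> nbrs E a"
proof (rule ccontr)
  assume "\<not> ?thesis"
  then have K: "b \<in> nbrs E a" if "a \<in> X" "b \<in> X" "a \<noteq> b" for a b using that by blast
  have fX: "finite X" using X(2) by (intro card_ge_0_finite) simp
  have "nbrs E v \<inter> X = X - {v}" if "v \<in> X" for v
    using K[OF that] graphD(2)[OF graph_nbrs[OF g], of v] by auto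
  then have v: "vol (nbrs E) X = 30" unfolding vol_def using X(2) fX by simp
  obtain Y where Y: "Y \<subseteq> X" "card Y = 3" using X(2) obtain_subset_with_card_n[of 3 X] by auto
  then obtain a b c where abc: "Y = {a, b, c}" "a \<noteq> b" "b \<noteq> c" "a \<noteq> c" by (auto simp: card_3_iff)
  have c: "cycle_in {e \<in> E. e \<subseteq> X} [a, b, c]"
    using abc Y K by (auto simp: cycle_in_def cycle_edges_def nbrs_def insert_commute)
  have "X \<noteq> {}" using X(2) by auto
  then have "1 * vol (nbrs E) X + 4 * (1 + 2) \<le> 2 * (1 + 2) * card X"
    by (rule planar_vol_bound(2)[OF g pl X(1) _ _ c]) (auto simp: cycle_def)
  then show False unfolding v X(2) by simp
qed

text \<open>For all three pairs, \<open>2 * (h + 2) / h\<close> equals \<open>d\<close>, so girth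
  \<open>h + 2\<close> gives average degree below \<open>d\<close>. If there is no soft cycle,
  4-cycles or 6-cycles are excluded as well, and the bound can be used with \<open>h + 1\<close> in
  place of \<open>h\<close> for \<open>d = 4\<close> and \<open>d = 3\<close>.\<close>

lemma planar_sparse:
  assumes g: "simple_graph V E" and pl: "planar V E"
    and hd: "(h, d) \<in> {(1, 6), (2, 4), (4, 3)}"
    and gir: "\<And>xs. cycle (nbrs E) xs \<Longrightarrow> set xs \<subseteq> V \<Longrightarrow> h + 2 \<le> length xs"
  shows "sparse d (nbrs E) V"
  unfolding sparse_def
proof (intro conjI allI impI ballI)
  fix X assume X: "X \<subseteq> V" "X \<noteq> {}"
  have "h * vol (nbrs E) X + 2 * (h + 2) \<le> 2 * (h + 2) * card X"
    by (rule planar_vol_bound(1)[OF g pl X]) (use gir X in auto)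
  moreover have "h = 1 \<and> d = 6 \<or> h = 2 \<and> d = 4 \<or> h = 4 \<and> d = 3" using hd by auto
  ultimately show "vol (nbrs E) X < d * card X" by (elim disjE conjE) simp_all
next
  fix X v i
  let ?B = "ball_in (restr (nbrs E) X) i v"
  assume X: "X \<subseteq> V" and v: "v \<in> X" and hard: "\<not> soft_cycle (nbrs E) ?B"
  have G: "graph (nbrs E)" by (rule graph_nbrs[OF g])
  have B: "?B \<subseteq> V" "?B \<noteq> {}" using ball_in_restr[OF v, of "nbrs E" i] X by (auto simp: ball_in_def intro: near_refl)
  have gB: "h + 2 \<le> length xs" if "cycle (nbrs E) xs" "set xs \<subseteq> ?B" for xs using gir[OF that(1)] that(2) B by auto
  from hd consider "h = 1" "d = 6" | "h = 2" "d = 4" | "h = 4" "d = 3" by auto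
  then show "10 * vol (nbrs E) ?B + 2 * card ?B \<le> 10 * d * card ?B"
  proof cases
    case 1
    interpret layered "nbrs E" X v i by standard (use G v hard in auto)
    have "vol (nbrs E) ?B \<le> 5 * card ?B"
    proof (rule vol_layered)
      fix Y assume "Y \<subseteq> ?B" "card Y = 6"
      then show "\<exists>a\<in>Y. \<exists>b\<in>Y. a \<noteq> b \<and> b \<notin> nbrs E a"
        by (intro planar_no_K6[OF g pl] order_trans[OF _ B(1)])
    qed
    then show ?thesis using 1 by simp
  next
    case 2
    have "3 * vol (nbrs E) ?B + 2 * (3 + 2) \<le> 2 * (3 + 2) * card ?B"
    proof (rule planar_vol_bound(1)[OF g pl B])
      fix xs assume xs: "cycle (nbrs E) xs" "set xs \<subseteq> ?B"
      have "length xs \<noteq> 4"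
        using soft_cycle_4[OF G xs(1) _ xs(2)] hard gB 2 by auto
      then show "3 + 2 \<le> length xs" using gB[OF xs] 2 by simp
    qed
    then show ?thesis using 2 by simp
  next
    case 3
    have "5 * vol (nbrs E) ?B + 2 * (5 + 2) \<le> 2 * (5 + 2) * card ?B"
    proof (rule planar_vol_bound(1)[OF g pl B])
      fix xs assume xs: "cycle (nbrs E) xs" "set xs \<subseteq> ?B"
      have "length xs \<noteq> 6"
        using soft_cycle_6[OF G xs(1) _ xs(2)] hard gB 3 by auto
      then show "5 + 2 \<le> length xs" using gB[OF xs] 3 by simp
    qed
    then show ?thesis using 3 by simp
  qed
qed

section \<open>Coloring in rounds\<close>

text \<open>Each rank takes one round. The choice at a vertex involves only its list and the present
  colors of its neighbors, which keeps the process local.\<close>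

primrec greedy :: "('v \<Rightarrow> 'v set) \<Rightarrow> ('v \<Rightarrow> 'c set) \<Rightarrow> ('v \<Rightarrow> nat option) \<Rightarrow> ('v \<Rightarrow> 'c option) \<Rightarrow> nat \<Rightarrow> 'v \<Rightarrow> 'c option"
  where
  "greedy N L rk c 0 = c"
| "greedy N L rk c (Suc j) =
     (\<lambda>v. if rk v = Some j then Some (SOME x. x \<in> L v \<and> Some x \<notin> greedy N L rk c j ` N v)
          else greedy N L rk c j v)"

text \<open>The set in \<open>few\<close> consists of the neighbors colored before the turn of
  \<open>v\<close>. Neighbors of the same rank do not exist, and later ones avoid the color of
  \<open>v\<close> themselves.\<close>

lemma greedy_correct:
  assumes G: "graph N"
    and c: "\<And>u v x. v \<in> N u \<Longrightarrow> c u = Some x \<Longrightarrow> c v \<noteq> Some x"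
    and rk_c: "\<And>v. rk v \<noteq> None \<Longrightarrow> c v = None"
    and rk_adj: "\<And>u v j. v \<in> N u \<Longrightarrow> rk u = Some j \<Longrightarrow> rk v \<noteq> Some j"
    and few: "\<And>v j. rk v = Some j \<Longrightarrow>
      card {u \<in> N v. c u \<noteq> None \<or> (\<exists>i<j. rk u = Some i)} < card (L v)"
  shows "(\<forall>u v x. v \<in> N u \<longrightarrow> greedy N L rk c m u = Some x \<longrightarrow> greedy N L rk c m v \<noteq> Some x) \<and>
    (\<forall>v. (\<exists>j<m. rk v = Some j) \<longrightarrow> (\<exists>x\<in>L v. greedy N L rk c m v = Some x)) \<and>
    (\<forall>v. \<not> (\<exists>j<m. rk v = Some j) \<longrightarrow> greedy N L rk c m v = c v)"
proof (induction m)
  case 0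
  then show ?case using c by auto
next
  case (Suc m)
  let ?g = "greedy N L rk c m"
  have IH1: "v \<in> N u \<Longrightarrow> ?g u = Some x \<Longrightarrow> ?g v \<noteq> Some x" for u v x using Suc by blast
  have IH2: "\<exists>j<m. rk v = Some j \<Longrightarrow> \<exists>x\<in>L v. ?g v = Some x" "\<not> (\<exists>j<m. rk v = Some j) \<Longrightarrow> ?g v = c v" for v
    using Suc by blast+
  have pick: "(SOME x. x \<in> L v \<and> Some x \<notin> ?g ` N v) \<in> L v \<and> Some (SOME x. x \<in> L v \<and> Some x \<notin> ?g ` N v) \<notin> ?g ` N v"
    if v: "rk v = Some m" for v
  proof -
    let ?U = "{u \<in> N v. c u \<noteq> None \<or> (\<exists>i<m. rk u = Some i)}"
    have fU: "finite ?U" using graphD(3)[OF G, of v] by simp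
    have "?g u \<noteq> None \<Longrightarrow> c u \<noteq> None \<or> (\<exists>i<m. rk u = Some i)" for u using IH2(2)[of u] by metis
    then have sub: "{x. Some x \<in> ?g ` N v} \<subseteq> (\<lambda>u. the (?g u)) ` ?U"
      by (smt (verit) image_iff mem_Collect_eq option.distinct(1) option.sel subsetI)
    then have "card {x. Some x \<in> ?g ` N v} \<le> card ((\<lambda>u. the (?g u)) ` ?U)" using fU by (intro card_mono) auto
    also have "\<dots> \<le> card ?U" using fU by (rule card_image_le)
    also have "\<dots> < card (L v)" by (rule few[OF v])
    finally have less: "card {x. Some x \<in> ?g ` N v} < card (L v)" .
    have "finite {x. Some x \<in> ?g ` N v}" using sub fU finite_subset by blast
    then have "\<not> L v \<subseteq> {x. Some x \<in> ?g ` N v}" using less card_mono by (metis not_le)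
    then have "\<exists>x. x \<in> L v \<and> Some x \<notin> ?g ` N v" by blast
    then show ?thesis by (rule someI_ex)
  qed
  show ?case
  proof (intro conjI allI impI)
    fix u v x assume uv: "v \<in> N u" and u: "greedy N L rk c (Suc m) u = Some x"
    have vu: "u \<in> N v" using graphD(1)[OF G uv] .
    show "greedy N L rk c (Suc m) v \<noteq> Some x"
    proof (cases "rk u = Some m")
      case True
      then have "rk v \<noteq> Some m" using rk_adj[OF uv] by blast
      moreover have "Some x \<notin> ?g ` N u" using pick[OF True] u True by auto
      ultimately show ?thesis using uv by (metis (no_types, lifting) greedy.simps(2) image_eqI)
    next
      case False
      then have gu: "?g u = Some x" using u by simp
      show ?thesis
      proof (cases "rk v = Some m")
        case True
        then have "Some (SOME x. x \<in> L v \<and> Some x \<notin> ?g ` N v) \<noteq> ?g u" using pick[OF True] vu by blast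
        then show ?thesis using True gu by auto
      next
        case nv: False
        then show ?thesis using IH1[OF uv gu] by simp
      qed
    qed
  next
    fix v assume "\<exists>j<Suc m. rk v = Some j"
    then show "\<exists>x\<in>L v. greedy N L rk c (Suc m) v = Some x"
    proof (cases "rk v = Some m")
      case True
      then show ?thesis using pick[OF True] by auto
    next
      case False
      then have "\<exists>j<m. rk v = Some j" using \<open>\<exists>j<Suc m. rk v = Some j\<close> less_Suc_eq by auto
      then show ?thesis using IH2(1)[of v] False by simp
    qed
  next
    fix v assume "\<not> (\<exists>j<Suc m. rk v = Some j)"
    then have "rk v \<noteq> Some m" "\<not> (\<exists>j<m. rk v = Some j)" using less_Suc_eq by blast+
    then show "greedy N L rk c (Suc m) v = c v" using IH2(2)[of v] by simp
  qed
qed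

section \<open>Symmetry breaking with the bits of the identifiers\<close>

text \<open>In step \<open>j\<close> the classes of identifiers with the same value of \<open>v div 2 ^ j\<close> are merged in
  pairs; the class with bit 1 gives way to the class with bit 0.\<close>

primrec ruling :: "(nat \<Rightarrow> nat set) \<Rightarrow> nat \<Rightarrow> nat set \<Rightarrow> nat \<Rightarrow> nat set" where
  "ruling G a A 0 = A"
| "ruling G a A (Suc j) = {v \<in> ruling G a A j. \<not> (odd (v div 2 ^ j) \<and>
     (\<exists>u\<in>ruling G a A j. even (u div 2 ^ j) \<and> u div 2 ^ Suc j = v div 2 ^ Suc j \<and> near G a v u))}"

lemma ruling_subset: "ruling G a A j \<subseteq> A"
  by (induction j) auto

text \<open>Whoever causes a removal has bit 0 and survives the step, so each step adds at most
  \<open>a\<close> to the distance.\<close>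

lemma ruling_dominates: "v \<in> A \<Longrightarrow> \<exists>s\<in>ruling G a A j. near G (a * j) v s"
proof (induction j)
  case (Suc j)
  then obtain s where s: "s \<in> ruling G a A j" "near G (a * j) v s" by auto
  show ?case
  proof (cases "s \<in> ruling G a A (Suc j)")
    case True
    then show ?thesis using near_mono[OF s(2), of "a * Suc j"] by auto
  next
    case False
    then obtain u where u: "u \<in> ruling G a A j" "even (u div 2 ^ j)" "near G a s u" using s by auto
    then have "u \<in> ruling G a A (Suc j)" by simp
    moreover have "near G (a * Suc j) v u" using near_trans[OF s(2) u(3)] by (simp add: add.commute)
    ultimately show ?thesis by blast
  qed
qed auto

lemma div_pow_Suc: "(v :: nat) div 2 ^ Suc j = v div 2 ^ j div 2"
  by (simp only: power_Suc2 div_mult2_eq)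

text \<open>If two survivors of a merged class are near each other, their bits agree, so they were
  in the same class before. Once \<open>2 ^ j\<close> exceeds all identifiers there is only one
  class.\<close>

lemma ruling_independent:
  assumes G: "graph G"
  shows "u \<in> ruling G a A j \<Longrightarrow> v \<in> ruling G a A j \<Longrightarrow> u div 2 ^ j = v div 2 ^ j \<Longrightarrow> near G a u v \<Longrightarrow> u = v"
proof (induction j)
  case (Suc j)
  have uv: "u \<in> ruling G a A j" "v \<in> ruling G a A j" using Suc.prems by auto
  have eq: "u div 2 ^ Suc j = v div 2 ^ Suc j" using Suc.prems by simp
  have near: "near G a u v" "near G a v u" using Suc.prems near_sym[OF G] by auto
  have "odd (u div 2 ^ j) \<longleftrightarrow> odd (v div 2 ^ j)"
    using Suc.prems(1,2) uv eq near by (auto simp del: power_Suc)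
  moreover have "u div 2 ^ j div 2 = v div 2 ^ j div 2" using eq by (simp only: div_pow_Suc)
  ultimately have "u div 2 ^ j = v div 2 ^ j" by (metis div_mult_mod_eq parity_cases)
  then show ?case using Suc.IH uv near by blast
qed simp

definition class_graph :: "(nat \<Rightarrow> nat set) \<Rightarrow> nat \<Rightarrow> nat \<Rightarrow> nat set" where
  "class_graph G j v = {u \<in> G v. u div 2 ^ j = v div 2 ^ j}"

text \<open>The same merging produces a coloring: vertices with bit 0 keep their colors, and those
  with bit 1 choose anew among seven, with their old colors as ranks. Degree at most 6 always leaves
  a choice.\<close>

primrec bit_color :: "(nat \<Rightarrow> nat set) \<Rightarrow> nat \<Rightarrow> nat \<Rightarrow> nat" where
  "bit_color G 0 = (\<lambda>v. 0)"
| "bit_color G (Suc j) = (\<lambda>v. the (greedy (class_graph G (Suc j)) (\<lambda>_. {..<7})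
      (\<lambda>v. if odd (v div 2 ^ j) then Some (bit_color G j v) else None)
      (\<lambda>v. if odd (v div 2 ^ j) then None else Some (bit_color G j v)) 7 v))"

lemma bit_color:
  assumes G: "graph G" and deg: "\<And>v. card (G v) \<le> 6"
  shows "(\<forall>v. bit_color G j v < 7) \<and>
    (\<forall>u v. v \<in> G u \<longrightarrow> u div 2 ^ j = v div 2 ^ j \<longrightarrow> bit_color G j u \<noteq> bit_color G j v)"
proof (induction j)
  case 0
  then show ?case using graphD(2)[OF G] by auto
next
  case (Suc j)
  let ?b = "bit_color G j" and ?H = "class_graph G (Suc j)"
  let ?rk = "\<lambda>v. if odd (v div 2 ^ j) then Some (?b v) else None"
  let ?c = "\<lambda>v. if odd (v div 2 ^ j) then None else Some (?b v)"
  let ?g = "greedy ?H (\<lambda>_. {..<7}) ?rk ?c 7"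
  have IH: "?b v < 7" "v \<in> G u \<Longrightarrow> u div 2 ^ j = v div 2 ^ j \<Longrightarrow> ?b u \<noteq> ?b v" for u v using Suc by auto
  have GH: "graph ?H" using G by (auto simp: graph_def class_graph_def)
  have same: "u div 2 ^ j = v div 2 ^ j" if "v \<in> ?H u" "odd (u div 2 ^ j) \<longleftrightarrow> odd (v div 2 ^ j)" for u v
  proof -
    have "u div 2 ^ j div 2 = v div 2 ^ j div 2" using that by (simp only: class_graph_def div_pow_Suc mem_Collect_eq)
    with that(2) show ?thesis by (metis div_mult_mod_eq parity_cases)
  qed
  have sub: "v \<in> G u" if "v \<in> ?H u" for u v using that by (simp add: class_graph_def)
  have "(\<forall>u v x. v \<in> ?H u \<longrightarrow> ?g u = Some x \<longrightarrow> ?g v \<noteq> Some x) \<and>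
    (\<forall>v. (\<exists>j<7. ?rk v = Some j) \<longrightarrow> (\<exists>x\<in>{..<7}. ?g v = Some x)) \<and>
    (\<forall>v. \<not> (\<exists>j<7. ?rk v = Some j) \<longrightarrow> ?g v = ?c v)"
  proof (rule greedy_correct[OF GH])
    show "?c v \<noteq> Some x" if "v \<in> ?H u" "?c u = Some x" for u v x
      using IH(2)[OF sub[OF that(1)]] same[OF that(1)] that(2) by (auto split: if_splits)
    show "?c v = None" if "?rk v \<noteq> None" for v using that by (auto split: if_splits)
    show "?rk v \<noteq> Some i" if "v \<in> ?H u" "?rk u = Some i" for u v i
      using IH(2)[OF sub[OF that(1)]] same[OF that(1)] that(2) by (auto split: if_splits)
    fix v i
    have "card {u \<in> ?H v. ?c u \<noteq> None \<or> (\<exists>ia<i. ?rk u = Some ia)} \<le> card (G v)"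
      using graphD(3)[OF G] by (intro card_mono) (auto simp: class_graph_def)
    then show "card {u \<in> ?H v. ?c u \<noteq> None \<or> (\<exists>ia<i. ?rk u = Some ia)} < card {..<7::nat}"
      using deg[of v] by simp
  qed
  then have g1: "\<And>u v x. v \<in> ?H u \<Longrightarrow> ?g u = Some x \<Longrightarrow> ?g v \<noteq> Some x"
    and g2: "\<And>v. \<exists>j<7. ?rk v = Some j \<Longrightarrow> \<exists>x\<in>{..<7}. ?g v = Some x"
      "\<And>v. \<not> (\<exists>j<7. ?rk v = Some j) \<Longrightarrow> ?g v = ?c v" by blast+
  have g3: "\<exists>x<7. ?g v = Some x" for v
  proof (cases "odd (v div 2 ^ j)")
    case True
    then have "\<exists>j<7. ?rk v = Some j" using IH(1) by simp
    then show ?thesis using g2(1)[of v] by auto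
  next
    case False
    then have "\<not> (\<exists>j<7. ?rk v = Some j)" by simp
    then have "?g v = ?c v" by (rule g2(2))
    with False show ?thesis using IH(1) by simp
  qed
  have b: "bit_color G (Suc j) v = the (?g v)" for v by simp
  show ?case
  proof (intro conjI allI impI)
    show "bit_color G (Suc j) v < 7" for v unfolding b using g3[of v] by auto
    fix u v assume uv: "v \<in> G u" "u div 2 ^ Suc j = v div 2 ^ Suc j"
    then have "v \<in> ?H u" by (simp add: class_graph_def del: power_Suc)
    then show "bit_color G (Suc j) u \<noteq> bit_color G (Suc j) v"
      unfolding b using g3[of u] g3[of v] g1[of v u] by force
  qed
qed

section \<open>Extending a coloring to the happy vertices\<close>

definition reach :: "('v \<Rightarrow> 'v set) \<Rightarrow> 'v set \<Rightarrow> nat \<Rightarrow> 'v set" where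
  "reach G S t = {v. \<exists>s\<in>S. near G t v s}"

text \<open>Lexicographic order by decreasing distance to \<open>S\<close> and then by \<kappa>,
  whose values will be below 7. Vertices within distance \<open>r\<close> of \<open>S\<close> get no
  rank; the completion of the balls takes care of them.\<close>

definition ranks :: "('v \<Rightarrow> 'v set) \<Rightarrow> 'v set \<Rightarrow> ('v \<Rightarrow> nat) \<Rightarrow> nat \<Rightarrow> nat \<Rightarrow> 'v \<Rightarrow> nat option" where
  "ranks G S \<kappa> r b v = (if v \<in> reach G S b - reach G S r
     then Some ((b - (LEAST t. v \<in> reach G S t)) * 7 + \<kappa> v) else None)"

definition free_colors :: "('v \<Rightarrow> 'v set) \<Rightarrow> ('v \<Rightarrow> 'c set) \<Rightarrow> ('v \<Rightarrow> 'c option) \<Rightarrow> 'v \<Rightarrow> 'c set" where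
  "free_colors M L c u = L u - {x. Some x \<in> c ` M u}"

text \<open>The coloring chosen for a ball depends on its center alone, so all its vertices agree on
  it without further communication. The center is unambiguous because the balls are far
  apart.\<close>

definition complete_balls ::
    "('v \<Rightarrow> 'v set) \<Rightarrow> 'v set \<Rightarrow> nat \<Rightarrow> ('v \<Rightarrow> 'c set) \<Rightarrow> ('v \<Rightarrow> 'c option) \<Rightarrow> 'v \<Rightarrow> 'c" where
  "complete_balls G S r L' c v = (if v \<in> reach G S r
     then (SOME f. proper G L' (ball_in G r (SOME s. s \<in> S \<and> near G r v s)) f) v
     else the (c v))"

text \<open>The vertices near \<open>S\<close> are uncolored and then colored again towards \<open>S\<close>, so that each of
  them outside the balls around \<open>S\<close> still has an uncolored neighbor when it chooses its color.\<close>

definition extend :: "nat \<Rightarrow> nat \<Rightarrow> (nat \<Rightarrow> nat set) \<Rightarrow> (nat \<Rightarrow> 'c set) \<Rightarrow> nat set \<Rightarrow> nat set \<Rightarrow>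
    (nat \<Rightarrow> 'c) \<Rightarrow> nat \<Rightarrow> 'c" where
  "extend d l N L X Y c =
    (let r = 58 * l; a = 2 * r + 1; b = a * l; M = restr N X; G = restr M (low d M);
       S = ruling G a (X - Y) l; rk = ranks G S (bit_color G l) r b;
       c0 = (\<lambda>v. if v \<in> Y - reach G S b then Some (c v) else None);
       c1 = greedy M L rk c0 (7 * (b + 1))
     in complete_balls G S r (free_colors M L c1) c1)"

lemma extend_proper:
  assumes N: "graph N" and YX: "Y \<subseteq> X" and X: "X \<subseteq> {..<2 ^ l}" and d: "d \<le> 6"
    and L: "\<And>v. v \<in> X \<Longrightarrow> finite (L v) \<and> card (L v) = d"
    and c: "proper N L Y c" and hap: "\<And>v. v \<in> X - Y \<Longrightarrow> happy d (58 * l) (restr N X) L v"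
  shows "proper N L X (extend d l N L X Y c)"
proof -
  define r a b where "r = 58 * l" and "a = 2 * r + 1" and "b = a * l"
  define M where "M = restr N X"
  define G where "G = restr M (low d M)"
  define S where "S = ruling G a (X - Y) l"
  define \<kappa> where "\<kappa> = bit_color G l"
  define rk where "rk = ranks G S \<kappa> r b"
  define c0 where "c0 = (\<lambda>v. if v \<in> Y - reach G S b then Some (c v) else None)"
  define c1 where "c1 = greedy M L rk c0 (7 * (b + 1))"
  define L' where "L' = free_colors M L c1"
  have ext: "extend d l N L X Y c = complete_balls G S r L' c1"
    by (simp add: extend_def Let_def r_def a_def b_def M_def G_def S_def \<kappa>_def rk_def c0_def c1_def L'_def)
  have gM: "graph M" and gG: "graph G" using N by (auto simp: M_def G_def intro: graph_restr)
  have GM: "G u \<subseteq> M u" "G u \<subseteq> low d M" for u unfolding G_def by (rule restr_subset)+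
  have MX: "M u \<subseteq> X" "M u \<subseteq> N u" for u unfolding M_def by (rule restr_subset)+
  have Gadj: "w \<in> G u" if "w \<in> M u" "u \<in> low d M" "w \<in> low d M" for u w using that by (simp add: G_def restr_def)
  have SA: "S \<subseteq> X - Y" unfolding S_def by (rule ruling_subset)
  have Slow: "S \<subseteq> low d M" using SA hap by (auto simp: happy_def M_def)
  have reach_low: "reach G S t \<subseteq> low d M \<inter> X" for t
  proof
    fix v assume "v \<in> reach G S t"
    then obtain s where s: "s \<in> S" "near G t v s" by (auto simp: reach_def)
    then have n: "near G t s v" using near_sym[OF gG] by blast
    have "v \<in> low d M" using near_restr[of M "low d M" t s v] n s Slow unfolding G_def by blast
    moreover have "v \<in> X"
    proof -
      have "near M t s v" using near_subgraph[of G M] GM n by blast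
      then show ?thesis using near_restr[of N X t s v] s SA unfolding M_def by blast
    qed
    ultimately show "v \<in> low d M \<inter> X" by blast
  qed
  have AB: "X - Y \<subseteq> reach G S b"
    using ruling_dominates[of _ "X - Y" G a l] by (auto simp: reach_def S_def b_def)
  have reach_mono: "v \<in> reach G S t" if "v \<in> reach G S s" "s \<le> t" for v s t
    using that near_mono by (fastforce simp: reach_def)
  have rb: "reach G S r \<subseteq> reach G S b"
  proof (cases l)
    case 0
    then show ?thesis using reach_mono by (simp add: r_def b_def)
  next
    case (Suc l')
    then have "r \<le> b" by (simp add: b_def a_def)
    then show ?thesis using reach_mono by blast
  qed
  \<comment> \<open>After \<open>l\<close> steps all identifiers in \<open>X\<close> form one class,
    so \<open>ruling\<close> and \<open>bit_color\<close> separate all of them.\<close>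
  have div0: "v div 2 ^ l = 0" if "v \<in> X" for v using that X by auto
  have indep: "u = v" if "u \<in> S" "v \<in> S" "near G a u v" for u v
    using ruling_independent[OF gG, of u a "X - Y" l v] that div0 SA unfolding S_def by (metis DiffD1 subsetD)
  have degG: "card (G v) \<le> 6" for v
  proof (cases "v \<in> low d M")
    case True
    have "card (G v) \<le> card (M v)" using GM graphD(3)[OF gM] by (intro card_mono) auto
    then show ?thesis using True d by (simp add: low_def)
  next
    case False
    then show ?thesis by (simp add: G_def restr_def)
  qed
  have k7: "\<kappa> v < 7" for v using bit_color[OF gG degG] unfolding \<kappa>_def by blast
  have kadj: "\<kappa> u \<noteq> \<kappa> v" if "v \<in> G u" "u \<in> X" "v \<in> X" for u v
    using bit_color[OF gG degG, of l] that div0 unfolding \<kappa>_def by metis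
  define \<tau> where "\<tau> = (\<lambda>v. LEAST t. v \<in> reach G S t)"
  have tau: "v \<in> reach G S (\<tau> v)" "\<tau> v \<le> t" if "v \<in> reach G S t" for v t
    unfolding \<tau>_def using that by (auto intro: LeastI Least_le)
  have rkI: "rk v = (if v \<in> reach G S b - reach G S r then Some ((b - \<tau> v) * 7 + \<kappa> v) else None)" for v
    by (simp add: rk_def ranks_def \<tau>_def)
  \<comment> \<open>The next vertex on a shortest path to \<open>S\<close> is colored later or lies
    in a ball.\<close>
  have down: "\<exists>w\<in>G v. w \<in> reach G S b \<and> (w \<in> reach G S r \<or> Suc (\<tau> w) \<le> \<tau> v)"
    if v: "v \<in> reach G S b - reach G S r" for v
  proof -
    have t: "v \<in> reach G S (\<tau> v)" "\<tau> v \<le> b" using tau v by auto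
    have "\<tau> v \<noteq> 0" using reach_mono[of v 0 r] t(1) v by (metis DiffD2 le0)
    then obtain t' where t': "\<tau> v = Suc t'" by (cases "\<tau> v") auto
    have "v \<notin> reach G S t'" using tau(2)[of v t'] t' by auto
    then obtain s w where "s \<in> S" "w \<in> G v" "near G t' w s" using t(1) t' by (auto simp: reach_def)
    then have w: "w \<in> G v" "w \<in> reach G S t'" by (auto simp: reach_def)
    then have "\<tau> w \<le> t'" using tau by blast
    moreover have "w \<in> reach G S b" using reach_mono[OF w(2)] t(2) t' by simp
    ultimately show ?thesis using w(1) t' by auto
  qed
  have greedy: "(\<forall>u v x. v \<in> M u \<longrightarrow> c1 u = Some x \<longrightarrow> c1 v \<noteq> Some x) \<and>
    (\<forall>v. (\<exists>j<7 * (b + 1). rk v = Some j) \<longrightarrow> (\<exists>x\<in>L v. c1 v = Some x)) \<and>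
    (\<forall>v. \<not> (\<exists>j<7 * (b + 1). rk v = Some j) \<longrightarrow> c1 v = c0 v)"
    unfolding c1_def
  proof (rule greedy_correct[OF gM])
    show "c0 v \<noteq> Some x" if uv: "v \<in> M u" "c0 u = Some x" for u v x
    proof
      assume "c0 v = Some x"
      then have Y: "u \<in> Y" "v \<in> Y" "c u = x" "c v = x" using uv by (auto simp: c0_def split: if_splits)
      have "v \<in> N u \<inter> Y" using uv MX Y by blast
      then have "c u \<noteq> c v" using c Y(1) unfolding proper_def by blast
      then show False using Y by simp
    qed
    show "c0 v = None" if "rk v \<noteq> None" for v using that by (auto simp: rkI c0_def split: if_splits)
    show "rk v \<noteq> Some j" if uv: "v \<in> M u" "rk u = Some j" for u v j
    proof
      assume vj: "rk v = Some j"
      then have R: "u \<in> reach G S b" "v \<in> reach G S b" "(b - \<tau> u) * 7 + \<kappa> u = (b - \<tau> v) * 7 + \<kappa> v"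
        using uv by (auto simp: rkI split: if_splits)
      \<comment> \<open>Reduction modulo 7 recovers \<kappa>, which differs on neighbors.\<close>
      from R(3) have "((b - \<tau> u) * 7 + \<kappa> u) mod 7 = ((b - \<tau> v) * 7 + \<kappa> v) mod 7" by simp
      then have "\<kappa> u = \<kappa> v" using k7[of u] k7[of v] by simp
      moreover have "v \<in> G u" using Gadj[OF uv(1)] R(1,2) reach_low by blast
      ultimately show False using kadj[of v u] R(1,2) reach_low by blast
    qed
    fix v j assume v: "rk v = Some j"
    then have vR: "v \<in> reach G S b - reach G S r" "j = (b - \<tau> v) * 7 + \<kappa> v" by (auto simp: rkI split: if_splits)
    then obtain w where w: "w \<in> G v" "w \<in> reach G S b" "w \<in> reach G S r \<or> Suc (\<tau> w) \<le> \<tau> v" using down by blast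
    have "\<not> (\<exists>i<j. rk w = Some i)"
    proof
      assume "\<exists>i<j. rk w = Some i"
      then have *: "(b - \<tau> w) * 7 + \<kappa> w < j" "w \<notin> reach G S r" by (auto simp: rkI split: if_splits)
      then have "Suc (\<tau> w) \<le> \<tau> v" using w(3) by blast
      moreover have "\<tau> v \<le> b" using tau(2) vR(1) by blast
      ultimately have "Suc (b - \<tau> v) \<le> b - \<tau> w" by linarith
      \<comment> \<open>One unit of distance outweighs any difference in \<kappa>.\<close>
      then have "7 * Suc (b - \<tau> v) \<le> 7 * (b - \<tau> w)" by (rule mult_le_mono2)
      then show False using * vR(2) k7[of v] by simp
    qed
    moreover have "c0 w = None" using w(2) by (simp add: c0_def)
    moreover have wM: "w \<in> M v" using w(1) GM by blast
    ultimately have "{u \<in> M v. c0 u \<noteq> None \<or> (\<exists>i<j. rk u = Some i)} \<subseteq> M v - {w}" by auto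
    then have "card {u \<in> M v. c0 u \<noteq> None \<or> (\<exists>i<j. rk u = Some i)} \<le> card (M v - {w})"
      using graphD(3)[OF gM] by (intro card_mono) auto
    also have "\<dots> < card (M v)" using graphD(3)[OF gM] wM by (rule card_Diff1_less)
    also have "card (M v) \<le> d" using vR(1) reach_low by (auto simp: low_def)
    also have "\<dots> = card (L v)" using vR(1) reach_low L by auto
    finally show "card {u \<in> M v. c0 u \<noteq> None \<or> (\<exists>i<j. rk u = Some i)} < card (L v)" .
  qed
  have g1: "c1 v \<noteq> Some x" if "v \<in> M u" "c1 u = Some x" for u v x using greedy that by blast
  have g2: "\<exists>j<7 * (b + 1). rk v = Some j \<Longrightarrow> \<exists>x\<in>L v. c1 v = Some x"
    "\<not> (\<exists>j<7 * (b + 1). rk v = Some j) \<Longrightarrow> c1 v = c0 v" for v using greedy by blast+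
  have inside: "c1 v = None" if "v \<in> reach G S r" for v
  proof -
    have "rk v = None" using that by (simp add: rkI)
    moreover have "c0 v = None" using that rb by (auto simp: c0_def)
    ultimately show ?thesis using g2(2)[of v] by simp
  qed
  have outside: "\<exists>x\<in>L v. c1 v = Some x" if v: "v \<in> X" "v \<notin> reach G S r" for v
  proof (cases "v \<in> reach G S b")
    case True
    then have "rk v = Some ((b - \<tau> v) * 7 + \<kappa> v)" using v by (simp add: rkI)
    moreover have "(b - \<tau> v) * 7 + \<kappa> v < 7 * (b + 1)" using k7[of v] by simp
    ultimately show ?thesis using g2(1)[of v] by blast
  next
    case False
    then have "v \<in> Y" using AB v by blast
    then have "c v \<in> L v" "c0 v = Some (c v)" using c False by (auto simp: proper_def c0_def)
    moreover have "rk v = None" using False by (simp add: rkI)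
    ultimately show ?thesis using g2(2)[of v] by simp
  qed
  have ballR: "ball_in G r s \<subseteq> reach G S r" if "s \<in> S" for s
    using that near_sym[OF gG] by (auto simp: ball_in_def reach_def)
  have ball: "\<exists>f. proper G L' (ball_in G r s) f" if s: "s \<in> S" for s
  proof -
    let ?B = "ball_in G r s"
    have "happy d r M L s" using hap s SA by (auto simp: M_def r_def)
    then have comp: "completable d M L ?B" by (simp add: happy_def G_def)
    have BZ: "?B \<subseteq> low d M \<inter> X" using ballR[OF s] reach_low by blast
    \<comment> \<open>Inside the ball nothing is colored yet, so each color lost at \<open>u\<close>
      is used by a neighbor outside. This is the premise in \<open>completable\<close>.\<close>
    have "\<forall>u\<in>?B. L' u \<subseteq> L u \<and> finite (L' u) \<and> d + card (M u \<inter> ?B) \<le> card (L' u) + card (M u)"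
    proof (intro ballI conjI)
      fix u assume u: "u \<in> ?B"
      have uX: "u \<in> X" using u BZ by blast
      show "L' u \<subseteq> L u" "finite (L' u)" using L[OF uX] by (auto simp: L'_def free_colors_def)
      have fM: "finite (M u)" by (rule graphD(3)[OF gM])
      have none: "c1 w = None" if "w \<in> ?B" for w using inside ballR[OF s] that by blast
      have used: "{x. Some x \<in> c1 ` M u} \<subseteq> (\<lambda>w. the (c1 w)) ` (M u - ?B)"
      proof
        fix x assume "x \<in> {x. Some x \<in> c1 ` M u}"
        then obtain w where w: "w \<in> M u" "c1 w = Some x" by (metis imageE mem_Collect_eq)
        then have "w \<in> M u - ?B" using none by force
        with w show "x \<in> (\<lambda>w. the (c1 w)) ` (M u - ?B)" by force
      qed
      have "card {x. Some x \<in> c1 ` M u} \<le> card (M u - ?B)"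
        using card_mono[OF _ used] card_image_le[of "M u - ?B" "\<lambda>w. the (c1 w)"] fM by force
      moreover have "card (L u) - card {x. Some x \<in> c1 ` M u} \<le> card (L' u)"
        unfolding L'_def free_colors_def using finite_subset[OF used] fM by (intro diff_card_le_card_Diff) auto
      moreover have "card (M u) = card (M u \<inter> ?B) + card (M u - ?B)"
        using fM by (rule card_Int_Diff)
      ultimately show "d + card (M u \<inter> ?B) \<le> card (L' u) + card (M u)" using L[OF uX] by linarith
    qed
    then obtain f where f: "proper M L' ?B f" using comp unfolding completable_def by blast
    \<comment> \<open>On the ball both graphs agree, since all its vertices are in
      \<open>low d M\<close>. So \<open>complete_balls\<close> can work with \<open>G\<close>
      alone.\<close>
    have "proper G L' ?B f" using f GM unfolding proper_def by (meson IntD1 IntD2 IntI subsetD)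
    then show ?thesis by blast
  qed
  define \<sigma> where "\<sigma> = (\<lambda>v. SOME s. s \<in> S \<and> near G r v s)"
  have sig: "\<sigma> v \<in> S" "near G r v (\<sigma> v)" "v \<in> ball_in G r (\<sigma> v)" if "v \<in> reach G S r" for v
  proof -
    have "\<exists>s. s \<in> S \<and> near G r v s" using that by (auto simp: reach_def)
    then have "\<sigma> v \<in> S \<and> near G r v (\<sigma> v)" unfolding \<sigma>_def by (rule someI_ex)
    then show "\<sigma> v \<in> S" "near G r v (\<sigma> v)" "v \<in> ball_in G r (\<sigma> v)" using near_sym[OF gG] by (auto simp: ball_in_def)
  qed
  define fs where "fs = (\<lambda>s. SOME f. proper G L' (ball_in G r s) f)"
  have fs: "proper G L' (ball_in G r s) (fs s)" if "s \<in> S" for s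
    unfolding fs_def using ball[OF that] by (rule someI_ex)
  have ev: "extend d l N L X Y c v = (if v \<in> reach G S r then fs (\<sigma> v) v else the (c1 v))" for v
    unfolding ext complete_balls_def fs_def \<sigma>_def ..
  have in_L': "fs (\<sigma> v) v \<in> L' v" if "v \<in> reach G S r" for v
    using fs[OF sig(1)[OF that]] sig(3)[OF that] by (simp add: proper_def)
  have cross: "fs (\<sigma> v) v \<noteq> the (c1 w)" if v: "v \<in> reach G S r" and w: "w \<in> M v" "w \<notin> reach G S r" for v w
  proof -
    obtain x where x: "c1 w = Some x" using outside[of w] w MX by blast
    have "Some x \<in> c1 ` M v" using w(1) x by force
    then show ?thesis using in_L'[OF v] x by (auto simp: L'_def free_colors_def)
  qed
  show ?thesis
    unfolding proper_def
  proof (intro ballI conjI)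
    fix u assume u: "u \<in> X"
    show "extend d l N L X Y c u \<in> L u"
    proof (cases "u \<in> reach G S r")
      case True
      then show ?thesis using in_L'[OF True] by (simp add: ev L'_def free_colors_def)
    next
      case False
      then show ?thesis using outside[OF u] by (auto simp: ev)
    qed
    fix w assume w: "w \<in> N u \<inter> X"
    then have uw: "w \<in> M u" "u \<in> M w" using u graphD(1)[OF N, of w u] by (auto simp: M_def restr_def)
    show "extend d l N L X Y c u \<noteq> extend d l N L X Y c w"
    proof (cases "u \<in> reach G S r")
      case uT: True
      show ?thesis
      proof (cases "w \<in> reach G S r")
        case wT: True
        have wG: "w \<in> G u" using Gadj[OF uw(1)] uT wT reach_low by blast
        \<comment> \<open>The choice \<open>a = 2 * r + 1\<close> is what makes balls around
          different centers disjoint and non-adjacent.\<close>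
        have "near G (r + (1 + r)) (\<sigma> u) (\<sigma> w)"
          using near_trans[OF near_sym[OF gG sig(2)[OF uT]] near_trans[of G 1 u w r "\<sigma> w"]] wG sig(2)[OF wT] by simp
        moreover have "r + (1 + r) = a" by (simp add: a_def)
        ultimately have "near G a (\<sigma> u) (\<sigma> w)" by (simp only:)
        then have eq: "\<sigma> u = \<sigma> w" by (rule indep[OF sig(1)[OF uT] sig(1)[OF wT]])
        have "fs (\<sigma> u) u \<noteq> fs (\<sigma> u) w"
          using fs[OF sig(1)[OF uT]] sig(3)[OF uT] sig(3)[OF wT] wG unfolding proper_def eq by blast
        then show ?thesis using uT wT eq by (simp add: ev)
      next
        case False
        then show ?thesis using cross[OF uT uw(1)] uT by (simp add: ev)
      qed
    next
      case uF: False
      show ?thesis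
      proof (cases "w \<in> reach G S r")
        case True
        then show ?thesis using cross[OF True uw(2)] uF by (auto simp: ev)
      next
        case wF: False
        then show ?thesis using outside[OF u uF] outside[of w] w g1[OF uw(1)] uF by (auto simp: ev)
      qed
    qed
  qed
qed

section \<open>Peeling off the happy vertices\<close>

text \<open>The vertices are the elements with a nonempty list.\<close>

primrec layer :: "nat \<Rightarrow> nat \<Rightarrow> ('v \<Rightarrow> 'v set) \<Rightarrow> ('v \<Rightarrow> 'c set) \<Rightarrow> nat \<Rightarrow> 'v set" where
  "layer d r N L 0 = {v. L v \<noteq> {}}"
| "layer d r N L (Suc i) = {v \<in> layer d r N L i. \<not> happy d r (restr N (layer d r N L i)) L v}"

text \<open>After \<open>j\<close> steps layer \<open>p - j\<close> is colored. Layer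
  \<open>p\<close> will be empty, so the initial value is irrelevant.\<close>

primrec layer_color :: "nat \<Rightarrow> nat \<Rightarrow> (nat \<Rightarrow> nat set) \<Rightarrow> (nat \<Rightarrow> 'c set) \<Rightarrow> nat \<Rightarrow> nat \<Rightarrow> nat \<Rightarrow> 'c" where
  "layer_color d l N L p 0 = (\<lambda>v. undefined)"
| "layer_color d l N L p (Suc j) =
     extend d l N L (layer d (58 * l) N L (p - Suc j)) (layer d (58 * l) N L (p - j)) (layer_color d l N L p j)"

lemma soft_cycle_restr:
  assumes "soft_cycle N B" "B \<subseteq> X"
  shows "soft_cycle (restr N X) B"
proof -
  obtain xs v where xs: "cycle N xs" "even (length xs)" "set xs \<subseteq> B" "v \<in> set xs" "card (N v \<inter> set xs) \<le> 2"
    using assms(1) by (auto simp: soft_cycle_def)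
  have mem: "xs ! i \<in> X" if "i < length xs" for i using that xs(3) assms(2) nth_mem by blast
  have l: "0 < length xs" using xs(4) by (cases xs) auto
  have "cycle (restr N X) xs"
    unfolding cycle_def
  proof (intro conjI allI impI)
    show "distinct xs" "3 \<le> length xs" using xs(1) by (auto simp: cycle_def)
    fix i assume i: "i < length xs"
    have "Suc i mod length xs < length xs" using l by simp
    then show "xs ! (Suc i mod length xs) \<in> restr N X (xs ! i)"
      using xs(1) i mem by (simp add: cycle_def restr_def)
  qed
  moreover have "restr N X v \<inter> set xs = N v \<inter> set xs" using xs(3,4) assms(2) by (auto simp: restr_def)
  ultimately show ?thesis unfolding soft_cycle_def using xs by (intro exI[of _ xs] exI[of _ v]) simp
qed

lemma restr_restr: "Y \<subseteq> X \<Longrightarrow> restr (restr N X) Y = restr N Y"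
  by (rule ext) (auto simp: restr_def)

text \<open>This is why \<open>sparse\<close> speaks of balls in all induced subgraphs: the property
  is inherited by every layer.\<close>

lemma sparse_restr:
  assumes "sparse d N V" "X \<subseteq> V"
  shows "sparse d (restr N X) X"
proof -
  have v: "vol (restr N X) Y = vol N Y" if "Y \<subseteq> X" for Y
    unfolding vol_def using that by (intro sum.cong refl arg_cong[of _ _ card]) (auto simp: restr_def)
  have b: "ball_in (restr N Y) i u \<subseteq> X" if "Y \<subseteq> X" "u \<in> Y" for Y i u
    using ball_in_restr[OF that(2)] that(1) by blast
  show ?thesis unfolding sparse_def
  proof (intro conjI allI impI ballI)
    fix Y assume "Y \<subseteq> X" "Y \<noteq> {}"
    then show "vol (restr N X) Y < d * card Y" using assms v unfolding sparse_def by auto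
  next
    fix Y u i assume Y: "Y \<subseteq> X" "u \<in> Y" and "\<not> soft_cycle (restr N X) (ball_in (restr (restr N X) Y) i u)"
    then have "\<not> soft_cycle N (ball_in (restr N Y) i u)"
      using soft_cycle_restr b[OF Y] by (metis restr_restr)
    moreover have "Y \<subseteq> V" using Y assms by blast
    ultimately show "10 * vol (restr N X) (ball_in (restr (restr N X) Y) i u) + 2 * card (ball_in (restr (restr N X) Y) i u)
        \<le> 10 * d * card (ball_in (restr (restr N X) Y) i u)"
      using assms(1) Y(2) v[OF b[OF Y]] unfolding sparse_def restr_restr[OF Y(1)] by auto
  qed
qed

lemma layer_subset: "layer d r N L i \<subseteq> {v. L v \<noteq> {}}"
  by (induction i) auto

lemma pow_doubling:
  assumes "0 < n"
  shows "2 ^ l * n ^ (Suc n * l) \<le> Suc n ^ (Suc n * l)"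
proof -
  have "1 + real (Suc n) * (1 / real n) \<le> (1 + 1 / real n) ^ Suc n"
    by (rule Bernoulli_inequality) (simp add: divide_simps)
  moreover have "2 \<le> 1 + real (Suc n) * (1 / real n)" using assms by (simp add: divide_simps)
  ultimately have "2 \<le> (1 + 1 / real n) ^ Suc n" by linarith
  then have "2 ^ l \<le> ((1 + 1 / real n) ^ Suc n) ^ l" by (intro power_mono) auto
  also have "\<dots> = (1 + 1 / real n) ^ (Suc n * l)" by (simp only: power_mult)
  also have "1 + 1 / real n = real (Suc n) / real n" using assms by (simp add: divide_simps)
  finally have "2 ^ l * real n ^ (Suc n * l) \<le> real (Suc n) ^ (Suc n * l)"
    using assms by (simp add: power_divide pos_le_divide_eq del: of_nat_Suc mult_Suc)
  then have "real (2 ^ l * n ^ (Suc n * l)) \<le> real (Suc n ^ (Suc n * l))"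
    by (simp only: of_nat_mult of_nat_power of_nat_numeral)
  then show ?thesis by (simp only: of_nat_le_iff)
qed

text \<open>Each layer keeps at most 486/487 of the previous one, and 487 such steps at least halve
  the size.\<close>

lemma layer_empty:
  assumes G: "graph N" and V: "finite V" "V = {v. L v \<noteq> {}}" "card V < 2 ^ l"
    and sp: "sparse d N V" and d: "d \<le> 6"
  shows "layer d (58 * l) N L (487 * l) = {}"
proof -
  let ?X = "layer d (58 * l) N L"
  have XV: "?X i \<subseteq> V" for i using layer_subset V(2) by metis
  have fX: "finite (?X i)" for i using XV V(1) finite_subset by blast
  have step: "487 * card (?X (Suc i)) \<le> 486 * card (?X i)" for i
  proof -
    let ?A = "{v \<in> ?X i. happy d (58 * l) (restr N (?X i)) L v}"
    have "card (?X i) \<le> 487 * card ?A"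
    proof (rule many_happy[OF graph_restr[OF G] fX _ sparse_restr[OF sp XV] d])
      show "card (?X i) < 2 ^ l" using card_mono[OF V(1) XV[of i]] V(3) by simp
    qed (rule restr_subset)
    moreover have "card (?X i) = card (?X (Suc i)) + card ?A"
    proof -
      have "finite ?A" by (rule finite_subset[OF _ fX[of i]]) auto
      then have "card (?X (Suc i) \<union> ?A) = card (?X (Suc i)) + card ?A"
        by (intro card_Un_disjoint fX) auto
      moreover have "?X (Suc i) \<union> ?A = ?X i" by auto
      ultimately show ?thesis by simp
    qed
    ultimately show ?thesis by simp
  qed
  have pow: "487 ^ i * card (?X i) \<le> 486 ^ i * card V" for i
  proof (induction i)
    case 0
    then show ?case using card_mono[OF V(1) XV[of 0]] by simp
  next
    case (Suc i)
    have "487 ^ Suc i * card (?X (Suc i)) = 487 ^ i * (487 * card (?X (Suc i)))" by simp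
    also have "\<dots> \<le> 487 ^ i * (486 * card (?X i))" by (intro mult_left_mono step) simp
    also have "\<dots> = 486 * (487 ^ i * card (?X i))" by simp
    also have "\<dots> \<le> 486 * (486 ^ i * card V)" by (intro mult_left_mono Suc) simp
    finally show ?case by simp
  qed
  have b: "2 ^ l * 486 ^ (487 * l) \<le> (487 :: nat) ^ (487 * l)"
    using pow_doubling[of 486 l] by simp
  show ?thesis
  proof (rule ccontr)
    assume "?X (487 * l) \<noteq> {}"
    then have "1 \<le> card (?X (487 * l))" using fX by (simp add: Suc_leI card_gt_0_iff)
    then have "487 ^ (487 * l) * 1 \<le> 487 ^ (487 * l) * card (?X (487 * l))" by (intro mult_left_mono) auto
    also note pow
    finally have "487 ^ (487 * l) \<le> 486 ^ (487 * l) * card V" by simp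
    also have "\<dots> < 486 ^ (487 * l) * 2 ^ l" using V(3) by simp
    finally show False using b by (simp add: mult.commute)
  qed
qed

lemma layer_color_proper:
  assumes G: "graph N" and V: "V = {v. L v \<noteq> {}}" "V \<subseteq> {..<2 ^ l}" "card V < 2 ^ l"
    and sp: "sparse d N V" and d: "d \<le> 6" and L: "\<And>v. v \<in> V \<Longrightarrow> finite (L v) \<and> card (L v) = d"
  shows "proper N L V (layer_color d l N L (487 * l) (487 * l))"
proof -
  let ?X = "layer d (58 * l) N L" and ?p = "487 * l"
  have fV: "finite V" using V(2) finite_subset by blast
  have XV: "?X i \<subseteq> V" for i using layer_subset V(1) by metis
  have "j \<le> ?p \<Longrightarrow> proper N L (?X (?p - j)) (layer_color d l N L ?p j)" for j
  proof (induction j)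
    case 0
    then show ?case using layer_empty[OF G fV V(1,3) sp d] by (simp add: proper_def)
  next
    case (Suc j)
    then obtain i where i: "?p - j = Suc i" "?p - Suc j = i" by (metis Suc_diff_Suc Suc_le_eq)
    show ?case unfolding layer_color.simps i
    proof (rule extend_proper[OF G _ _ d])
      show "?X (Suc i) \<subseteq> ?X i" by auto
      show "?X i \<subseteq> {..<2 ^ l}" using XV V(2) by blast
      show "finite (L v) \<and> card (L v) = d" if "v \<in> ?X i" for v using L XV that by blast
      show "proper N L (?X (Suc i)) (layer_color d l N L ?p j)" using Suc i by simp
      show "happy d (58 * l) (restr N (?X i)) L v" if "v \<in> ?X i - ?X (Suc i)" for v using that by simp
    qed
  qed
  from this[of ?p] show ?thesis using V(1) by simp
qed

section \<open>Locality\<close>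

text \<open>Dependence on the labelled ball of radius \<open>r\<close> only. The ball is taken in
  \<open>N\<close>; by \<open>near_cong\<close> it is the same in \<open>N'\<close>. The vertex
  \<open>v\<close> itself may be used, since vertices will be identifiers.\<close>

definition local_op :: "nat \<Rightarrow> (('v \<Rightarrow> 'v set) \<Rightarrow> ('v \<Rightarrow> 'x) \<Rightarrow> 'v \<Rightarrow> 'y) \<Rightarrow> bool" where
  "local_op r H \<longleftrightarrow> (\<forall>N N' f f' v. (\<forall>u. near N r v u \<longrightarrow> N u = N' u \<and> f u = f' u) \<longrightarrow> H N f v = H N' f' v)"

lemma local_opI:
  "(\<And>N N' f f' v. (\<And>u. near N r v u \<Longrightarrow> N u = N' u) \<Longrightarrow> (\<And>u. near N r v u \<Longrightarrow> f u = f' u) \<Longrightarrow>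
     H N f v = H N' f' v) \<Longrightarrow> local_op r H"
  unfolding local_op_def by blast

lemma local_opD:
  assumes "local_op r H" "\<And>u. near N r v u \<Longrightarrow> N u = N' u" "\<And>u. near N r v u \<Longrightarrow> f u = f' u"
  shows "H N f v = H N' f' v"
  using assms unfolding local_op_def by blast

lemma near_cong:
  assumes "\<And>u. near N r v u \<Longrightarrow> N u = N' u" "s \<le> r"
  shows "near N s v u \<longleftrightarrow> near N' s v u"
  using assms
proof (induction s arbitrary: v r)
  case (Suc s)
  obtain r' where r: "r = Suc r'" "s \<le> r'" using Suc.prems(2) by (cases r) auto
  have Nv: "N v = N' v" by (rule Suc.prems(1)) (rule near_refl)
  have "near N s w u \<longleftrightarrow> near N' s w u" if w: "w \<in> N v" for w
  proof (rule Suc.IH[OF _ r(2)])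
    fix x assume "near N r' w x"
    then have "near N r v x" using w r by auto
    then show "N x = N' x" by (rule Suc.prems(1))
  qed
  moreover have "near N s v u \<longleftrightarrow> near N' s v u"
  proof (rule Suc.IH)
    show "N x = N' x" if "near N r v x" for x using that by (rule Suc.prems(1))
    show "s \<le> r" using Suc.prems(2) by simp
  qed
  ultimately show ?case using Nv by auto
qed simp

lemma local_op_mono:
  fixes H :: "('v \<Rightarrow> 'v set) \<Rightarrow> ('v \<Rightarrow> 'x) \<Rightarrow> 'v \<Rightarrow> 'y"
  assumes H: "local_op s H" and sr: "s \<le> r"
  shows "local_op r H"
proof (rule local_opI)
  fix N N' :: "'v \<Rightarrow> 'v set" and f f' :: "'v \<Rightarrow> 'x" and v
  assume eq: "\<And>u. near N r v u \<Longrightarrow> N u = N' u" "\<And>u. near N r v u \<Longrightarrow> f u = f' u"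
  show "H N f v = H N' f' v"
  proof (rule local_opD[OF H])
    show "N u = N' u" "f u = f' u" if "near N s v u" for u
      using eq near_mono[OF that sr] by blast+
  qed
qed

text \<open>The rule for counting rounds: a subgraph and new labels are computed within radius
  \<open>s\<close>, then \<open>H\<close> is applied to them. As \<open>M\<close> is contained in
  \<open>N\<close>, its balls are not larger than those of \<open>N\<close>, and the radii add
  up.\<close>

lemma local_op_comp:
  fixes H :: "('v \<Rightarrow> 'v set) \<Rightarrow> ('v \<Rightarrow> 'x) \<Rightarrow> 'v \<Rightarrow> 'y" and F :: "('v \<Rightarrow> 'v set) \<Rightarrow> ('v \<Rightarrow> 'z) \<Rightarrow> 'v \<Rightarrow> 'x"
  assumes "local_op s M" "local_op s F" "\<And>N f u. M N f u \<subseteq> N u" "local_op r H"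
  shows "local_op (r + s) (\<lambda>N f v. H (M N f) (F N f) v)"
proof (rule local_opI)
  fix N N' :: "'v \<Rightarrow> 'v set" and f f' :: "'v \<Rightarrow> 'z" and v
  assume eq: "\<And>u. near N (r + s) v u \<Longrightarrow> N u = N' u" "\<And>u. near N (r + s) v u \<Longrightarrow> f u = f' u"
  have *: "M N f u = M N' f' u \<and> F N f u = F N' f' u" if "near (M N f) r v u" for u
  proof -
    have n: "near N r v u" using near_subgraph[of "M N f" N] assms(3) that by blast
    have e: "N x = N' x" "f x = f' x" if "near N s u x" for x using eq near_trans[OF n that] by auto
    show ?thesis using local_opD[OF assms(1), of N u N' f f'] local_opD[OF assms(2), of N u N' f f'] e by auto
  qed
  show "H (M N f) (F N f) v = H (M N' f') (F N' f') v"
    by (rule local_opD[OF assms(4)]) (use * in auto)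
qed

lemma local_op_nbrs: "local_op s (\<lambda>N f. N)"
  by (rule local_opI) simp

lemma local_op_label: "local_op s (\<lambda>N f v. h (f v))"
  by (rule local_opI) simp

lemma local_op_label_nbrs: "local_op s (\<lambda>N f v. h (f v) (N v))"
  by (rule local_opI) simp

lemma local_op_comp_id:
  assumes "local_op s F" "local_op r H"
  shows "local_op (r + s) (\<lambda>N f v. H N (F N f) v)"
  using local_op_comp[OF local_op_nbrs assms(1) _ assms(2)] by simp

lemma local_op_id: "local_op s (\<lambda>N f. f)"
  by (rule local_opI) simp

lemma local_op_map: "local_op s F \<Longrightarrow> local_op s (\<lambda>N f v. h v (F N f v))"
  unfolding local_op_def by metis

lemma local_op_Pair: "local_op s F \<Longrightarrow> local_op s G \<Longrightarrow> local_op s (\<lambda>N f v. (F N f v, G N f v))"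
  unfolding local_op_def by blast

lemma local_op_conj: "local_op s F \<Longrightarrow> local_op s G \<Longrightarrow> local_op s (\<lambda>N f v. F N f v \<and> G N f v)"
  unfolding local_op_def by blast

section \<open>Locality radii of the single operations\<close>

lemma local_restr: "local_op 1 (\<lambda>N f. restr N {u. h (f u)})"
proof (rule local_opI)
  fix N N' :: "'a \<Rightarrow> 'a set" and f f' :: "'a \<Rightarrow> 'b" and v
  assume eq: "\<And>u. near N 1 v u \<Longrightarrow> N u = N' u" "\<And>u. near N 1 v u \<Longrightarrow> f u = f' u"
  have "N v = N' v" "f v = f' v" "\<And>u. u \<in> N v \<Longrightarrow> f u = f' u" using eq by auto
  then show "restr N {u. h (f u)} v = restr N' {u. h (f' u)} v" by (auto simp: restr_def)
qed

lemma local_low_graph: "local_op 1 (\<lambda>N f. restr N (low d N))"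
proof (rule local_opI)
  fix N N' :: "'a \<Rightarrow> 'a set" and f f' :: "'a \<Rightarrow> 'b" and v
  assume eq: "\<And>u. near N 1 v u \<Longrightarrow> N u = N' u"
  have "N v = N' v" "\<And>u. u \<in> N v \<Longrightarrow> N u = N' u" using eq by auto
  then show "restr N (low d N) v = restr N' (low d N') v" by (auto simp: restr_def low_def)
qed

lemma proper_cong:
  assumes "\<And>u. u \<in> B \<Longrightarrow> N u = N' u" "\<And>u. u \<in> B \<Longrightarrow> L u = L' u"
  shows "proper N L B c \<longleftrightarrow> proper N' L' B c"
  using assms unfolding proper_def by simp

lemma completable_cong:
  assumes "\<And>u. u \<in> B \<Longrightarrow> N u = N' u" "\<And>u. u \<in> B \<Longrightarrow> L u = L' u"
  shows "completable d N L B \<longleftrightarrow> completable d N' L' B"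
proof -
  have p: "proper N K B c \<longleftrightarrow> proper N' K B c" for K and c :: "_ \<Rightarrow> 'b"
    by (rule proper_cong) (use assms in auto)
  show ?thesis unfolding completable_def p using assms by simp
qed

lemma local_happy: "local_op (r + 1) (\<lambda>N (L :: 'a \<Rightarrow> 'b set) v. happy d r N L v)"
proof -
  \<comment> \<open>The ball is taken in the low-degree graph, but completability refers to the full
    neighborhoods. These are therefore carried along in the labels.\<close>
  have "local_op r (\<lambda>G (g :: 'a \<Rightarrow> 'b set \<times> 'a set) v. completable d (\<lambda>u. snd (g u)) (\<lambda>u. fst (g u)) (ball_in G r v))"
  proof (rule local_opI)
    fix G G' :: "'a \<Rightarrow> 'a set" and g g' :: "'a \<Rightarrow> 'b set \<times> 'a set" and v
    assume eq: "\<And>u. near G r v u \<Longrightarrow> G u = G' u" "\<And>u. near G r v u \<Longrightarrow> g u = g' u"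
    have "ball_in G r v = ball_in G' r v" using near_cong[where N = G and N' = G' and r = r and s = r and v = v] eq(1) by (auto simp: ball_in_def)
    moreover have "completable d (\<lambda>u. snd (g u)) (\<lambda>u. fst (g u)) (ball_in G r v) \<longleftrightarrow>
        completable d (\<lambda>u. snd (g' u)) (\<lambda>u. fst (g' u)) (ball_in G r v)"
      by (rule completable_cong) (use eq(2) in \<open>auto simp: ball_in_def\<close>)
    ultimately show "completable d (\<lambda>u. snd (g u)) (\<lambda>u. fst (g u)) (ball_in G r v) =
        completable d (\<lambda>u. snd (g' u)) (\<lambda>u. fst (g' u)) (ball_in G' r v)" by simp
  qed
  from local_op_comp[OF local_low_graph local_op_label_nbrs[where h = Pair] _ this]
  have c: "local_op (r + 1) (\<lambda>N (L :: 'a \<Rightarrow> 'b set) v. completable d N L (ball_in (restr N (low d N)) r v))"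
    by (simp add: restr_subset)
  have l: "local_op (r + 1) (\<lambda>N (L :: 'a \<Rightarrow> 'b set) v. v \<in> low d N)"
    using local_op_label_nbrs[of "r + 1" "\<lambda>_ A. card A \<le> d"] by (simp add: low_def)
  show ?thesis unfolding happy_def by (rule local_op_conj[OF l c])
qed

text \<open>A layer costs \<open>r + 1\<close> for happiness and 1 for restricting the graph to the
  layer before.\<close>

lemma local_layer: "local_op (i * (r + 2)) (\<lambda>N (L :: 'a \<Rightarrow> 'b set) v. v \<in> layer d r N L i)"
proof (induction i)
  case 0
  then show ?case using local_op_label[of 0 "\<lambda>A. A \<noteq> {}"] by simp
next
  case (Suc i)
  have F: "local_op (i * (r + 2)) (\<lambda>N (L :: 'a \<Rightarrow> 'b set) v. (L v, v \<in> layer d r N L i))"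
    by (intro local_op_Pair local_op_id Suc)
  have "local_op 1 (\<lambda>N (g :: 'a \<Rightarrow> 'b set \<times> bool). restr N {u. snd (g u)})" by (rule local_restr)
  from local_op_comp[OF this local_op_label[where h = fst] _ local_happy[of r d]]
  have "local_op (r + 2) (\<lambda>N (g :: 'a \<Rightarrow> 'b set \<times> bool) v. happy d r (restr N {u. snd (g u)}) (\<lambda>u. fst (g u)) v)"
    by (simp add: restr_subset)
  then have "local_op (r + 2) (\<lambda>N (g :: 'a \<Rightarrow> 'b set \<times> bool) v. \<not> happy d r (restr N {u. snd (g u)}) (\<lambda>u. fst (g u)) v)"
    by (rule local_op_map)
  then have "local_op (r + 2) (\<lambda>N (g :: 'a \<Rightarrow> 'b set \<times> bool) v. snd (g v) \<and> \<not> happy d r (restr N {u. snd (g u)}) (\<lambda>u. fst (g u)) v)"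
    by (rule local_op_conj[OF local_op_label])
  from local_op_comp_id[OF F this]
  have "local_op ((r + 2) + i * (r + 2)) (\<lambda>N (L :: 'a \<Rightarrow> 'b set) v. v \<in> layer d r N L i \<and>
      \<not> happy d r (restr N (layer d r N L i)) L v)" by simp
  then show ?case by (simp only: layer.simps mult_Suc mem_Collect_eq)
qed

lemma local_ruling: "local_op (j * a) (\<lambda>G f v. v \<in> ruling G a {u. f u} j)"
proof (induction j)
  case 0
  then show ?case using local_op_label[of 0 "\<lambda>x. x"] by simp
next
  case (Suc j)
  have "local_op a (\<lambda>G f (v :: nat). f v \<and> \<not> (odd (v div 2 ^ j) \<and>
     (\<exists>u. f u \<and> even (u div 2 ^ j) \<and> u div 2 ^ Suc j = v div 2 ^ Suc j \<and> near G a v u)))"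
  proof (rule local_opI)
    fix G G' :: "nat \<Rightarrow> nat set" and f f' :: "nat \<Rightarrow> bool" and v
    assume eq: "\<And>u. near G a v u \<Longrightarrow> G u = G' u" "\<And>u. near G a v u \<Longrightarrow> f u = f' u"
    have "f v = f' v" using eq(2) by simp
    moreover have "f u \<and> near G a v u \<longleftrightarrow> f' u \<and> near G' a v u" for u
      using near_cong[where N = G and N' = G' and r = a and s = a and v = v and u = u] eq by auto
    ultimately show "(f v \<and> \<not> (odd (v div 2 ^ j) \<and>
       (\<exists>u. f u \<and> even (u div 2 ^ j) \<and> u div 2 ^ Suc j = v div 2 ^ Suc j \<and> near G a v u))) =
      (f' v \<and> \<not> (odd (v div 2 ^ j) \<and>
       (\<exists>u. f' u \<and> even (u div 2 ^ j) \<and> u div 2 ^ Suc j = v div 2 ^ Suc j \<and> near G' a v u)))" by metis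
  qed
  from local_op_comp_id[OF Suc this] show ?case by (simp add: Bex_def del: power_Suc)
qed

lemma local_greedy:
  "local_op m (\<lambda>N (g :: 'a \<Rightarrow> 'b set \<times> nat option \<times> 'b option). greedy N (\<lambda>u. fst (g u)) (\<lambda>u. fst (snd (g u))) (\<lambda>u. snd (snd (g u))) m)"
proof (induction m)
  case 0
  then show ?case using local_op_label[of 0 "\<lambda>x. snd (snd x)"] by simp
next
  case (Suc m)
  have F: "local_op m (\<lambda>N (g :: 'a \<Rightarrow> 'b set \<times> nat option \<times> 'b option) v.
      (g v, greedy N (\<lambda>u. fst (g u)) (\<lambda>u. fst (snd (g u))) (\<lambda>u. snd (snd (g u))) m v))"
    by (intro local_op_Pair local_op_id Suc)
  have "local_op 1 (\<lambda>N (h :: 'a \<Rightarrow> ('b set \<times> nat option \<times> 'b option) \<times> 'b option) v.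
     if fst (snd (fst (h v))) = Some m then Some (SOME x. x \<in> fst (fst (h v)) \<and> Some x \<notin> (\<lambda>u. snd (h u)) ` N v)
     else snd (h v))"
  proof (rule local_opI)
    fix N N' :: "'a \<Rightarrow> 'a set" and h h' :: "'a \<Rightarrow> ('b set \<times> nat option \<times> 'b option) \<times> 'b option" and v
    assume eq: "\<And>u. near N 1 v u \<Longrightarrow> N u = N' u" "\<And>u. near N 1 v u \<Longrightarrow> h u = h' u"
    have "h v = h' v" "N v = N' v" "(\<lambda>u. snd (h u)) ` N v = (\<lambda>u. snd (h' u)) ` N v"
      using eq by (auto intro!: image_cong)
    then show "(if fst (snd (fst (h v))) = Some m then Some (SOME x. x \<in> fst (fst (h v)) \<and> Some x \<notin> (\<lambda>u. snd (h u)) ` N v)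
       else snd (h v)) = (if fst (snd (fst (h' v))) = Some m then Some (SOME x. x \<in> fst (fst (h' v)) \<and> Some x \<notin> (\<lambda>u. snd (h' u)) ` N' v)
       else snd (h' v))" by simp
  qed
  from local_op_comp_id[OF F this] show ?case by (simp cong: if_cong)
qed

lemma local_bit_color: "local_op (7 * j) (\<lambda>G (f :: nat \<Rightarrow> 'a). bit_color G j)"
proof (induction j)
  case 0
  then show ?case by (simp add: local_op_def)
next
  case (Suc j)
  have sub: "class_graph G (Suc j) u \<subseteq> G u" for G u by (auto simp: class_graph_def)
  have cg: "local_op (7 * j) (\<lambda>G (f :: nat \<Rightarrow> 'a) v. class_graph G (Suc j) v)"
    by (rule local_opI) (simp add: class_graph_def)
  have F: "local_op (7 * j) (\<lambda>G (f :: nat \<Rightarrow> 'a) v. ({..<7::nat},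
      (if odd (v div 2 ^ j) then Some (bit_color G j v) else None),
      (if odd (v div 2 ^ j) then None else Some (bit_color G j v))))"
    using local_op_map[OF Suc, of "\<lambda>v b. ({..<7}, (if odd (v div 2 ^ j) then Some b else None),
      (if odd (v div 2 ^ j) then None else Some b))"] by simp
  have "local_op (7 + 7 * j) (\<lambda>G (f :: nat \<Rightarrow> 'a) v. greedy (class_graph G (Suc j)) (\<lambda>_. {..<7})
      (\<lambda>v. if odd (v div 2 ^ j) then Some (bit_color G j v) else None)
      (\<lambda>v. if odd (v div 2 ^ j) then None else Some (bit_color G j v)) 7 v)"
    using local_op_comp[OF cg F sub local_greedy[of 7]] by simp
  then have "local_op (7 + 7 * j) (\<lambda>G (f :: nat \<Rightarrow> 'a) v. the (greedy (class_graph G (Suc j)) (\<lambda>_. {..<7})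
      (\<lambda>v. if odd (v div 2 ^ j) then Some (bit_color G j v) else None)
      (\<lambda>v. if odd (v div 2 ^ j) then None else Some (bit_color G j v)) 7 v))"
    by (rule local_op_map)
  then show ?case by simp
qed

lemma reach_cong:
  assumes "\<And>u. near G r v u \<Longrightarrow> G u = G' u" "\<And>u. near G r v u \<Longrightarrow> f u = f' u" "t \<le> r"
  shows "v \<in> reach G {u. f u} t \<longleftrightarrow> v \<in> reach G' {u. f' u} t"
proof -
  have "near G t v u \<longleftrightarrow> near G' t v u" for u
    using near_cong[where N = G and N' = G' and r = r and s = t and v = v and u = u] assms(1,3) by blast
  moreover have "near G t v u \<Longrightarrow> f u = f' u" for u using near_mono[of G t v u r] assms(2,3) by blast
  ultimately show ?thesis by (auto simp: reach_def)
qed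

lemma local_reach: "local_op t (\<lambda>G f v. v \<in> reach G {u. f u} t)"
proof (rule local_opI)
  fix G G' :: "'a \<Rightarrow> 'a set" and f f' :: "'a \<Rightarrow> bool" and v
  assume "\<And>u. near G t v u \<Longrightarrow> G u = G' u" "\<And>u. near G t v u \<Longrightarrow> f u = f' u"
  then show "v \<in> reach G {u. f u} t \<longleftrightarrow> v \<in> reach G' {u. f' u} t" by (rule reach_cong) auto
qed

text \<open>In \<open>ranks\<close> the minimum ranges over all distances, of which only a bounded
  number can be checked locally.\<close>

lemma Least_cong_below:
  fixes b :: nat
  assumes "P b" "\<And>t. t \<le> b \<Longrightarrow> P t = Q t"
  shows "Least P = Least Q"
proof (rule antisym)
  have "Q b" using assms by simp
  have "Least P \<le> b" "Least Q \<le> b" by (rule Least_le, fact)+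
  moreover have "P (Least P)" "Q (Least Q)" by (rule LeastI, fact)+
  ultimately have "Q (Least P)" "P (Least Q)" using assms(2)[of "Least P"] assms(2)[of "Least Q"] by simp_all
  then show "Least P \<le> Least Q" "Least Q \<le> Least P" by (simp_all add: Least_le)
qed

lemma local_ranks: "local_op (b + r) (\<lambda>G g. ranks G {u. fst (g u)} (\<lambda>u. snd (g u)) r b)"
proof (rule local_opI)
  fix G G' :: "'a \<Rightarrow> 'a set" and g g' :: "'a \<Rightarrow> bool \<times> nat" and v
  assume eq: "\<And>u. near G (b + r) v u \<Longrightarrow> G u = G' u" "\<And>u. near G (b + r) v u \<Longrightarrow> g u = g' u"
  have R: "v \<in> reach G {u. fst (g u)} t \<longleftrightarrow> v \<in> reach G' {u. fst (g' u)} t" if "t \<le> b + r" for t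
    by (rule reach_cong[where r = "b + r"]) (use eq that in auto)
  have "g v = g' v" using eq(2) by simp
  moreover have "(LEAST t. v \<in> reach G {u. fst (g u)} t) = (LEAST t. v \<in> reach G' {u. fst (g' u)} t)"
    if "v \<in> reach G {u. fst (g u)} b" 
    by (rule Least_cong_below[where b = b]) (use that R in auto)
  ultimately show "ranks G {u. fst (g u)} (\<lambda>u. snd (g u)) r b v = ranks G' {u. fst (g' u)} (\<lambda>u. snd (g' u)) r b v"
    using R[of b] R[of r] by (auto simp: ranks_def)
qed

lemma local_free_colors: "local_op 1 (\<lambda>M g. free_colors M (\<lambda>u. fst (g u)) (\<lambda>u. snd (g u)))"
proof (rule local_opI)
  fix N N' :: "'a \<Rightarrow> 'a set" and h h' :: "'a \<Rightarrow> 'b set \<times> 'b option" and v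
  assume eq: "\<And>u. near N 1 v u \<Longrightarrow> N u = N' u" "\<And>u. near N 1 v u \<Longrightarrow> h u = h' u"
  have "h v = h' v" "N v = N' v" "(\<lambda>u. snd (h u)) ` N v = (\<lambda>u. snd (h' u)) ` N v"
    using eq by (auto intro!: image_cong)
  then show "free_colors N (\<lambda>u. fst (h u)) (\<lambda>u. snd (h u)) v = free_colors N' (\<lambda>u. fst (h' u)) (\<lambda>u. snd (h' u)) v"
    by (simp add: free_colors_def)
qed

text \<open>The center is within distance \<open>r\<close>, and its ball extends by another
  \<open>r\<close>.\<close>

lemma local_complete_balls:
  "local_op (r + r) (\<lambda>G g. complete_balls G {u. fst (g u)} r (\<lambda>u. fst (snd (g u))) (\<lambda>u. snd (snd (g u))))"
proof (rule local_opI)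
  fix G G' :: "'a \<Rightarrow> 'a set" and g g' :: "'a \<Rightarrow> bool \<times> 'b set \<times> 'b option" and v
  assume eq: "\<And>u. near G (r + r) v u \<Longrightarrow> G u = G' u" "\<And>u. near G (r + r) v u \<Longrightarrow> g u = g' u"
  have R: "v \<in> reach G {u. fst (g u)} r \<longleftrightarrow> v \<in> reach G' {u. fst (g' u)} r"
    by (rule reach_cong[where r = "r + r"]) (use eq in auto)
  have gv: "g v = g' v" using eq(2) by simp
  have n: "near G r v s \<longleftrightarrow> near G' r v s" for s
    by (rule near_cong[where r = "r + r"]) (use eq(1) in auto)
  have "fst (g s) \<and> near G r v s \<longleftrightarrow> fst (g' s) \<and> near G' r v s" for s
    using n[of s] eq(2)[of s] near_mono[of G r v s "r + r"] by auto
  then have \<sigma>: "(SOME s. s \<in> {u. fst (g u)} \<and> near G r v s) = (SOME s. s \<in> {u. fst (g' u)} \<and> near G' r v s)" by simp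
  define s where "s = (SOME s. s \<in> {u. fst (g u)} \<and> near G r v s)"
  have "(SOME f. proper G (\<lambda>u. fst (snd (g u))) (ball_in G r s) f) = (SOME f. proper G' (\<lambda>u. fst (snd (g' u))) (ball_in G' r s) f)"
    if v: "v \<in> reach G {u. fst (g u)} r"
  proof -
    have "\<exists>s. s \<in> {u. fst (g u)} \<and> near G r v s" using v by (auto simp: reach_def)
    then have vs: "near G r v s" unfolding s_def by (rule someI2_ex) blast
    have e: "G u = G' u" "g u = g' u" if "near G r s u" for u using eq near_trans[OF vs that] by auto
    have "ball_in G r s = ball_in G' r s" 
      using near_cong[where N = G and N' = G' and r = r and s = r and v = s] e(1) by (auto simp: ball_in_def)
    moreover have "proper G (\<lambda>u. fst (snd (g u))) (ball_in G r s) f \<longleftrightarrow> proper G' (\<lambda>u. fst (snd (g' u))) (ball_in G r s) f" for f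
      by (rule proper_cong) (use e in \<open>auto simp: ball_in_def\<close>)
    ultimately show ?thesis by simp
  qed
  then show "complete_balls G {u. fst (g u)} r (\<lambda>u. fst (snd (g u))) (\<lambda>u. snd (snd (g u))) v =
      complete_balls G' {u. fst (g' u)} r (\<lambda>u. fst (snd (g' u))) (\<lambda>u. snd (snd (g' u))) v"
    using R gv \<sigma> unfolding complete_balls_def s_def by simp
qed

text \<open>The radii of the stages, the last one first: completing the balls, free colors, greedy
  coloring, ranks, and finally the ruling set, the bit coloring and the graph.\<close>

definition extend_rounds :: "nat \<Rightarrow> nat" where
  "extend_rounds l = (let r = 58 * l; a = 2 * r + 1; b = a * l
     in 2 * r + 1 + 7 * (b + 1) + (b + r) + (l * a + 7 * l + 2))"

text \<open>The label of a vertex holds its list, its membership in \<open>X\<close> and in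
  \<open>Y\<close>, and its present color.\<close>

lemma local_extend:
  "local_op (extend_rounds l) (\<lambda>N g. extend d l N (\<lambda>u. fst (g u)) {u. fst (fst (snd (g u)))} {u. snd (fst (snd (g u)))}
     (\<lambda>u. snd (snd (g u))))"
proof -
  define r a b where "r = 58 * l" and "a = 2 * r + 1" and "b = a * l"
  define s1 where "s1 = l * a + 7 * l + 2"
  define s2 where "s2 = (b + r) + s1"
  define s3 where "s3 = 7 * (b + 1) + s2"
  define LL :: "(nat \<Rightarrow> 'a set \<times> (bool \<times> bool) \<times> 'a) \<Rightarrow> nat \<Rightarrow> 'a set" where "LL = (\<lambda>g u. fst (g u))"
  define X :: "(nat \<Rightarrow> 'a set \<times> (bool \<times> bool) \<times> 'a) \<Rightarrow> nat set" where "X = (\<lambda>g. {u. fst (fst (snd (g u)))})"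
  define Y :: "(nat \<Rightarrow> 'a set \<times> (bool \<times> bool) \<times> 'a) \<Rightarrow> nat set" where "Y = (\<lambda>g. {u. snd (fst (snd (g u)))})"
  define C :: "(nat \<Rightarrow> 'a set \<times> (bool \<times> bool) \<times> 'a) \<Rightarrow> nat \<Rightarrow> 'a" where "C = (\<lambda>g u. snd (snd (g u)))"
  define M where "M = (\<lambda>N g. restr N (X g))"
  define G where "G = (\<lambda>N g. restr (M N g) (low d (M N g)))"
  define S where "S = (\<lambda>N g. ruling (G N g) a (X g - Y g) l)"
  define \<kappa> where "\<kappa> = (\<lambda>N g. bit_color (G N g) l)"
  define rk where "rk = (\<lambda>N g. ranks (G N g) (S N g) (\<kappa> N g) r b)"
  define c0 where "c0 = (\<lambda>N g v. if v \<in> Y g - reach (G N g) (S N g) b then Some (C g v) else None)"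
  define c1 where "c1 = (\<lambda>N g. greedy (M N g) (LL g) (rk N g) (c0 N g) (7 * (b + 1)))"
  define L' where "L' = (\<lambda>N g. free_colors (M N g) (LL g) (c1 N g))"
  have MN: "M N g u \<subseteq> N u" for N g u unfolding M_def by (rule restr_subset)
  have GM: "G N g u \<subseteq> M N g u" for N g u unfolding G_def by (rule restr_subset)
  have GN: "G N g u \<subseteq> N u" for N g u using MN GM by blast
  have M: "local_op s M" if "1 \<le> s" for s
    unfolding M_def X_def by (rule local_op_mono[OF local_restr that])
  have G: "local_op s G" if "2 \<le> s" for s
  proof -
    have "local_op (1 + 1) G" unfolding G_def
      by (rule local_op_comp[OF M[OF order_refl] local_op_label[where h = "\<lambda>x. x"] MN local_low_graph])
    then show ?thesis by (rule local_op_mono) (use that in simp)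
  qed
  have "local_op (l * a + 2) (\<lambda>N g v. v \<in> S N g)"
    using local_op_comp[OF G[OF order_refl] local_op_label[where h = "\<lambda>x. fst (fst (snd x)) \<and> \<not> snd (fst (snd x))"] GN local_ruling[of l a]]
    by (simp add: S_def X_def Y_def set_diff_eq)
  then have S: "local_op s1 (\<lambda>N g v. v \<in> S N g)" by (rule local_op_mono) (simp add: s1_def)
  have "local_op (7 * l + 2) \<kappa>" unfolding \<kappa>_def
    by (rule local_op_comp[OF G[OF order_refl] local_op_label[where h = "\<lambda>x. x"] GN local_bit_color[of l]])
  then have K: "local_op s1 \<kappa>" by (rule local_op_mono) (simp add: s1_def)
  have G1: "local_op s1 G" by (rule G) (simp add: s1_def)
  have "local_op (b + s1) (\<lambda>N g v. v \<in> reach (G N g) (S N g) b)"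
    using local_op_comp[OF G1 S GN local_reach[of b]] by simp
  then have re: "local_op s2 (\<lambda>N g v. v \<in> reach (G N g) (S N g) b)" by (rule local_op_mono) (simp add: s2_def)
  have rk: "local_op s2 rk"
    using local_op_comp[OF G1 local_op_Pair[OF S K] GN local_ranks[of b r]] by (simp add: rk_def s2_def)
  have c0: "local_op s2 c0"
    using local_op_map[OF local_op_Pair[OF re local_op_label[where h = snd]],
        of "\<lambda>v (x, y). if snd (fst y) \<and> \<not> x then Some (snd y) else None"]
    by (simp add: c0_def Y_def C_def cong: if_cong)
  have M2: "local_op s2 M" by (rule M) (simp add: s2_def s1_def)
  have c1: "local_op s3 c1"
    using local_op_comp[OF M2 local_op_Pair[OF local_op_label[where h = fst] local_op_Pair[OF rk c0]] MN local_greedy[of "7 * (b + 1)"]]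
    by (simp add: c1_def s3_def LL_def)
  have M3: "local_op s3 M" by (rule M) (simp add: s3_def s2_def s1_def)
  have L': "local_op (1 + s3) L'"
    using local_op_comp[OF M3 local_op_Pair[OF local_op_label[where h = fst] c1] MN local_free_colors]
    by (simp add: L'_def LL_def)
  have c1': "local_op (1 + s3) c1" by (rule local_op_mono[OF c1]) simp
  have S': "local_op (1 + s3) (\<lambda>N g v. v \<in> S N g)" by (rule local_op_mono[OF S]) (simp add: s3_def s2_def)
  have G4: "local_op (1 + s3) G" by (rule G) (simp add: s3_def s2_def s1_def)
  have "local_op ((r + r) + (1 + s3)) (\<lambda>N g. complete_balls (G N g) (S N g) r (L' N g) (c1 N g))"
    using local_op_comp[OF G4 local_op_Pair[OF S' local_op_Pair[OF L' c1']] GN local_complete_balls[of r]]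
    by simp
  moreover have "(r + r) + (1 + s3) = extend_rounds l"
    by (simp add: extend_rounds_def Let_def s3_def s2_def s1_def r_def a_def b_def)
  moreover have "(\<lambda>N g. complete_balls (G N g) (S N g) r (L' N g) (c1 N g)) =
      (\<lambda>N g. extend d l N (\<lambda>u. fst (g u)) {u. fst (fst (snd (g u)))} {u. snd (fst (snd (g u)))} (\<lambda>u. snd (snd (g u))))"
    by (simp add: extend_def Let_def G_def S_def L'_def c1_def M_def c0_def rk_def \<kappa>_def X_def Y_def C_def LL_def
        r_def a_def b_def cong: if_cong)
  ultimately show ?thesis by simp
qed

text \<open>All layers are known within the first summand, as they do not depend on colors; only the
  extensions accumulate.\<close>

lemma local_layer_color:
  "local_op (p * (58 * l + 2) + j * extend_rounds l) (\<lambda>N (L :: nat \<Rightarrow> 'a set). layer_color d l N L p j)"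
proof (induction j)
  case 0
  then show ?case by (simp add: local_op_def)
next
  case (Suc j)
  let ?s = "p * (58 * l + 2) + j * extend_rounds l"
  have lay: "local_op ?s (\<lambda>N (L :: nat \<Rightarrow> 'a set) v. v \<in> layer d (58 * l) N L i)" if "i \<le> p" for i
  proof (rule local_op_mono[OF local_layer])
    show "i * (58 * l + 2) \<le> ?s" using that by (intro trans_le_add1 mult_right_mono) auto
  qed
  have "local_op ?s (\<lambda>N (L :: nat \<Rightarrow> 'a set) v. (L v, (v \<in> layer d (58 * l) N L (p - Suc j), v \<in> layer d (58 * l) N L (p - j)), layer_color d l N L p j v))"
    by (rule local_op_Pair[OF local_op_id local_op_Pair[OF local_op_Pair[OF lay lay] Suc]]) simp_all
  from local_op_comp_id[OF this local_extend[of l d]] show ?case by (simp add: add.assoc add.commute)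
qed

section \<open>Simulating a local function\<close>

text \<open>A \<open>Tree\<close> stores lists only, so some listing of the received set is kept.
  Equal sets have the same listing, and the set can be read off from it.\<close>

definition gather :: "'c data \<Rightarrow> (nat \<times> 'c data) set \<Rightarrow> 'c data" where
  "gather s R = Tree [s, Tree (map (\<lambda>(i, x). Tree [Num i, x]) (SOME xs. set xs = R))]"

primrec view :: "nat \<Rightarrow> nat \<Rightarrow> (nat \<Rightarrow> nat set) \<Rightarrow> (nat \<Rightarrow> 'c set) \<Rightarrow> nat \<Rightarrow> nat \<Rightarrow> 'c data" where
  "view n k N L 0 = (\<lambda>v. Tree [Num n, Num k, Num v, Colors (L v)])"
| "view n k N L (Suc t) = (\<lambda>v. gather (view n k N L t v) ((\<lambda>u. (u, view n k N L t u)) ` N v))"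

lemma gather_inject:
  assumes "finite R" "finite R'" "gather s R = gather s' R'"
  shows "s = s' \<and> R = R'"
proof -
  have ex: "set (SOME xs. set xs = R) = R" if "finite R" for R :: "(nat \<times> 'a data) set"
    using finite_list[OF that] by (rule someI_ex)
  have "inj (\<lambda>(i, x :: 'a data). Tree [Num i, x])" by (auto simp: inj_on_def)
  then have "(SOME xs. set xs = R) = (SOME xs. set xs = R')"
    using assms(3) by (simp add: gather_def inj_map_eq_map)
  then have "R = R'" using ex[OF assms(1)] ex[OF assms(2)] by metis
  then show ?thesis using assms(3) by (simp add: gather_def)
qed

text \<open>An initial view has four children and a gathered one has two, the first being the
  previous view of the same node. So the age of a view and its initial data can be
  recovered.\<close>

lemma view_params:
  assumes "\<And>u. finite (N u)" "\<And>u. finite (N' u)"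
  shows "view n k N L t v = view n' k' N' L' t' v' \<Longrightarrow> t = t' \<and> n = n' \<and> k = k' \<and> v = v'"
proof (induction t arbitrary: t')
  case 0
  then show ?case by (cases t') (auto simp: gather_def)
next
  case (Suc t)
  show ?case
  proof (cases t')
    case 0
    then show ?thesis using Suc.prems by (simp add: gather_def)
  next
    case (Suc t'')
    then have "view n k N L t v = view n' k' N' L' t'' v'"
      using Suc.prems gather_inject[of "(\<lambda>u. (u, view n k N L t u)) ` N v"
          "(\<lambda>u. (u, view n' k' N' L' t'' u)) ` N' v'"] assms by simp
    then show ?thesis using Suc.IH Suc by blast
  qed
qed

text \<open>The extra round is needed because a node learns its own neighbors only from the first
  messages.\<close>

lemma view_near:
  assumes "\<And>u. finite (N u)" "\<And>u. finite (N' u)"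
  shows "view n k N L (Suc t) v = view n k N' L' (Suc t) v \<Longrightarrow> near N t v u \<Longrightarrow> N u = N' u \<and> L u = L' u"
proof (induction t arbitrary: v)
  case 0
  have "view n k N L 0 v = view n k N' L' 0 v \<and>
      (\<lambda>u. (u, view n k N L 0 u)) ` N v = (\<lambda>u. (u, view n k N' L' 0 u)) ` N' v"
    using 0(1) assms by (intro gather_inject) (simp_all del: view.simps(1))
  moreover from this have "fst ` (\<lambda>u. (u, view n k N L 0 u)) ` N v = fst ` (\<lambda>u. (u, view n k N' L' 0 u)) ` N' v" by simp
  then have "N v = N' v" by (simp add: image_image)
  ultimately show ?case using 0(2) by simp
next
  case (Suc t)
  have eq: "view n k N L (Suc t) v = view n k N' L' (Suc t) v \<and>
      (\<lambda>u. (u, view n k N L (Suc t) u)) ` N v = (\<lambda>u. (u, view n k N' L' (Suc t) u)) ` N' v"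
  proof (rule gather_inject)
    show "gather (view n k N L (Suc t) v) ((\<lambda>u. (u, view n k N L (Suc t) u)) ` N v) =
      gather (view n k N' L' (Suc t) v) ((\<lambda>u. (u, view n k N' L' (Suc t) u)) ` N' v)"
      using Suc.prems(1) by (simp only: view.simps(2)[of n k N L "Suc t"] view.simps(2)[of n k N' L' "Suc t"])
  qed (use assms in auto)
  from Suc.prems(2) consider "near N t v u" | w where "w \<in> N v" "near N t w u" by auto
  then show ?case
  proof cases
    case 1
    then show ?thesis using Suc.IH eq by blast
  next
    case (2 w)
    then have "(w, view n k N L (Suc t) w) \<in> (\<lambda>u. (u, view n k N' L' (Suc t) u)) ` N' v"
      using eq by blast
    then have "view n k N L (Suc t) w = view n k N' L' (Suc t) w" by blast
    then show ?thesis using Suc.IH 2 by blast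
  qed
qed

text \<open>A state after \<open>Suc (R n)\<close> rounds determines the labelled ball of radius \<open>R n\<close>, hence the value
  of \<open>F\<close>; any instance that leads to this state may be used to compute it.\<close>

definition simulator ::
    "(nat \<Rightarrow> nat) \<Rightarrow> (nat \<Rightarrow> nat \<Rightarrow> (nat \<Rightarrow> nat set) \<Rightarrow> (nat \<Rightarrow> 'c set) \<Rightarrow> nat \<Rightarrow> 'c) \<Rightarrow> 'c local_algorithm" where
  "simulator R F = \<lparr>
     init = (\<lambda>n k i C. Tree [Num n, Num k, Num i, Colors C]),
     send = (\<lambda>s j. s),
     receive = gather,
     decide = (\<lambda>s. if \<exists>n k N L v. (\<forall>u. finite (N u)) \<and> s = view n k N L (Suc (R n)) v
       then Some (SOME x. \<exists>n k N L v. (\<forall>u. finite (N u)) \<and> s = view n k N L (Suc (R n)) v \<and> x = F n k N L v)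
       else None)\<rparr>"

text \<open>Two instances with the same state have the same parameters and the same labelled ball,
  so locality of \<open>F\<close> makes the choice harmless; the state also reveals the round, so no
  decision is made at another time.\<close>

lemma decide_simulator:
  assumes F: "\<And>n k. local_op (R n) (F n k)" and N: "\<And>u. finite (N u)"
  shows "decide (simulator R F) (view n k N L t v) = (if t = Suc (R n) then Some (F n k N L v) else None)"
proof (cases "t = Suc (R n)")
  case True
  have uniq: "x = F n k N L v"
    if x: "\<exists>n' k' N' L' v'. (\<forall>u. finite (N' u)) \<and> view n k N L t v = view n' k' N' L' (Suc (R n')) v' \<and> x = F n' k' N' L' v'" for x
  proof -
    obtain n' k' N' L' v' where *: "\<And>u. finite (N' u)" "view n k N L t v = view n' k' N' L' (Suc (R n')) v'" "x = F n' k' N' L' v'"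
      using x by blast
    have p: "n = n'" "k = k'" "v = v'" using view_params[OF N *(1) *(2)] by auto
    have e: "N u = N' u" "L u = L' u" if "near N (R n) v u" for u
      using view_near[where N = N and N' = N' and n = n and k = k and L = L and L' = L' and t = "R n" and v = v and u = u] N *(1) *(2) that unfolding True p[symmetric] by auto
    have "F n k N L v = F n k N' L' v" by (rule local_opD[OF F]) (use e in auto)
    then show ?thesis using *(3) p by simp
  qed
  have ex: "(\<forall>u. finite (N u)) \<and> view n k N L t v = view n k N L (Suc (R n)) v" using True N by simp
  then have ex': "\<exists>n' k' N' L' v'. (\<forall>u. finite (N' u)) \<and> view n k N L t v = view n' k' N' L' (Suc (R n')) v'" by blast
  have "\<exists>n' k' N' L' v'. (\<forall>u. finite (N' u)) \<and> view n k N L t v = view n' k' N' L' (Suc (R n')) v' \<and> F n k N L v = F n' k' N' L' v'"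
    using ex by blast
  then have "(SOME x. \<exists>n' k' N' L' v'. (\<forall>u. finite (N' u)) \<and> view n k N L t v = view n' k' N' L' (Suc (R n')) v' \<and>
      x = F n' k' N' L' v') = F n k N L v"
    using uniq by (rule some_equality)
  then show ?thesis using ex' True by (simp add: simulator_def)
next
  case False
  have "\<not> (\<exists>n' k' N' L' v'. (\<forall>u. finite (N' u)) \<and> view n k N L t v = view n' k' N' L' (Suc (R n')) v')"
  proof
    assume "\<exists>n' k' N' L' v'. (\<forall>u. finite (N' u)) \<and> view n k N L t v = view n' k' N' L' (Suc (R n')) v'"
    then obtain n' k' N' L' v' where *: "\<And>u. finite (N' u)" "view n k N L t v = view n' k' N' L' (Suc (R n')) v'" by blast
    then show False using view_params[OF N *(1) *(2)] False by simp
  qed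
  then show ?thesis using False by (simp add: simulator_def)
qed

section \<open>Replacing vertices by their identifiers\<close>

definition id_edges :: "('v \<Rightarrow> nat) \<Rightarrow> 'v set set \<Rightarrow> nat set set" where
  "id_edges ident E = (\<lambda>e. ident ` e) ` E"

text \<open>The empty list marks a number that is not an identifier; \<open>layer\<close> recognizes
  the vertices in this way.\<close>

definition id_lists :: "'v set \<Rightarrow> ('v \<Rightarrow> nat) \<Rightarrow> ('v \<Rightarrow> 'c set) \<Rightarrow> nat \<Rightarrow> 'c set" where
  "id_lists V ident L i = (if i \<in> ident ` V then L (inv_into V ident i) else {})"

lemma nbrs_id_edges:
  assumes g: "simple_graph V E" and inj: "inj_on ident V" and v: "v \<in> V"
  shows "nbrs (id_edges ident E) (ident v) = ident ` {u. {u, v} \<in> E}"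
proof (intro equalityI subsetI)
  fix i assume "i \<in> nbrs (id_edges ident E) (ident v)"
  then obtain e where e: "e \<in> E" "{i, ident v} = ident ` e" by (auto simp: nbrs_def id_edges_def)
  have eV: "e \<subseteq> V" "card e = 2" using g e(1) by (auto simp: simple_graph_def)
  have "ident v \<in> ident ` e" using e(2) by blast
  then have ve: "v \<in> e" using inj eV v by (auto dest: inj_onD)
  then obtain u where u: "e = {u, v}" "u \<noteq> v" using eV(2) by (auto simp: card_2_iff)
  then have "ident u \<noteq> ident v" using inj eV v by (auto dest: inj_onD)
  then have "i = ident u" using e(2) u by (auto simp: doubleton_eq_iff)
  then show "i \<in> ident ` {u. {u, v} \<in> E}" using e(1) u by blast
next
  fix i assume "i \<in> ident ` {u. {u, v} \<in> E}"
  then obtain u where "i = ident u" "{u, v} \<in> E" by blast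
  then show "i \<in> nbrs (id_edges ident E) (ident v)"
    unfolding nbrs_def id_edges_def by (intro CollectI image_eqI[of _ _ "{u, v}"]) auto
qed

lemma state_simulator:
  assumes g: "simple_graph V E" and inj: "inj_on ident V"
  shows "v \<in> V \<Longrightarrow> state_after (simulator R F) k V E ident L t v =
    view (card V) k (nbrs (id_edges ident E)) (id_lists V ident L) t (ident v)"
proof (induction t arbitrary: v)
  case 0
  then show ?case using inj by (simp add: simulator_def id_lists_def)
next
  case (Suc t)
  let ?w = "view (card V) k (nbrs (id_edges ident E)) (id_lists V ident L) t"
  have uV: "u \<in> V" if "{u, v} \<in> E" for u using that g by (auto simp: simple_graph_def)
  have "{(ident u, send (simulator R F) (state_after (simulator R F) k V E ident L t u) (ident v)) | u. {u, v} \<in> E} =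
      (\<lambda>u. (ident u, ?w (ident u))) ` {u. {u, v} \<in> E}"
    using Suc.IH uV by (auto simp: simulator_def)
  also have "\<dots> = (\<lambda>i. (i, ?w i)) ` nbrs (id_edges ident E) (ident v)"
    by (simp add: nbrs_id_edges[OF g inj Suc.prems] image_image)
  finally show ?case using Suc.IH[OF Suc.prems] by (simp add: simulator_def)
qed

lemma simulator_output:
  assumes F: "\<And>n k. local_op (R n) (F n k)" and g: "simple_graph V E" and inj: "inj_on ident V" and v: "v \<in> V"
  shows "decided_by (simulator R F) k V E ident L (Suc (R (card V))) v"
    and "output_color (simulator R F) k V E ident L v =
      F (card V) k (nbrs (id_edges ident E)) (id_lists V ident L) (ident v)"
proof -
  have fin: "finite (nbrs (id_edges ident E) u)" for u
  proof -
    have "finite E" using g by (intro finite_subset[of E "Pow V"]) (auto simp: simple_graph_def)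
    moreover have "finite e" if "e \<in> E" for e using that g by (intro card_ge_0_finite) (auto simp: simple_graph_def)
    ultimately have "finite (\<Union>(id_edges ident E))" by (auto simp: id_edges_def)
    then show ?thesis by (rule finite_subset[rotated]) (auto simp: nbrs_def)
  qed
  have d: "decide (simulator R F) (state_after (simulator R F) k V E ident L t v) =
      (if t = Suc (R (card V)) then Some (F (card V) k (nbrs (id_edges ident E)) (id_lists V ident L) (ident v)) else None)" for t
    unfolding state_simulator[OF g inj v] by (rule decide_simulator[OF F fin])
  have some: "decide (simulator R F) (state_after (simulator R F) k V E ident L (Suc (R (card V))) v) \<noteq> None"
    using d[of "Suc (R (card V))"] by (metis option.distinct(1))
  then show "decided_by (simulator R F) k V E ident L (Suc (R (card V))) v"
    unfolding decided_by_def by blast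
  have least: "(LEAST t. decide (simulator R F) (state_after (simulator R F) k V E ident L t v) \<noteq> None) = Suc (R (card V))"
  proof (rule Least_equality)
    show "decide (simulator R F) (state_after (simulator R F) k V E ident L (Suc (R (card V))) v) \<noteq> None"
      by (rule some)
    show "Suc (R (card V)) \<le> t"
      if "decide (simulator R F) (state_after (simulator R F) k V E ident L t v) \<noteq> None" for t
      using that unfolding d by (auto split: if_splits)
  qed
  then show "output_color (simulator R F) k V E ident L v =
      F (card V) k (nbrs (id_edges ident E)) (id_lists V ident L) (ident v)"
    unfolding output_color_def least d by simp
qed

section \<open>Passing to identifiers\<close>

lemma simple_graph_id:
  assumes "simple_graph V E" "inj_on ident V"
  shows "simple_graph (ident ` V) (id_edges ident E)"
  unfolding simple_graph_def
proof (intro conjI ballI)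
  show "finite (ident ` V)" using assms by (simp add: simple_graph_def)
  fix e' assume "e' \<in> id_edges ident E"
  then obtain e where e: "e \<in> E" "e' = ident ` e" by (auto simp: id_edges_def)
  then have "e \<subseteq> V" "card e = 2" using assms(1) by (auto simp: simple_graph_def)
  then show "e' \<subseteq> ident ` V" "card e' = 2" using e inj_on_subset[OF assms(2)] by (auto simp: card_image)
qed

lemma inv_image_id:
  assumes "inj_on ident V" "e \<subseteq> V"
  shows "inv_into V ident ` ident ` e = e"
  using assms by (simp add: inv_into_image_cancel)

lemma planar_id:
  assumes g: "simple_graph V E" and inj: "inj_on ident V" and pl: "planar V E"
  shows "planar (ident ` V) (id_edges ident E)"
proof -
  let ?i = "inv_into V ident"
  from pl obtain p :: "_ \<Rightarrow> complex" and \<gamma> where "inj_on p V \<and>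
      (\<forall>e\<in>E. arc (\<gamma> e) \<and> {pathstart (\<gamma> e), pathfinish (\<gamma> e)} = p ` e \<and> path_image (\<gamma> e) \<inter> p ` V = p ` e) \<and>
      (\<forall>e\<in>E. \<forall>f\<in>E. e \<noteq> f \<longrightarrow> path_image (\<gamma> e) \<inter> path_image (\<gamma> f) \<subseteq> p ` (e \<inter> f))"
    unfolding planar_def by (elim exE) (rule that)
  note * = conjunct1[OF this] conjunct1[OF conjunct2[OF this]] conjunct2[OF conjunct2[OF this]]
  have eV: "e \<subseteq> V" if "e \<in> E" for e using that g by (auto simp: simple_graph_def)
  have undo: "?i ` ident ` e = e" if "e \<subseteq> V" for e by (rule inv_image_id[OF inj that])
  have pim: "(p \<circ> ?i) ` ident ` e = p ` e" if "e \<subseteq> V" for e using undo[OF that] by (metis image_comp)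
  show ?thesis
    unfolding planar_def
  proof (intro exI conjI ballI impI)
    show "inj_on (p \<circ> ?i) (ident ` V)"
    proof (rule comp_inj_on)
      show "inj_on ?i (ident ` V)" by (rule inj_on_inv_into) simp
      show "inj_on p (?i ` ident ` V)" using *(1) undo[of V] by simp
    qed
    fix e' assume "e' \<in> id_edges ident E"
    then obtain e where e: "e \<in> E" "e' = ident ` e" by (auto simp: id_edges_def)
    have be: "?i ` e' = e" "(p \<circ> ?i) ` e' = p ` e" using undo pim eV e by auto
    show "arc ((\<lambda>e. \<gamma> (?i ` e)) e')" "{pathstart ((\<lambda>e. \<gamma> (?i ` e)) e'), pathfinish ((\<lambda>e. \<gamma> (?i ` e)) e')} = (p \<circ> ?i) ` e'"
      "path_image ((\<lambda>e. \<gamma> (?i ` e)) e') \<inter> (p \<circ> ?i) ` ident ` V = (p \<circ> ?i) ` e'"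
      using bspec[OF *(2) e(1)] unfolding be pim[OF order_refl] by simp_all
    fix f' assume f': "f' \<in> id_edges ident E" "e' \<noteq> f'"
    then obtain f where f: "f \<in> E" "f' = ident ` f" by (auto simp: id_edges_def)
    have bf: "?i ` f' = f" using undo eV f by auto
    have "e \<noteq> f" using f'(2) e f by auto
    then have "path_image (\<gamma> e) \<inter> path_image (\<gamma> f) \<subseteq> p ` (e \<inter> f)"
      using bspec[OF bspec[OF *(3) e(1)] f(1)] by simp
    also have "p ` (e \<inter> f) = (p \<circ> ?i) ` (ident ` (e \<inter> f))" using pim[of "e \<inter> f"] eV[OF e(1)] by auto
    also have "ident ` (e \<inter> f) = e' \<inter> f'" using inj_on_image_Int[OF inj eV eV] e f by simp
    finally show "path_image ((\<lambda>e. \<gamma> (?i ` e)) e') \<inter> path_image ((\<lambda>e. \<gamma> (?i ` e)) f') \<subseteq> (p \<circ> ?i) ` (e' \<inter> f')"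
      unfolding be bf .
  qed
qed

lemma cycle_id:
  assumes g: "simple_graph V E" and inj: "inj_on ident V"
    and c: "cycle (nbrs (id_edges ident E)) xs" "set xs \<subseteq> ident ` V"
  shows "is_cycle V E (map (inv_into V ident) xs)"
  unfolding is_cycle_def
proof (intro conjI allI impI)
  let ?i = "inv_into V ident"
  show "set (map ?i xs) \<subseteq> V" using c(2) by (auto intro: inv_into_into)
  show "distinct (map ?i xs)" using c by (auto simp: cycle_def distinct_map intro: inj_on_inv_into)
  show "3 \<le> length (map ?i xs)" using c(1) by (simp add: cycle_def)
  fix j assume j: "j < length (map ?i xs)"
  then have m: "Suc j mod length xs < length xs" by (intro mod_less_divisor) auto
  have "{xs ! (Suc j mod length xs), xs ! j} \<in> id_edges ident E"
    using c(1) j by (simp add: cycle_def nbrs_def)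
  then obtain e where e: "e \<in> E" "{xs ! (Suc j mod length xs), xs ! j} = ident ` e" by (auto simp: id_edges_def)
  have "?i ` {xs ! (Suc j mod length xs), xs ! j} = e"
    unfolding e(2) using inv_image_id[OF inj] e(1) g by (auto simp: simple_graph_def)
  then have "{?i (xs ! j), ?i (xs ! (Suc j mod length xs))} = e" by (simp add: insert_commute)
  then show "{map ?i xs ! j, map ?i xs ! (Suc j mod length (map ?i xs))} \<in> E" using e(1) j m by simp
qed

section \<open>The algorithm\<close>

text \<open>Degrees are compared with lists of exactly \<open>k\<close> colors. An empty list stays
  empty, for it marks a non-vertex.\<close>

definition cut :: "nat \<Rightarrow> 'c set \<Rightarrow> 'c set" where
  "cut k A = (if A = {} then {} else (SOME B. B \<subseteq> A \<and> finite B \<and> card B = k))"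

lemma cut:
  assumes "infinite A \<or> k \<le> card A" "0 < k"
  shows "cut k A \<subseteq> A" "finite (cut k A)" "card (cut k A) = k"
proof -
  have "A \<noteq> {}" using assms by auto
  have "\<exists>B. B \<subseteq> A \<and> finite B \<and> card B = k"
  proof (cases "finite A")
    case True
    then show ?thesis using assms(1) obtain_subset_with_card_n[of k A] by metis
  next
    case False
    then show ?thesis using infinite_arbitrarily_large[of A k] by metis
  qed
  then have "cut k A \<subseteq> A \<and> finite (cut k A) \<and> card (cut k A) = k"
    unfolding cut_def using \<open>A \<noteq> {}\<close> by (simp only: if_False) (rule someI_ex)
  then show "cut k A \<subseteq> A" "finite (cut k A)" "card (cut k A) = k" by auto
qed

text \<open>Strictly less, since identifiers go up to \<open>n\<close> itself.\<close>

definition bits :: "nat \<Rightarrow> nat" where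
  "bits n = (LEAST l. n < 2 ^ l)"

lemma less_bits: "n < 2 ^ bits n"
  unfolding bits_def by (rule LeastI[of _ n]) simp

definition list_color :: "nat \<Rightarrow> nat \<Rightarrow> (nat \<Rightarrow> nat set) \<Rightarrow> (nat \<Rightarrow> 'c set) \<Rightarrow> nat \<Rightarrow> 'c" where
  "list_color n k N L = layer_color k (bits n) N (\<lambda>v. cut k (L v)) (487 * bits n) (487 * bits n)"

definition rounds :: "nat \<Rightarrow> nat" where
  "rounds n = 487 * bits n * (58 * bits n + 2) + 487 * bits n * extend_rounds (bits n)"

lemma local_list_color: "local_op (rounds n) (list_color n k)"
proof -
  have "local_op 0 (\<lambda>N (L :: nat \<Rightarrow> 'a set) v. cut k (L v))" by (rule local_op_label)
  from local_op_comp_id[OF this local_layer_color[of "487 * bits n" "bits n" "487 * bits n" k]]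
  have "local_op (rounds n) (\<lambda>N (L :: nat \<Rightarrow> 'a set). layer_color k (bits n) N (\<lambda>v. cut k (L v)) (487 * bits n) (487 * bits n))"
    by (simp only: rounds_def add_0_right)
  moreover have "(\<lambda>N (L :: nat \<Rightarrow> 'a set). layer_color k (bits n) N (\<lambda>v. cut k (L v)) (487 * bits n) (487 * bits n)) = list_color n k"
    by (intro ext) (simp only: list_color_def)
  ultimately show ?thesis by simp
qed

definition algorithm :: "'c local_algorithm" where
  "algorithm = simulator rounds list_color"

lemma algorithm_finds:
  assumes hk: "(h, k) \<in> {(1, 6), (2, 4), (4, 3)}"
    and P: "\<And>(V :: 'v set) E. P V E \<Longrightarrow> planar V E"
      "\<And>(V :: 'v set) E xs. P V E \<Longrightarrow> is_cycle V E xs \<Longrightarrow> h + 2 \<le> length xs"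
  shows "finds_list_coloring (algorithm :: 'c local_algorithm) (\<lambda>n. Suc (rounds n)) k P"
  unfolding finds_list_coloring_def
proof (intro allI impI)
  fix V :: "'v set" and E ident and L :: "'v \<Rightarrow> 'c set"
  assume A: "simple_graph V E \<and> P V E \<and> identifiers V ident \<and> list_assignment k V L"
  have g: "simple_graph V E" and PV: "P V E" and inj: "inj_on ident V" and idV: "ident ` V \<subseteq> {1..card V}"
    and LL: "\<And>v. v \<in> V \<Longrightarrow> infinite (L v) \<or> k \<le> card (L v)"
    using A by (auto simp: identifiers_def list_assignment_def)
  have k: "0 < k" "k \<le> 6" using hk by auto
  define l where "l = bits (card V)"
  define N where "N = nbrs (id_edges ident E)"
  define L1 where "L1 = (\<lambda>i. cut k (id_lists V ident L i))"
  let ?V = "ident ` V"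
  have g': "simple_graph ?V (id_edges ident E)" by (rule simple_graph_id[OF g inj])
  have L1V: "L1 (ident v) = cut k (L v)" if "v \<in> V" for v
    using that inj by (simp add: L1_def id_lists_def)
  have supp: "?V = {v. L1 v \<noteq> {}}"
  proof -
    have "L1 i = {}" if "i \<notin> ?V" for i using that by (simp add: L1_def id_lists_def cut_def)
    moreover have "L1 (ident v) \<noteq> {}" if "v \<in> V" for v
      using L1V[OF that] cut(3)[OF LL[OF that] k(1)] k(1) by force
    ultimately show ?thesis by blast
  qed
  have c: "card ?V = card V" by (rule card_image[OF inj])
  have p: "proper N L1 ?V (layer_color k l N L1 (487 * l) (487 * l))"
  proof (rule layer_color_proper[OF _ supp _ _ _ k(2)])
    show "graph N" unfolding N_def by (rule graph_nbrs[OF g'])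
    show "?V \<subseteq> {..<2 ^ l}" using idV less_bits[of "card V"] unfolding l_def by fastforce
    show "card ?V < 2 ^ l" unfolding c l_def by (rule less_bits)
    show "sparse k N ?V" unfolding N_def
    proof (rule planar_sparse[OF g' planar_id[OF g inj P(1)[OF PV]] hk])
      show "h + 2 \<le> length xs" if "cycle (nbrs (id_edges ident E)) xs" "set xs \<subseteq> ?V" for xs
        using P(2)[OF PV cycle_id[OF g inj that]] by simp
    qed
    show "finite (L1 v) \<and> card (L1 v) = k" if "v \<in> ?V" for v
      using that L1V cut(2,3)[OF LL k(1)] by auto
  qed
  have out: "output_color algorithm k V E ident L v = layer_color k l N L1 (487 * l) (487 * l) (ident v)"
    if "v \<in> V" for v
    unfolding algorithm_def using simulator_output(2)[OF local_list_color g inj that, where k = k and L = L]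
    by (simp add: list_color_def l_def N_def L1_def)
  show "(\<forall>v\<in>V. decided_by algorithm k V E ident L (Suc (rounds (card V))) v) \<and>
      list_coloring L V E (output_color algorithm k V E ident L)"
    unfolding list_coloring_def coloring_def
  proof (intro conjI ballI impI)
    show "decided_by algorithm k V E ident L (Suc (rounds (card V))) v" if "v \<in> V" for v
      unfolding algorithm_def by (rule simulator_output(1)[OF local_list_color g inj that])
    show "output_color algorithm k V E ident L v \<in> L v" if v: "v \<in> V" for v
      using p v L1V[OF v] cut(1)[OF LL[OF v] k(1)] unfolding out[OF v] proper_def by blast
    fix u v assume uv: "u \<in> V" "v \<in> V" "{u, v} \<in> E"
    have "ident u \<in> N (ident v) \<inter> ?V" using nbrs_id_edges[OF g inj uv(2)] uv unfolding N_def by blast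
    then show "output_color algorithm k V E ident L u \<noteq> output_color algorithm k V E ident L v"
      using p uv(2) unfolding out[OF uv(1)] out[OF uv(2)] proper_def by (metis imageI)
  qed
qed

lemma finds_coloring_of_list_coloring:
  assumes "finds_list_coloring A T k P"
  shows "finds_coloring A T k P"
  unfolding finds_coloring_def
proof (intro allI impI)
  fix V :: "'a set" and E ident
  assume "simple_graph V E \<and> P V E \<and> identifiers V ident"
  moreover have "list_assignment k V (\<lambda>_. {1..k})" by (simp add: list_assignment_def)
  ultimately show "(\<forall>v\<in>V. decided_by A k V E ident (\<lambda>_. {1..k}) (T (card V)) v) \<and>
      k_coloring k V E (output_color A k V E ident (\<lambda>_. {1..k}))"
    using assms unfolding finds_list_coloring_def list_coloring_def k_coloring_def by blast
qed

section \<open>The number of rounds\<close>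

lemma rounds_bound: "Suc (rounds n) \<le> 1000000 * bits n ^ 3" if "0 < n"
proof -
  let ?l = "bits n"
  have "?l \<noteq> 0"
  proof
    assume "?l = 0"
    with less_bits[of n] have "n < 1" by simp
    with that show False by simp
  qed
  then have l: "1 \<le> ?l" by simp
  have l2: "?l \<le> ?l ^ 2" "?l ^ 2 \<le> ?l ^ 3" "1 \<le> ?l ^ 3"
    by (rule self_le_power[OF l], simp) (rule power_increasing[OF _ l], simp, rule one_le_power[OF l])
  have "Suc (rounds n) = 1 + 487 * 2 * ?l + 487 * 58 * ?l ^ 2 + 487 * ?l * extend_rounds ?l"
    by (simp add: rounds_def algebra_simps power2_eq_square)
  also have "extend_rounds ?l = 10 + 190 * ?l + 1044 * ?l ^ 2"
    by (simp add: extend_rounds_def Let_def algebra_simps power2_eq_square)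
  finally have "Suc (rounds n) = 1 + 5844 * ?l + 120776 * ?l ^ 2 + 508428 * ?l ^ 3"
    by (simp add: algebra_simps power2_eq_square power3_eq_cube)
  \<comment> \<open>All powers are at most the cube, and the coefficients add up to 635049.\<close>
  then show ?thesis using l2 by linarith
qed

text \<open>By minimality \<open>2 ^ (bits n - 1) <= n\<close>. The missing bit is absorbed using
  \<open>n >= 2\<close>, and the logarithm of 2 exceeds 1/2.\<close>

lemma bits_le_ln:
  assumes "2 \<le> n"
  shows "real (bits n) \<le> 4 * ln (real n)"
proof -
  obtain l where l: "bits n = Suc l" using less_bits[of n] assms by (cases "bits n") auto
  have "\<not> n < 2 ^ l" using not_less_Least[of l "\<lambda>l. n < 2 ^ l"] l unfolding bits_def by simp
  then have "real (2 ^ l) \<le> real n" by (simp only: of_nat_le_iff not_less)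
  then have "ln (2 ^ l) \<le> ln (real n)" using assms by (subst ln_le_cancel_iff) auto
  then have a: "real l * ln 2 \<le> ln (real n)" by (simp add: ln_realpow)
  have b: "ln 2 \<le> ln (real n)" using assms by simp
  have "1 / 2 \<le> ln (2 :: real)" using ln2_ge_two_thirds by simp
  then have "real (Suc l) * (1 / 2) \<le> real (Suc l) * ln 2" by (intro mult_left_mono) auto
  also have "\<dots> \<le> 2 * ln (real n)" using a b by (simp add: algebra_simps)
  finally show ?thesis by (simp add: l)
qed

lemma rounds_bigo: "(\<lambda>n. real (Suc (rounds n))) \<in> O(\<lambda>n. ln (real n) ^ 3)"
proof (rule bigoI[where c = "64000000"])
  show "\<forall>\<^sub>F n in sequentially. norm (real (Suc (rounds n))) \<le> 64000000 * norm (ln (real n) ^ 3)"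
    using eventually_ge_at_top[of 2]
  proof eventually_elim
    case (elim n)
    have ln: "0 \<le> ln (real n)" using elim by simp
    have "Suc (rounds n) \<le> 1000000 * bits n ^ 3" by (rule rounds_bound) (use elim in simp)
    then have "real (Suc (rounds n)) \<le> real (1000000 * bits n ^ 3)" by (simp only: of_nat_le_iff)
    also have "\<dots> = 1000000 * real (bits n) ^ 3" by simp
    also have "\<dots> \<le> 1000000 * (4 * ln (real n)) ^ 3" using bits_le_ln[OF elim] by (intro mult_left_mono power_mono) auto
    also have "\<dots> = 64000000 * ln (real n) ^ 3" by (simp add: power_mult_distrib)
    finally show ?case using ln by simp
  qed
qed

lemma triangle_free_cycle:
  assumes "triangle_free V E" "is_cycle V E xs"
  shows "4 \<le> length xs"
proof (rule ccontr)
  assume "\<not> 4 \<le> length xs"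
  then have "length xs = 3" using assms(2) by (simp add: is_cycle_def)
  then obtain a b c where xs: "xs = [a, b, c]" by (auto simp: numeral_3_eq_3 length_Suc_conv)
  have "{xs ! i, xs ! (Suc i mod 3)} \<in> E" if "i < 3" for i
    using assms(2) that \<open>length xs = 3\<close> by (simp add: is_cycle_def)
  from this[of 0] this[of 1] this[of 2] have "{a, b} \<in> E" "{b, c} \<in> E" "{a, c} \<in> E"
    unfolding xs by (simp_all add: insert_commute)
  then show False using assms xs unfolding triangle_free_def is_cycle_def by auto
qed

lemma girth_cycle:
  assumes "6 \<le> girth V E" "is_cycle V E xs"
  shows "6 \<le> length xs"
proof -
  have "girth V E \<le> enat (length xs)" unfolding girth_def using assms(2) by (intro INF_lower) simp
  then have "6 \<le> enat (length xs)" using assms(1) by (rule order_trans[rotated])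
  then show ?thesis by (simp add: numeral_eq_enat)
qed

lemma algorithm_planar:
  "finds_list_coloring (algorithm :: 'c local_algorithm) (\<lambda>n. Suc (rounds n)) 6 (\<lambda>(V :: 'v set) E. planar V E)"
proof (rule algorithm_finds[where h = 1])
  show "1 + 2 \<le> length xs" if "is_cycle V E xs" for V :: "'v set" and E xs
    using that by (simp add: is_cycle_def)
qed auto

lemma algorithm_triangle_free:
  "finds_list_coloring (algorithm :: 'c local_algorithm) (\<lambda>n. Suc (rounds n)) 4
     (\<lambda>(V :: 'v set) E. planar V E \<and> triangle_free V E)"
proof (rule algorithm_finds[where h = 2])
  show "2 + 2 \<le> length xs" if "planar V E \<and> triangle_free V E" "is_cycle V E xs" for V :: "'v set" and E xs
    using triangle_free_cycle[of V E xs] that by simp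
qed auto

lemma algorithm_girth:
  "finds_list_coloring (algorithm :: 'c local_algorithm) (\<lambda>n. Suc (rounds n)) 3
     (\<lambda>(V :: 'v set) E. planar V E \<and> 6 \<le> girth V E)"
proof (rule algorithm_finds[where h = 4])
  show "4 + 2 \<le> length xs" if "planar V E \<and> 6 \<le> girth V E" "is_cycle V E xs" for V :: "'v set" and E xs
    using girth_cycle[of V E xs] that by simp
qed auto

text \<open>One algorithm and one bound serve all three cases, because the number of colors is part
  of the input of a node; \<open>B\<close> is the same algorithm with natural numbers as
  colors.\<close>

theorem corollary2p3:
  "\<exists>(A :: 'c local_algorithm) (B :: nat local_algorithm) (T :: nat \<Rightarrow> nat).
    (\<lambda>n. real (T n)) \<in> O(\<lambda>n. ln (real n) ^ 3) \<and>
    finds_list_coloring A T 6 (\<lambda>(V :: 'v set) E. planar V E) \<and>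
    finds_coloring B T 6 (\<lambda>(V :: 'v set) E. planar V E) \<and>
    finds_list_coloring A T 4 (\<lambda>(V :: 'v set) E. planar V E \<and> triangle_free V E) \<and>
    finds_coloring B T 4 (\<lambda>(V :: 'v set) E. planar V E \<and> triangle_free V E) \<and>
    finds_list_coloring A T 3 (\<lambda>(V :: 'v set) E. planar V E \<and> 6 \<le> girth V E) \<and>
    finds_coloring B T 3 (\<lambda>(V :: 'v set) E. planar V E \<and> 6 \<le> girth V E)"
  by (intro exI conjI finds_coloring_of_list_coloring)
    (rule rounds_bigo algorithm_planar algorithm_triangle_free algorithm_girth)+

end
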